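(* Suppose Assumption 1 holds and $\mathcal M$ is a nested candidate model set with sizes $1\le k_1<\dots<k_{M_n}\le p_n$. Then for any estimator $\hat\sigma^2$ of $\sigma^2$ (with finite second moment), $$Q_n(\hat{\mathbf w}|\mathcal M,\mathbf f)\le R_n(\mathbf w^*|\mathcal M,\mathbf f)+\frac{C\sigma^2}{n}\psi(\mathcal M)+\frac{C\sigma}{\sqrt n}[\psi(\mathcal M)]^{1/2}[R_n(\mathbf w^*|\mathcal M,\mathbf f)]^{1/2}+C\rho(n,\mathcal M,\mathbf f,\hat\sigma^2,\sigma^2),$$ where $C>0$ is a constant depending only on the sub-Gaussian parameter of $\epsilon_i$, and $$\rho(n,\mathcal M,\mathbf f,\hat\sigma^2,\sigma^2)=\frac{k_{M_n}}{n\sigma^2}\mathbb E(\hat\sigma^2-\sigma^2)^2+\Big[\frac{k_{M_n}}{n\sigma^2}\mathbb E(\hat\sigma^2-\sigma^2)^2\Big]^{1/2}[R_n(\mathbf w^*|\mathcal M,\mathbf f)]^{1/2}.$$ This holds for every $n$ (non-asymptotically).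
   Context: Setup. For each sample size $n$ we observe $\mathbf y=\mathbf f+\boldsymbol\epsilon\in\mathbb R^n$ with $\mathbf f=\mathbf X\boldsymbol\beta$, where $\mathbf X\in\mathbb R^{n\times p_n}$ is nonstochastic with full column rank, $p_n\le n$, and $\epsilon_1,\dots,\epsilon_n$ are i.i.d. sub-Gaussian with mean $0$ and variance $\sigma^2>0$. Let $\mathbf P_j$ be the orthogonal projection onto the span of the first $j$ columns of $\mathbf X$ ($\mathbf P_0=\mathbf 0$); then $\mathbf P_j-\mathbf P_{j-1}=\boldsymbol\phi_j\boldsymbol\phi_j^\top$ for unit vectors $\boldsymbol\phi_1,\dots,\boldsymbol\phi_{p_n}$ forming an orthonormal basis of the column space of $\mathbf X$. The transformed coefficients are $\theta_j=\boldsymbol\phi_j^\top\mathbf f/\sqrt n$. A nested candidate set is $\mathcal M=\{\{1,\dots,k_m\}:m=1,\dots,M_n\}$ with $1\le k_1<\dots<k_{M_n}\le p_n$; model $m$ gives $\hat{\mathbf f}_m=\mathbf P_{k_m}\mathbf y$. For $\mathbf w\in\mathcal W_{M_n}=\{\mathbf w\in[0,1]^{M_n}:\sum_m w_m=1\}$, the MA estimator is $\hat{\mathbf f}_{\mathbf w|\mathcal M}=\sum_m w_m\hat{\mathbf f}_m=\mathbf P_{\mathbf w|\mathcal M}\mathbf y$, and for deterministic $\mathbf w$, $R_n(\mathbf w|\mathcal M,\mathbf f)=n^{-1}\|\mathbf f-\mathbf P_{\mathbf w|\mathcal M}\mathbf f\|^2+\sigma^2n^{-1}\operatorname{tr}(\mathbf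 P_{\mathbf w|\mathcal M}^\top\mathbf P_{\mathbf w|\mathcal M})$; $\mathbf w^*|\mathcal M$ minimizes it over $\mathcal W_{M_n}$. MMA: with $\hat\sigma^2$ an estimator of $\sigma^2$, $C_n(\mathbf w|\mathcal M,\mathbf y)=n^{-1}\|\mathbf y-\hat{\mathbf f}_{\mathbf w|\mathcal M}\|^2+2\hat\sigma^2n^{-1}\sum_m k_mw_m$, and $\hat{\mathbf w}|\mathcal M$ is a minimizer of $C_n$ over $\mathcal W_{M_n}$. $Q_n(\hat{\mathbf w}|\mathcal M,\mathbf f)$ denotes either $n^{-1}\mathbb E\|\hat{\mathbf f}_{\hat{\mathbf w}|\mathcal M}-\mathbf f\|^2$ or $\mathbb E R_n(\hat{\mathbf w}|\mathcal M,\mathbf f)=n^{-1}\mathbb E\|\mathbf f-\mathbf P_{\hat{\mathbf w}|\mathcal M}\mathbf f\|^2+\sigma^2n^{-1}\mathbb E\operatorname{tr}(\mathbf P_{\hat{\mathbf w}|\mathcal M}^\top\mathbf P_{\hat{\mathbf w}|\mathcal M})$ (the bound holds for both). The quantity $\psi(\mathcal M)$: let $k_0=0$, $S_j=\sum_{l=k_j+1}^{k_{M_n}}\theta_l^2$ for $0\le j\le M_n-1$, $S_{M_n}=0$, $M_n'=\min\{1\le j\le M_n:S_j=0\}$, and $$\psi(\mathcal M)=\Big[M_n\wedge\Big(1+\sum_{j=1}^{M_n-1}\frac{k_{j+1}-k_j}{4k_j}+\sum_{j=1}^{M_n'-1}\frac{S_{j-1}-S_j}{4S_j}\Big)\Big](1+\log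 M_n)^2.$$ Assumption 1: $\limsup_n n^{-1}\|\mathbf f\|^2<\infty$. *)

theory Defs
  imports "HOL-Probability.Probability"
begin

text \<open>Vectors in R^n are represented as functions nat => real, only the
  coordinates i < n being relevant (we keep them zero outside {..<n});
  n x p matrices are functions nat => nat => real (row, column), 0-based.\<close>

definition inner_n :: "nat \<Rightarrow> (nat \<Rightarrow> real) \<Rightarrow> (nat \<Rightarrow> real) \<Rightarrow> real" where
  "inner_n n u v = (\<Sum>i<n. u i * v i)"

definition full_col_rank :: "nat \<Rightarrow> nat \<Rightarrow> (nat \<Rightarrow> nat \<Rightarrow> real) \<Rightarrow> bool" where
  "full_col_rank n p X \<longleftrightarrow>
     (\<forall>c::nat \<Rightarrow> real. (\<forall>i<n. (\<Sum>l<p. c l * X i l) = 0) \<longrightarrow> (\<forall>l<p. c l = 0))"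

definition design_mean :: "nat \<Rightarrow> nat \<Rightarrow> (nat \<Rightarrow> nat \<Rightarrow> real) \<Rightarrow> (nat \<Rightarrow> real) \<Rightarrow> (nat \<Rightarrow> real)" where
  "design_mean n p X \<beta> = (\<lambda>i. if i < n then (\<Sum>l<p. X i l * \<beta> l) else 0)"

definition proj :: "nat \<Rightarrow> (nat \<Rightarrow> nat \<Rightarrow> real) \<Rightarrow> nat \<Rightarrow> (nat \<Rightarrow> real) \<Rightarrow> (nat \<Rightarrow> real)" where
  "proj n X j y = (THE v. (\<exists>c::nat \<Rightarrow> real. \<forall>i. v i = (if i < n then (\<Sum>l<j. c l * X i l) else 0))
        \<and> (\<forall>l<j. inner_n n (\<lambda>i. y i - v i) (\<lambda>i. X i l) = 0))"

definition projmat :: "nat \<Rightarrow> (nat \<Rightarrow> nat \<Rightarrow> real) \<Rightarrow> nat \<Rightarrow> nat \<Rightarrow> nat \<Rightarrow> real" where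
  "projmat n X j = (\<lambda>i i'. proj n X j (\<lambda>l. if l = i' then 1 else 0) i)"

definition mat_vec :: "nat \<Rightarrow> (nat \<Rightarrow> nat \<Rightarrow> real) \<Rightarrow> (nat \<Rightarrow> real) \<Rightarrow> (nat \<Rightarrow> real)" where
  "mat_vec n A y = (\<lambda>i. if i < n then (\<Sum>i'<n. A i i' * y i') else 0)"

definition phi :: "nat \<Rightarrow> (nat \<Rightarrow> nat \<Rightarrow> real) \<Rightarrow> nat \<Rightarrow> (nat \<Rightarrow> real)" where
  "phi n X j = (SOME \<phi>. (\<forall>i. n \<le> i \<longrightarrow> \<phi> i = 0) \<and> inner_n n \<phi> \<phi> = 1 \<and>
      (\<forall>i<n. \<forall>i'<n. projmat n X j i i' - projmat n X (j - 1) i i' = \<phi> i * \<phi> i'))"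

definition theta :: "nat \<Rightarrow> (nat \<Rightarrow> nat \<Rightarrow> real) \<Rightarrow> (nat \<Rightarrow> real) \<Rightarrow> nat \<Rightarrow> real" where
  "theta n X f j = inner_n n (phi n X j) f / sqrt (real n)"

definition nested_sizes :: "nat \<Rightarrow> (nat \<Rightarrow> nat) \<Rightarrow> nat \<Rightarrow> bool" where
  "nested_sizes M k p \<longleftrightarrow> 1 \<le> M \<and> 1 \<le> k 1 \<and> k M \<le> p \<and>
     (\<forall>m. 1 \<le> m \<and> m < M \<longrightarrow> k m < k (Suc m))"

definition S_tail :: "nat \<Rightarrow> (nat \<Rightarrow> nat \<Rightarrow> real) \<Rightarrow> (nat \<Rightarrow> real) \<Rightarrow> nat \<Rightarrow> (nat \<Rightarrow> nat) \<Rightarrow> nat \<Rightarrow> real" where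
  "S_tail n X f M k j = (if j = M then 0 else
      (\<Sum>l\<in>{(if j = 0 then 0 else k j) + 1 .. k M}. (theta n X f l)\<^sup>2))"

definition psi :: "nat \<Rightarrow> (nat \<Rightarrow> nat \<Rightarrow> real) \<Rightarrow> (nat \<Rightarrow> real) \<Rightarrow> nat \<Rightarrow> (nat \<Rightarrow> nat) \<Rightarrow> real" where
  "psi n X f M k =
    (let S = S_tail n X f M k;
         M' = (LEAST j. 1 \<le> j \<and> j \<le> M \<and> S j = 0)
     in min (real M)
          (1 + (\<Sum>j=1..M-1. (real (k (j+1)) - real (k j)) / (4 * real (k j)))
             + (\<Sum>j=1..M'-1. (S (j-1) - S j) / (4 * S j)))
        * (1 + ln (real M))\<^sup>2)"

definition weights :: "nat \<Rightarrow> (nat \<Rightarrow> real) set" where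
  "weights M = {w. (\<forall>m\<in>{1..M}. 0 \<le> w m \<and> w m \<le> 1) \<and> (\<Sum>m=1..M. w m) = 1}"

definition Pw :: "nat \<Rightarrow> (nat \<Rightarrow> nat \<Rightarrow> real) \<Rightarrow> nat \<Rightarrow> (nat \<Rightarrow> nat) \<Rightarrow> (nat \<Rightarrow> real) \<Rightarrow> nat \<Rightarrow> nat \<Rightarrow> real" where
  "Pw n X M k w = (\<lambda>i i'. \<Sum>m=1..M. w m * projmat n X (k m) i i')"

definition risk :: "nat \<Rightarrow> (nat \<Rightarrow> nat \<Rightarrow> real) \<Rightarrow> nat \<Rightarrow> (nat \<Rightarrow> nat) \<Rightarrow> real \<Rightarrow> (nat \<Rightarrow> real) \<Rightarrow> (nat \<Rightarrow> real) \<Rightarrow> real" where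
  "risk n X M k \<sigma> f w =
     (\<Sum>i<n. (f i - mat_vec n (Pw n X M k w) f i)\<^sup>2) / real n
     + \<sigma>\<^sup>2 / real n * (\<Sum>i<n. \<Sum>l<n. (Pw n X M k w l i)\<^sup>2)"

definition mma_crit :: "nat \<Rightarrow> (nat \<Rightarrow> nat \<Rightarrow> real) \<Rightarrow> nat \<Rightarrow> (nat \<Rightarrow> nat) \<Rightarrow> real \<Rightarrow> (nat \<Rightarrow> real) \<Rightarrow> (nat \<Rightarrow> real) \<Rightarrow> real" where
  "mma_crit n X M k s y w =
     (\<Sum>i<n. (y i - mat_vec n (Pw n X M k w) y i)\<^sup>2) / real n
     + 2 * s / real n * (\<Sum>m=1..M. real (k m) * w m)"

text \<open>Noise distribution D on the reals: mean 0, variance sigma^2, and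
  sub-Gaussian with (scale-free) parameter K: E exp(t e) <= exp(t^2 K^2 sigma^2 / 2).\<close>
definition noise_dist :: "real measure \<Rightarrow> real \<Rightarrow> real \<Rightarrow> bool" where
  "noise_dist D \<sigma> K \<longleftrightarrow> prob_space D \<and> sets D = sets borel \<and> \<sigma> > 0 \<and>
     integrable D (\<lambda>x. x) \<and> (\<integral>x. x \<partial>D) = 0 \<and>
     integrable D (\<lambda>x. x\<^sup>2) \<and> (\<integral>x. x\<^sup>2 \<partial>D) = \<sigma>\<^sup>2 \<and>
     (\<forall>t::real. integrable D (\<lambda>x. exp (t * x)) \<and>
        (\<integral>x. exp (t * x) \<partial>D) \<le> exp (t\<^sup>2 * K\<^sup>2 * \<sigma>\<^sup>2 / 2))"

definition noise_space :: "nat \<Rightarrow> real measure \<Rightarrow> (nat \<Rightarrow> real) measure" where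
  "noise_space n D = PiM {..<n} (\<lambda>_. D)"

definition obs :: "nat \<Rightarrow> (nat \<Rightarrow> real) \<Rightarrow> (nat \<Rightarrow> real) \<Rightarrow> (nat \<Rightarrow> real)" where
  "obs n f \<epsilon> = (\<lambda>i. if i < n then f i + \<epsilon> i else 0)"

end

theory Submission
  imports Defs
begin

text \<open>In the coordinates \<open>a\<^sub>l = \<langle>\<phi>\<^sub>l, f\<rangle>\<close>, \<open>e\<^sub>l = \<langle>\<phi>\<^sub>l, \<epsilon>\<rangle>\<close> the averaged projection multiplies by
  \<open>g\<^sub>l = \<Sum>{w\<^sub>m. k\<^sub>m \<ge> l}\<close>, which is nonincreasing in \<open>l\<close>. Comparing the criterion at the selected and
  at the optimal weights bounds risk and loss by the optimal risk, up to sums of \<open>a\<^sub>l e\<^sub>l\<close> and of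
  \<open>e\<^sub>l\<^sup>2 - \<sigma>\<^sup>2\<close> with monotone coefficients. Abel summation and Cauchy--Schwarz reduce these to
  suprema over the candidates of normalised tail sums and partial sums, times the square root of
  \<open>\<Sum> (sqrt d\<^sub>m - sqrt d\<^sub>m\<^sub>-\<^sub>1) / (sqrt d\<^sub>m + sqrt d\<^sub>m\<^sub>-\<^sub>1)\<close> with \<open>d\<close> a size or a tail of the signal; that
  ratio sum is at most the first factor of \<open>\<psi>\<close>. The suprema are over at most \<open>M\<close> variables
  with bounded exponential moments, so their second moments are of order \<open>(1 + ln M)\<^sup>2\<close>. What
  remains is a quadratic inequality for the square root of the expected risk.\<close>

section \<open>Orthonormal bases and the projections\<close>

text \<open>The selected weights depend on the noise, so nothing averages out at them: their noise
  sums are bounded for each outcome, uniformly over monotone coefficient sequences. The optimal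
  weights are fixed, and their noise sums have mean zero. The comparison at the selected weights
  needs deviations in one direction only, hence exponential moments of one sign. The hard deviation
  is that of the sums of \<open>e_l^2 - \<sigma>^2\<close>. The coordinates of the noise are
  independent, but the \<open>e_l\<close> need not be, and the centring must be at the true
  variance, whereas the sub-Gaussian condition controls exponential moments through the larger proxy
  \<open>K^2 \<sigma>^2\<close>. Exchanging the noise, one coordinate at a time, for a Gaussian with
  standard deviation \<open>4 * K * \<sigma>\<close> resolves both; the \<open>64 * K^2\<close> of
  the final constant is \<open>4 * (4 * K)^2\<close>. The bound for the loss also has the square
  root of the risk, not of the loss, on its right. One inequality for the expected risk therefore
  serves both readings of \<open>Q_n\<close>.\<close>

lemma inner_n_commute: "inner_n n u v = inner_n n v u"
  by (simp add: inner_n_def mult.commute)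

lemma inner_n_sum_left: "inner_n n (\<lambda>i. \<Sum>l\<in>L. c l * u l i) v = (\<Sum>l\<in>L. c l * inner_n n (u l) v)"
  unfolding inner_n_def sum_distrib_left sum_distrib_right
  by (subst sum.swap) (simp add: mult.assoc)

lemma inner_n_sum_right: "inner_n n v (\<lambda>i. \<Sum>l\<in>L. c l * u l i) = (\<Sum>l\<in>L. c l * inner_n n v (u l))"
  using inner_n_sum_left[of n c u L v] by (simp add: inner_n_commute)

lemma inner_n_diff_left: "inner_n n (\<lambda>i. u i - v i) w = inner_n n u w - inner_n n v w"
  by (simp add: inner_n_def algebra_simps sum_subtractf)

lemma inner_n_cong: "(\<And>i. i < n \<Longrightarrow> u i = u' i) \<Longrightarrow> (\<And>i. i < n \<Longrightarrow> v i = v' i) \<Longrightarrow> inner_n n u v = inner_n n u' v'"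
  by (simp add: inner_n_def)

lemma inner_n_self_nonneg: "0 \<le> inner_n n u u"
  by (simp add: inner_n_def sum_nonneg)

lemma inner_n_self_eq_0: "inner_n n u u = 0 \<Longrightarrow> i < n \<Longrightarrow> u i = 0"
  unfolding inner_n_def by (subst (asm) sum_nonneg_eq_0_iff) auto

definition orthonormal_on :: "nat \<Rightarrow> nat set \<Rightarrow> (nat \<Rightarrow> nat \<Rightarrow> real) \<Rightarrow> bool" where
  "orthonormal_on n L q \<longleftrightarrow> (\<forall>l\<in>L. \<forall>m\<in>L. inner_n n (q l) (q m) = (if l = m then 1 else 0))"

lemma inner_n_orthonormal_comb:
  assumes "orthonormal_on n L q" "finite L" "m \<in> L"
  shows "inner_n n (\<lambda>i. \<Sum>l\<in>L. c l * q l i) (q m) = c m"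
proof -
  have "inner_n n (\<lambda>i. \<Sum>l\<in>L. c l * q l i) (q m) = (\<Sum>l\<in>L. c l * (if l = m then 1 else 0))"
    unfolding inner_n_sum_left by (rule sum.cong) (use assms in \<open>auto simp: orthonormal_on_def\<close>)
  also have "\<dots> = c m"
    using assms by (simp add: if_distrib[of "\<lambda>x. _ * x"] cong: if_cong)
  finally show ?thesis .
qed

lemma norm_orthonormal_comb:
  assumes "orthonormal_on n L q" "finite L"
  shows "(\<Sum>i<n. (\<Sum>l\<in>L. c l * q l i)\<^sup>2) = (\<Sum>l\<in>L. (c l)\<^sup>2)"
proof -
  have "(\<Sum>i<n. (\<Sum>l\<in>L. c l * q l i)\<^sup>2) = inner_n n (\<lambda>i. \<Sum>l\<in>L. c l * q l i) (\<lambda>i. \<Sum>l\<in>L. c l * q l i)"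
    by (simp add: inner_n_def power2_eq_square)
  also have "\<dots> = (\<Sum>l\<in>L. c l * inner_n n (\<lambda>i. \<Sum>l\<in>L. c l * q l i) (q l))"
    by (rule inner_n_sum_right)
  also have "\<dots> = (\<Sum>l\<in>L. (c l)\<^sup>2)"
    by (rule sum.cong) (simp_all add: inner_n_orthonormal_comb[OF assms] power2_eq_square)
  finally show ?thesis .
qed

text \<open>Pythagoras: the part of \<open>u\<close> outside the span plus the coordinatewise
  errors. The coefficients \<open>c\<close> stay free because they will come from the data
  \<open>y\<close> while \<open>u\<close> is the signal \<open>f\<close> (for the loss) or
  \<open>y\<close> itself (for the criterion).\<close>

lemma norm_diff_orthonormal_comb:
  assumes "orthonormal_on n L q" "finite L"
  shows "(\<Sum>i<n. (u i - (\<Sum>l\<in>L. c l * q l i))\<^sup>2)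
    = (\<Sum>i<n. (u i)\<^sup>2) - (\<Sum>l\<in>L. (inner_n n (q l) u)\<^sup>2) + (\<Sum>l\<in>L. (inner_n n (q l) u - c l)\<^sup>2)"
proof -
  have "(\<Sum>i<n. (u i - (\<Sum>l\<in>L. c l * q l i))\<^sup>2)
     = (\<Sum>i<n. (u i)\<^sup>2) - 2 * inner_n n (\<lambda>i. \<Sum>l\<in>L. c l * q l i) u + (\<Sum>i<n. (\<Sum>l\<in>L. c l * q l i)\<^sup>2)"
    by (simp add: power2_diff sum.distrib sum_subtractf inner_n_def sum_distrib_left mult.assoc mult.left_commute mult.commute)
  also have "\<dots> = (\<Sum>i<n. (u i)\<^sup>2) - 2 * (\<Sum>l\<in>L. c l * inner_n n (q l) u) + (\<Sum>l\<in>L. (c l)\<^sup>2)"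
    by (simp only: inner_n_sum_left norm_orthonormal_comb[OF assms])
  also have "\<dots> = (\<Sum>i<n. (u i)\<^sup>2) - (\<Sum>l\<in>L. (inner_n n (q l) u)\<^sup>2) + (\<Sum>l\<in>L. (inner_n n (q l) u - c l)\<^sup>2)"
    by (simp add: power2_diff sum.distrib sum_subtractf sum_distrib_left mult.assoc mult.left_commute mult.commute)
  finally show ?thesis .
qed

lemma bessel_inequality:
  assumes "orthonormal_on n L q" "finite L"
  shows "(\<Sum>l\<in>L. (inner_n n (q l) u)\<^sup>2) \<le> (\<Sum>i<n. (u i)\<^sup>2)"
proof -
  have "0 \<le> (\<Sum>i<n. (u i - (\<Sum>l\<in>L. inner_n n (q l) u * q l i))\<^sup>2)"
    by (rule sum_nonneg) simp
  then show ?thesis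
    by (simp add: norm_diff_orthonormal_comb[OF assms])
qed

text \<open>Both changes of basis are triangular, so a single basis \<open>q\<close> serves all
  nested column spaces at once: its first vectors span the same space as equally many columns of
  \<open>X\<close>.\<close>

lemma gram_schmidt:
  assumes rank: "full_col_rank n p X" and "j \<le> p"
  shows "\<exists>q. orthonormal_on n {..<j} q \<and>
    (\<forall>l<j. \<exists>c::nat\<Rightarrow>real. \<forall>i<n. q l i = (\<Sum>m\<le>l. c m * X i m)) \<and>
    (\<forall>l<j. \<exists>c::nat\<Rightarrow>real. \<forall>i<n. X i l = (\<Sum>m\<le>l. c m * q m i))"
  using \<open>j \<le> p\<close>
proof (induction j)
  case 0
  then show ?case by (simp add: orthonormal_on_def)
next
  case (Suc j)
  then obtain q where on: "orthonormal_on n {..<j} q"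
    and q1: "\<And>l. l<j \<Longrightarrow> \<exists>c::nat\<Rightarrow>real. \<forall>i<n. q l i = (\<Sum>m\<le>l. c m * X i m)"
    and q2: "\<And>l. l<j \<Longrightarrow> \<exists>c::nat\<Rightarrow>real. \<forall>i<n. X i l = (\<Sum>m\<le>l. c m * q m i)"
    by auto
  from q1 have "\<exists>C. \<forall>l<j. \<forall>i<n. q l i = (\<Sum>m\<le>l. C l m * X i m)"
    by (metis (no_types))
  then obtain C :: "nat \<Rightarrow> nat \<Rightarrow> real" where C: "\<And>l i. l<j \<Longrightarrow> i<n \<Longrightarrow> q l i = (\<Sum>m\<le>l. C l m * X i m)"
    by blast
  define b where "b l = inner_n n (q l) (\<lambda>i. X i j)" for l
  define u where "u i = X i j - (\<Sum>l<j. b l * q l i)" for i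
  \<comment> \<open>Coefficients of the residual \<open>u\<close> with respect to the columns. The
    coefficient of column \<open>j\<close> is 1, so by full rank \<open>u\<close> cannot vanish and
    may be normalised.\<close>
  define d where "d m = (if m = j then 1 else - (\<Sum>l\<in>{l. l < j \<and> m \<le> l}. b l * C l m))" for m
  have u_span: "u i = (\<Sum>m\<le>j. d m * X i m)" if "i < n" for i
  proof -
    have "(\<Sum>l<j. b l * q l i) = (\<Sum>l<j. \<Sum>m\<in>{m. m < j \<and> m \<le> l}. b l * C l m * X i m)"
      by (rule sum.cong[OF refl]) (auto simp: C that sum_distrib_left mult.assoc intro!: sum.cong)
    also have "\<dots> = (\<Sum>m<j. \<Sum>l\<in>{l. l < j \<and> m \<le> l}. b l * C l m * X i m)"
      using sum.swap_restrict[of "{..<j}" "{..<j}" "\<lambda>l m. b l * C l m * X i m" "\<lambda>l m. m \<le> l"] by simp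
    also have "\<dots> = (\<Sum>m<j. - (d m * X i m))"
      by (rule sum.cong) (auto simp: d_def sum_distrib_right)
    finally have "(\<Sum>l<j. b l * q l i) = - (\<Sum>m<j. d m * X i m)"
      by (simp add: sum_negf)
    then show ?thesis
      by (simp add: u_def lessThan_Suc_atMost[symmetric] d_def)
  qed
  have "inner_n n u u \<noteq> 0"
  proof
    assume "inner_n n u u = 0"
    then have "\<forall>i<n. (\<Sum>m\<le>j. d m * X i m) = 0"
      using inner_n_self_eq_0 u_span by metis
    moreover have "(\<Sum>m<p. (if m \<le> j then d m else 0) * X i m) = (\<Sum>m\<le>j. d m * X i m)" for i
      by (rule sum.mono_neutral_cong_right) (use Suc.prems in auto)
    ultimately have "\<forall>i<n. (\<Sum>m<p. (if m \<le> j then d m else 0) * X i m) = 0"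
      by simp
    then have "\<forall>l<p. (if l \<le> j then d l else 0) = 0"
      by (rule rank[unfolded full_col_rank_def, THEN spec[of _ "\<lambda>l. if l \<le> j then d l else 0"], THEN mp])
    then have "(if j \<le> j then d j else 0) = 0" using Suc.prems by (simp only: Suc_le_eq)
    then show False by (simp add: d_def)
  qed
  then have pos: "inner_n n u u > 0"
    using inner_n_self_nonneg[of n u] by linarith
  define r where "r = sqrt (inner_n n u u)"
  have r: "r > 0" "r * r = inner_n n u u"
    using pos by (auto simp: r_def)
  define q' where "q' = q(j := (\<lambda>i. u i / r))"
  have u_orth: "inner_n n u (q l) = 0" if "l < j" for l
  proof -
    have "inner_n n u (q l) = inner_n n (\<lambda>i. X i j) (q l) - inner_n n (\<lambda>i. \<Sum>l<j. b l * q l i) (q l)"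
      unfolding u_def by (rule inner_n_diff_left)
    then show ?thesis
      using that by (simp add: inner_n_orthonormal_comb[OF on]) (simp add: b_def inner_n_commute)
  qed
  have sc: "inner_n n (\<lambda>i. u i / r) v = inner_n n u v / r" "inner_n n v (\<lambda>i. u i / r) = inner_n n v u / r" for v
    by (simp_all add: inner_n_def sum_divide_distrib)
  have u_orth': "inner_n n (q l) u = 0" if "l < j" for l
    using u_orth[OF that] by (simp add: inner_n_commute)
  have on': "orthonormal_on n {..<Suc j} q'"
    using on r u_orth u_orth'
    by (auto simp: orthonormal_on_def q'_def sc less_Suc_eq)
  have "\<exists>c::nat\<Rightarrow>real. \<forall>i<n. q' l i = (\<Sum>m\<le>l. c m * X i m)" if "l < Suc j" for l
  proof (cases "l = j")
    case True
    then show ?thesis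
      by (intro exI[of _ "\<lambda>m. d m / r"]) (simp add: q'_def u_span sum_divide_distrib)
  next
    case False
    then show ?thesis using that q1[of l] by (simp add: q'_def)
  qed
  moreover have "\<exists>c::nat\<Rightarrow>real. \<forall>i<n. X i l = (\<Sum>m\<le>l. c m * q' m i)" if l: "l < Suc j" for l
  proof (cases "l = j")
    case True
    have "X i j = (\<Sum>m<j. b m * q' m i) + r * q' j i" for i
      using r by (simp add: q'_def u_def)
    then have "X i j = (\<Sum>m<j. (b(j := r)) m * q' m i) + (b(j := r)) j * q' j i" for i
      by simp
    then have "\<forall>i<n. X i l = (\<Sum>m\<le>l. (b(j := r)) m * q' m i)"
      unfolding True lessThan_Suc_atMost[symmetric] sum.lessThan_Suc by blast
    then show ?thesis by blast
  next
    case False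
    then obtain c :: "nat \<Rightarrow> real" where "\<forall>i<n. X i l = (\<Sum>m\<le>l. c m * q m i)"
      using l q2[of l] by (metis less_SucE)
    moreover have "(\<Sum>m\<le>l. c m * q' m i) = (\<Sum>m\<le>l. c m * q m i)" for i
      using False l by (intro sum.cong) (auto simp: q'_def)
    ultimately show ?thesis by metis
  qed
  ultimately show ?case using on' by blast
qed

text \<open>\<open>proj\<close> is a definite description, so existence and uniqueness are both due.
  \<open>q1\<close> puts the Fourier sum into the column span, and \<open>q2\<close> carries
  orthogonality over from the basis to the columns.\<close>

lemma proj_eq_orthonormal:
  assumes on: "orthonormal_on n {..<j} q"
    and q1: "\<And>l. l<j \<Longrightarrow> \<exists>c::nat\<Rightarrow>real. \<forall>i<n. q l i = (\<Sum>m\<le>l. c m * X i m)"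
    and q2: "\<And>l. l<j \<Longrightarrow> \<exists>c::nat\<Rightarrow>real. \<forall>i<n. X i l = (\<Sum>m\<le>l. c m * q m i)"
  shows "proj n X j y = (\<lambda>i. if i < n then \<Sum>l<j. inner_n n (q l) y * q l i else 0)"
    (is "_ = ?v")
  unfolding proj_def
proof (rule the_equality)
  from q1 have "\<exists>C. \<forall>l<j. \<forall>i<n. q l i = (\<Sum>m\<le>l. C l m * X i m)"
    by (metis (no_types))
  then obtain C :: "nat \<Rightarrow> nat \<Rightarrow> real" where C: "\<And>l i. l<j \<Longrightarrow> i<n \<Longrightarrow> q l i = (\<Sum>m\<le>l. C l m * X i m)"
    by blast
  define b where "b l = inner_n n (q l) y" for l
  have span: "(\<Sum>l<j. b l * q l i) = (\<Sum>m<j. (\<Sum>l\<in>{l. l < j \<and> m \<le> l}. b l * C l m) * X i m)" if "i < n" for i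
  proof -
    have "(\<Sum>l<j. b l * q l i) = (\<Sum>l<j. \<Sum>m\<in>{m. m < j \<and> m \<le> l}. b l * C l m * X i m)"
      by (rule sum.cong[OF refl]) (auto simp: C that sum_distrib_left mult.assoc intro!: sum.cong)
    also have "\<dots> = (\<Sum>m<j. \<Sum>l\<in>{l. l < j \<and> m \<le> l}. b l * C l m * X i m)"
      using sum.swap_restrict[of "{..<j}" "{..<j}" "\<lambda>l m. b l * C l m * X i m" "\<lambda>l m. m \<le> l"] by simp
    finally show ?thesis by (simp add: sum_distrib_right)
  qed
  have orth: "inner_n n (\<lambda>i. y i - ?v i) (q l) = 0" if "l < j" for l
  proof -
    have "inner_n n ?v (q l) = inner_n n (\<lambda>i. \<Sum>l<j. b l * q l i) (q l)"
      by (rule inner_n_cong) (simp_all add: b_def)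
    also have "\<dots> = inner_n n y (q l)"
      using that by (simp add: inner_n_orthonormal_comb[OF on]) (simp add: b_def inner_n_commute)
    finally show ?thesis
      by (simp only: inner_n_diff_left)
  qed
  have orthX: "inner_n n (\<lambda>i. y i - ?v i) (\<lambda>i. X i l) = 0" if l: "l < j" for l
  proof -
    obtain c :: "nat \<Rightarrow> real" where c: "\<forall>i<n. X i l = (\<Sum>m\<le>l. c m * q m i)"
      using q2[OF l] by blast
    have "inner_n n (\<lambda>i. y i - ?v i) (\<lambda>i. X i l) = inner_n n (\<lambda>i. y i - ?v i) (\<lambda>i. \<Sum>m\<le>l. c m * q m i)"
      by (rule inner_n_cong) (use c in auto)
    also have "\<dots> = (\<Sum>m\<le>l. c m * inner_n n (\<lambda>i. y i - ?v i) (q m))"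
      by (rule inner_n_sum_right)
    also have "\<dots> = 0"
      using l by (intro sum.neutral) (auto simp: orth)
    finally show ?thesis .
  qed
  have ex: "\<exists>c::nat \<Rightarrow> real. \<forall>i. ?v i = (if i < n then (\<Sum>l<j. c l * X i l) else 0)"
    by (intro exI[of _ "\<lambda>m. \<Sum>l\<in>{l. l < j \<and> m \<le> l}. b l * C l m"]) (use span in \<open>auto simp: b_def\<close>)
  show "(\<exists>c::nat \<Rightarrow> real. \<forall>i. ?v i = (if i < n then (\<Sum>l<j. c l * X i l) else 0))
        \<and> (\<forall>l<j. inner_n n (\<lambda>i. y i - ?v i) (\<lambda>i. X i l) = 0)"
    using ex orthX by blast
  fix v :: "nat \<Rightarrow> real"
  assume v: "(\<exists>c::nat \<Rightarrow> real. \<forall>i. v i = (if i < n then (\<Sum>l<j. c l * X i l) else 0))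
        \<and> (\<forall>l<j. inner_n n (\<lambda>i. y i - v i) (\<lambda>i. X i l) = 0)"
  then obtain c :: "nat \<Rightarrow> real" where c: "\<And>i. v i = (if i < n then (\<Sum>l<j. c l * X i l) else 0)"
    by blast
  from ex obtain c' :: "nat \<Rightarrow> real" where c': "\<And>i. ?v i = (if i < n then (\<Sum>l<j. c' l * X i l) else 0)"
    by blast
  \<comment> \<open>The difference of two candidates lies in the column span and is orthogonal to
    it, hence has norm zero.\<close>
  define w where "w i = v i - ?v i" for i
  have w_orth: "inner_n n w (\<lambda>i. X i l) = 0" if "l < j" for l
  proof -
    have "inner_n n w (\<lambda>i. X i l) = inner_n n (\<lambda>i. y i - ?v i) (\<lambda>i. X i l) - inner_n n (\<lambda>i. y i - v i) (\<lambda>i. X i l)"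
      unfolding inner_n_diff_left[symmetric] by (rule inner_n_cong) (simp_all add: w_def)
    then show ?thesis using v orthX[OF that] that by simp
  qed
  have "inner_n n w w = inner_n n w (\<lambda>i. \<Sum>l<j. (c l - c' l) * X i l)"
    by (rule inner_n_cong) (unfold w_def c c', simp_all add: algebra_simps sum_subtractf)
  also have "\<dots> = (\<Sum>l<j. (c l - c' l) * inner_n n w (\<lambda>i. X i l))"
    by (rule inner_n_sum_right)
  also have "\<dots> = 0" by (simp add: w_orth)
  finally have w0: "w i = 0" if "i < n" for i
    using inner_n_self_eq_0 that by blast
  show "v = ?v"
  proof (intro ext)
    fix i
    show "v i = ?v i"
      using w0[of i] c[of i] by (cases "i < n") (simp_all add: w_def)
  qed
qed

text \<open>\<open>phi\<close> is picked by \<open>SOME\<close> and is determined only up to sign: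
  \<open>phi n X j\<close> is plus or minus \<open>q (j - 1)\<close>. Only the outer products are
  known to agree, so orthogonality is read off from the square of the inner product, which depends
  on the outer products alone.\<close>

lemma
  assumes rank: "full_col_rank n p X"
  shows phi_orthonormal: "orthonormal_on n {1..p} (phi n X)"
    and projmat_eq_sum_phi: "j \<le> p \<Longrightarrow> i < n \<Longrightarrow> i' < n \<Longrightarrow>
       projmat n X j i i' = (\<Sum>l=1..j. phi n X l i * phi n X l i')"
proof -
  obtain q where on: "orthonormal_on n {..<p} q"
    and q1: "\<And>l. l<p \<Longrightarrow> \<exists>c::nat\<Rightarrow>real. \<forall>i<n. q l i = (\<Sum>m\<le>l. c m * X i m)"
    and q2: "\<And>l. l<p \<Longrightarrow> \<exists>c::nat\<Rightarrow>real. \<forall>i<n. X i l = (\<Sum>m\<le>l. c m * q m i)"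
    using gram_schmidt[OF rank order_refl] by auto
  have pm: "projmat n X j i i' = (\<Sum>l<j. q l i * q l i')" if "j \<le> p" "i < n" "i' < n" for j i i'
  proof -
    have onj: "orthonormal_on n {..<j} q"
      using on that(1) by (auto simp: orthonormal_on_def)
    have "inner_n n (q l) (\<lambda>i. if i = i' then 1 else 0) = q l i'" for l
      using that by (simp add: inner_n_def if_distrib[of "\<lambda>x. _ * x"] cong: if_cong)
    then show ?thesis
      unfolding projmat_def
      by (subst proj_eq_orthonormal[OF onj]) (use q1 q2 that in \<open>auto simp: mult.commute\<close>)
  qed
  have diff: "projmat n X j i i' - projmat n X (j - 1) i i' = q (j - 1) i * q (j - 1) i'"
    if "1 \<le> j" "j \<le> p" "i < n" "i' < n" for j i i'
    using that by (cases j) (auto simp: pm)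
  have ph: "inner_n n (phi n X j) (phi n X j) = 1 \<and>
      (\<forall>i<n. \<forall>i'<n. phi n X j i * phi n X j i' = q (j - 1) i * q (j - 1) i')" if j: "1 \<le> j" "j \<le> p" for j
  proof -
    let ?P = "\<lambda>\<phi>. (\<forall>i. n \<le> i \<longrightarrow> \<phi> i = 0) \<and> inner_n n \<phi> \<phi> = 1 \<and>
      (\<forall>i<n. \<forall>i'<n. projmat n X j i i' - projmat n X (j - 1) i i' = \<phi> i * \<phi> i')"
    let ?q = "\<lambda>i. if i < n then q (j - 1) i else 0"
    have "inner_n n ?q ?q = inner_n n (q (j-1)) (q (j-1))"
      by (rule inner_n_cong) auto
    also have "\<dots> = 1"
      using on j by (simp add: orthonormal_on_def)
    finally have q_unit: "inner_n n ?q ?q = 1" .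
    have "?P ?q"
    proof (intro conjI allI impI)
      fix i i' assume "i < n" "i' < n"
      then show "projmat n X j i i' - projmat n X (j - 1) i i' = ?q i * ?q i'"
        using diff[OF j, of i i'] by (simp only: if_True)
    qed (simp_all only: q_unit linorder_not_less[symmetric] if_False)
    then have P_phi: "?P (SOME \<phi>. ?P \<phi>)"
      by (rule someI[where P = ?P])
    have phi: "?P (phi n X j)"
      using P_phi unfolding phi_def[of n X j, symmetric] .
    show ?thesis
    proof (intro conjI allI impI)
      fix i i' assume "i < n" "i' < n"
      then show "phi n X j i * phi n X j i' = q (j - 1) i * q (j - 1) i'"
        using phi diff[OF j, of i i'] by metis
    qed (use phi in blast)
  qed
  have "inner_n n (phi n X l) (phi n X m) = 0" if lm: "l \<in> {1..p}" "m \<in> {1..p}" "l \<noteq> m" for l m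
  proof -
    have sq: "(inner_n n u v)\<^sup>2 = (\<Sum>i<n. \<Sum>i'<n. (u i * u i') * (v i * v i'))" for u v
      by (simp add: inner_n_def power2_eq_square sum_product mult.assoc mult.left_commute)
    have "(inner_n n (phi n X l) (phi n X m))\<^sup>2 = (inner_n n (q (l - 1)) (q (m - 1)))\<^sup>2"
      unfolding sq
    proof (intro sum.cong refl)
      fix i i' assume "i \<in> {..<n}" "i' \<in> {..<n}"
      then show "phi n X l i * phi n X l i' * (phi n X m i * phi n X m i')
        = q (l - 1) i * q (l - 1) i' * (q (m - 1) i * q (m - 1) i')"
        using ph[of l] ph[of m] lm by simp
    qed
    also have "\<dots> = 0"
      using on lm by (auto simp: orthonormal_on_def)
    finally show ?thesis by simp
  qed
  then show "orthonormal_on n {1..p} (phi n X)"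
    using ph by (auto simp: orthonormal_on_def)
  assume j: "j \<le> p" and i: "i < n" "i' < n"
  have "(\<Sum>l=1..j. phi n X l i * phi n X l i') = (\<Sum>l=1..j. q (l - 1) i * q (l - 1) i')"
  proof (rule sum.cong)
    fix l assume "l \<in> {1..j}"
    then show "phi n X l i * phi n X l i' = q (l - 1) i * q (l - 1) i'"
      using ph[of l] j i by simp
  qed simp
  also have "\<dots> = (\<Sum>l<j. q l i * q l i')"
    by (rule sum.reindex_bij_witness[of _ Suc "\<lambda>l. l - 1"]) auto
  finally show "projmat n X j i i' = (\<Sum>l=1..j. phi n X l i * phi n X l i')"
    using pm j i by simp
qed

section \<open>Abel summation over the nested candidates\<close>

text \<open>Abel summation with the boundary term kept: the partial sum up to \<open>j\<close> is at
  least \<open>c j * U j\<close>. \<open>U\<close> need not be monotone; it will be the gap between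
  a bound and the sum that it bounds.\<close>

lemma sum_by_parts_antimono_nonneg:
  fixes c U :: "nat \<Rightarrow> real"
  assumes "U 0 = 0" "\<And>m. m \<le> M \<Longrightarrow> 0 \<le> U m" "\<And>m. m \<in> {1..M} \<Longrightarrow> 0 \<le> c m"
    and anti: "\<And>m. 1 \<le> m \<Longrightarrow> m < M \<Longrightarrow> c (Suc m) \<le> c m"
  shows "0 \<le> (\<Sum>m=1..M. c m * (U m - U (m - 1)))"
proof -
  have "c j * U j \<le> (\<Sum>m=1..j. c m * (U m - U (m - 1)))" if "1 \<le> j" "j \<le> M" for j
    using that
  proof (induction j rule: nat_induct_at_least)
    case base
    then show ?case using assms(1) by simp
  next
    case (Suc j)
    have "c (Suc j) * U j \<le> c j * U j"
      using Suc assms(2)[of j] anti[of j] by (intro mult_right_mono) auto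
    then show ?case using Suc by (simp add: algebra_simps)
  qed
  from this[of M] show ?thesis
    using assms(2)[of M] assms(3)[of M] by (cases "M = 0") (auto intro: order_trans[OF mult_nonneg_nonneg])
qed

text \<open>The mirror image for tails: partial sums are at least \<open>- (c j * U j)\<close>, and
  this defect disappears at the end, where \<open>U M = 0\<close>.\<close>

lemma sum_by_parts_mono_nonneg:
  fixes c U :: "nat \<Rightarrow> real"
  assumes "U M = 0" "\<And>m. m \<le> M \<Longrightarrow> 0 \<le> U m" "\<And>m. m \<in> {1..M} \<Longrightarrow> 0 \<le> c m"
    and mono: "\<And>m. 1 \<le> m \<Longrightarrow> m < M \<Longrightarrow> c m \<le> c (Suc m)"
  shows "0 \<le> (\<Sum>m=1..M. c m * (U (m - 1) - U m))"
proof -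
  have "- (c j * U j) \<le> (\<Sum>m=1..j. c m * (U (m - 1) - U m))" if "1 \<le> j" "j \<le> M" for j
    using that
  proof (induction j rule: nat_induct_at_least)
    case base
    then show ?case using assms(2)[of 0] assms(3)[of 1] by (simp add: algebra_simps)
  next
    case (Suc j)
    have "c j * U j \<le> c (Suc j) * U j"
      using Suc assms(2)[of j] mono[of j] by (intro mult_right_mono) auto
    then show ?case using Suc by (simp add: algebra_simps)
  qed
  from this[of M] show ?thesis
    using assms(1) by (cases "M = 0") auto
qed

text \<open>Write \<open>x - y\<close> as
  \<open>sqrt (x^2 - y^2) * sqrt ((x - y) / (x + y))\<close>. With \<open>x\<close> and
  \<open>y\<close> square roots of consecutive sizes or signal tails, the first factor reassembles a
  part of the risk. The second no longer involves the weights and is what \<open>psi\<close>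
  controls.\<close>

lemma weighted_increment_Cauchy_Schwarz:
  fixes c x y :: "'a \<Rightarrow> real"
  assumes xy: "\<And>i. i \<in> I \<Longrightarrow> 0 \<le> y i \<and> y i \<le> x i"
  shows "(\<Sum>i\<in>I. c i * (x i - y i))
    \<le> sqrt (\<Sum>i\<in>I. (c i)\<^sup>2 * ((x i)\<^sup>2 - (y i)\<^sup>2)) * sqrt (\<Sum>i\<in>I. (x i - y i) / (x i + y i))"
proof -
  define A where "A i = c i * sqrt ((x i)\<^sup>2 - (y i)\<^sup>2)" for i
  define B where "B i = sqrt ((x i - y i) / (x i + y i))" for i
  have sq: "(y i)\<^sup>2 \<le> (x i)\<^sup>2" if "i \<in> I" for i
    using xy[OF that] by (intro power_mono) auto
  have "c i * (x i - y i) = A i * B i" if "i \<in> I" for i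
  proof (cases "x i + y i = 0")
    case True
    then have "x i = 0" "y i = 0" using xy[OF that] by auto
    then show ?thesis by (simp add: A_def B_def)
  next
    case False
    have "((x i)\<^sup>2 - (y i)\<^sup>2) * ((x i - y i) / (x i + y i)) = (x i - y i)\<^sup>2"
      using False by (simp add: field_simps power2_eq_square)
    then have "A i * B i = c i * sqrt ((x i - y i)\<^sup>2)"
      by (metis A_def B_def mult.assoc real_sqrt_mult)
    then show ?thesis
      using xy[OF that] by simp
  qed
  then have eq: "(\<Sum>i\<in>I. c i * (x i - y i)) = (\<Sum>i\<in>I. A i * B i)"
    by simp
  have "(\<Sum>i\<in>I. A i * B i)\<^sup>2 \<le> (\<Sum>i\<in>I. (A i)\<^sup>2) * (\<Sum>i\<in>I. (B i)\<^sup>2)"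
    by (rule Cauchy_Schwarz_ineq_sum)
  also have "(\<Sum>i\<in>I. (A i)\<^sup>2) = (\<Sum>i\<in>I. (c i)\<^sup>2 * ((x i)\<^sup>2 - (y i)\<^sup>2))"
    by (rule sum.cong) (auto simp: A_def power_mult_distrib sq)
  also have "(\<Sum>i\<in>I. (B i)\<^sup>2) = (\<Sum>i\<in>I. (x i - y i) / (x i + y i))"
    by (rule sum.cong) (use xy in \<open>force simp: B_def intro!: divide_nonneg_nonneg\<close>)+
  finally show ?thesis
    unfolding eq real_sqrt_mult[symmetric] by (rule real_le_rsqrt)
qed

section \<open>Coordinates grouped into blocks between consecutive model sizes\<close>

lemma sum_blocks:
  fixes k :: "nat \<Rightarrow> nat"
  assumes "k 0 = 0" "\<And>m. m < M \<Longrightarrow> k m \<le> k (Suc m)"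
  shows "sum F {0<..k M} = (\<Sum>m=1..M. sum F {k (m - 1)<..k m})"
  using assms(2)
proof (induction M)
  case 0
  then show ?case using assms(1) by simp
next
  case (Suc M)
  have "{0<..k (Suc M)} = {0<..k M} \<union> {k M<..k (Suc M)}"
    using Suc.prems[of M] by auto
  then have "sum F {0<..k (Suc M)} = sum F {0<..k M} + sum F {k M<..k (Suc M)}"
    by (simp add: sum.union_disjoint)
  then show ?case using Suc by simp
qed

text \<open>The eigenvalue of the averaged projection \<open>P\<^sub>w\<close> on \<open>\<phi>\<^sub>l\<close>.\<close>
definition shrink :: "nat \<Rightarrow> (nat \<Rightarrow> nat) \<Rightarrow> (nat \<Rightarrow> real) \<Rightarrow> nat \<Rightarrow> real" where
  "shrink M k w l = (\<Sum>m\<in>{m\<in>{1..M}. l \<le> k m}. w m)"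

lemma strict_mono_upto_less:
  fixes k :: "nat \<Rightarrow> nat"
  assumes "\<And>m. m < M \<Longrightarrow> k m < k (Suc m)" "i < j" "j \<le> M"
  shows "k i < k j"
  using assms(2,3)
proof (induction j)
  case (Suc j)
  then show ?case using assms(1)[of j] by (cases "i = j") auto
qed simp

lemma shrink_block:
  assumes k: "\<And>m. m < M \<Longrightarrow> k m < k (Suc m)" and "m \<in> {1..M}" "l \<in> {k (m - 1)<..k m}"
  shows "shrink M k w l = (\<Sum>i=m..M. w i)"
proof -
  have "{i\<in>{1..M}. l \<le> k i} = {m..M}"
  proof (intro set_eqI iffI)
    fix i assume i: "i \<in> {i\<in>{1..M}. l \<le> k i}"
    have "\<not> i < m"
    proof
      assume "i < m"
      then have "k i \<le> k (m - 1)"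
        using strict_mono_upto_less[where k = k and M = M, OF k, of i "m - 1"] assms(2)
        by (cases "i = m - 1") force+
      then show False using i assms(3) by auto
    qed
    then show "i \<in> {m..M}" using i by auto
  next
    fix i assume i: "i \<in> {m..M}"
    then have "k m \<le> k i"
      using strict_mono_upto_less[where k = k and M = M, OF k, of m i] assms(2)
      by (cases "i = m") force+
    then show "i \<in> {i\<in>{1..M}. l \<le> k i}" using i assms by auto
  qed
  then show ?thesis by (simp add: shrink_def)
qed

lemma sum_shrink_blocks:
  fixes k :: "nat \<Rightarrow> nat" and F :: "real \<Rightarrow> nat \<Rightarrow> real"
  assumes "k 0 = 0" and k: "\<And>m. m < M \<Longrightarrow> k m < k (Suc m)"
  shows "(\<Sum>l=1..k M. F (shrink M k w l) l) = (\<Sum>m=1..M. \<Sum>l\<in>{k (m - 1)<..k m}. F (\<Sum>i=m..M. w i) l)"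
proof -
  have "(\<Sum>l=1..k M. F (shrink M k w l) l) = (\<Sum>l\<in>{0<..k M}. F (shrink M k w l) l)"
    by (rule sum.cong) auto
  also have "\<dots> = (\<Sum>m=1..M. \<Sum>l\<in>{k (m - 1)<..k m}. F (shrink M k w l) l)"
    by (rule sum_blocks) (use assms less_imp_le in auto)
  also have "\<dots> = (\<Sum>m=1..M. \<Sum>l\<in>{k (m - 1)<..k m}. F (\<Sum>i=m..M. w i) l)"
    by (intro sum.cong refl) (use shrink_block[where k = k, OF k] in simp)
  finally show ?thesis .
qed

lemma shrink_bounds:
  assumes "w \<in> weights M"
  shows "0 \<le> shrink M k w l" "shrink M k w l \<le> 1"
proof -
  show "0 \<le> shrink M k w l"
    unfolding shrink_def by (rule sum_nonneg) (use assms in \<open>auto simp: weights_def\<close>)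
  have "shrink M k w l \<le> (\<Sum>m=1..M. w m)"
    unfolding shrink_def by (rule sum_mono2) (use assms in \<open>auto simp: weights_def\<close>)
  then show "shrink M k w l \<le> 1"
    using assms by (simp add: weights_def)
qed

lemma weight_tail:
  assumes "w \<in> weights M" "m \<in> {1..M}"
  shows "0 \<le> (\<Sum>i=m..M. w i)" "(\<Sum>i=m..M. w i) \<le> 1" "m < M \<Longrightarrow> (\<Sum>i=Suc m..M. w i) \<le> (\<Sum>i=m..M. w i)"
proof -
  show "0 \<le> (\<Sum>i=m..M. w i)"
    by (rule sum_nonneg) (use assms in \<open>auto simp: weights_def\<close>)
  have "(\<Sum>i=m..M. w i) \<le> (\<Sum>m=1..M. w m)"
    by (rule sum_mono2) (use assms in \<open>auto simp: weights_def\<close>)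
  then show "(\<Sum>i=m..M. w i) \<le> 1"
    using assms by (simp add: weights_def)
  show "(\<Sum>i=Suc m..M. w i) \<le> (\<Sum>i=m..M. w i)"
    by (rule sum_mono2) (use assms in \<open>auto simp: weights_def\<close>)
qed

text \<open>Exchange of the two summations. With outer products of \<open>phi\<close> as
  \<open>b\<close> it diagonalises the averaged projection; with \<open>b = 1\<close> it turns the
  penalty \<open>\<Sum> k m * w m\<close> into the sum of the eigenvalues.\<close>

lemma sum_shrink_eq:
  fixes k :: "nat \<Rightarrow> nat"
  assumes "\<And>m. m \<in> {1..M} \<Longrightarrow> k m \<le> N"
  shows "(\<Sum>l=1..N. shrink M k w l * b l) = (\<Sum>m=1..M. w m * (\<Sum>l=1..k m. b l))"
proof -
  have "(\<Sum>l=1..N. shrink M k w l * b l) = (\<Sum>l=1..N. \<Sum>m\<in>{m\<in>{1..M}. l \<le> k m}. w m * b l)"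
    by (simp add: shrink_def sum_distrib_right)
  also have "\<dots> = (\<Sum>m=1..M. \<Sum>l\<in>{l\<in>{1..N}. l \<le> k m}. w m * b l)"
    by (rule sum.swap_restrict) auto
  also have "\<dots> = (\<Sum>m=1..M. w m * (\<Sum>l=1..k m. b l))"
    unfolding sum_distrib_left
    by (intro sum.cong refl) (use assms in force)+
  finally show ?thesis .
qed

text \<open>Abel summation turns bounds on the partial sums of \<open>b\<close> into one on \<open>\<Sum>\<^sub>l h\<^sub>l b\<^sub>l\<close> for a
  nonincreasing \<open>h\<close>; the square roots of the sizes are the increments of the summation.\<close>
lemma variance_term_bound:
  fixes k :: "nat \<Rightarrow> nat" and b :: "nat \<Rightarrow> real" and h :: "real \<Rightarrow> real"
  assumes k0: "k 0 = 0" and k: "\<And>m. m < M \<Longrightarrow> k m < k (Suc m)"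
    and w: "w \<in> weights M"
    and T: "\<And>m. m \<in> {1..M} \<Longrightarrow> (\<Sum>l=1..k m. b l) \<le> Z * sqrt (real (k m))"
    and Z: "0 \<le> Z"
    and h: "\<And>x. 0 \<le> x \<Longrightarrow> x \<le> 1 \<Longrightarrow> 0 \<le> h x \<and> h x \<le> 2 * x"
    and h_mono: "\<And>x y. 0 \<le> x \<Longrightarrow> x \<le> y \<Longrightarrow> y \<le> 1 \<Longrightarrow> h x \<le> h y"
    and V: "(\<Sum>m=1..M. (sqrt (real (k m)) - sqrt (real (k (m - 1)))) / (sqrt (real (k m)) + sqrt (real (k (m - 1))))) \<le> V"
  shows "(\<Sum>l=1..k M. h (shrink M k w l) * b l) \<le> 2 * Z * sqrt V * sqrt (\<Sum>l=1..k M. (shrink M k w l)\<^sup>2)"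
proof -
  define G where "G m = (\<Sum>i=m..M. w i)" for m
  define B where "B m = (\<Sum>l=1..k m. b l)" for m
  note tail = weight_tail[OF w, folded G_def]
  have blocks: "(\<Sum>l=1..k M. F (shrink M k w l) l) = (\<Sum>m=1..M. \<Sum>l\<in>{k (m - 1)<..k m}. F (G m) l)"
    for F :: "real \<Rightarrow> nat \<Rightarrow> real"
    unfolding G_def by (rule sum_shrink_blocks[where k = k]) (fact k0, rule k)
  have km: "k (m - 1) \<le> k m" if "m \<in> {1..M}" for m
    using k[of "m - 1"] that by force
  have "(\<Sum>l=1..k M. h (shrink M k w l) * b l) = (\<Sum>m=1..M. h (G m) * (B m - B (m - 1)))"
    unfolding blocks[where F = "\<lambda>g l. h g * b l"]
  proof (rule sum.cong[OF refl])
    fix m assume m: "m \<in> {1..M}"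
    have "{1..k m} = {1..k (m - 1)} \<union> {k (m - 1)<..k m}"
      using km[OF m] by auto
    then have "B m = B (m - 1) + sum b {k (m - 1)<..k m}"
      unfolding B_def by (auto intro!: sum.union_disjoint)
    then show "(\<Sum>l\<in>{k (m - 1)<..k m}. h (G m) * b l) = h (G m) * (B m - B (m - 1))"
      by (simp add: sum_distrib_left)
  qed
  \<comment> \<open>The gap \<open>Z * sqrt (k m) - B m\<close> is nonnegative by \<open>T\<close>
    and zero at \<open>m = 0\<close>, while \<open>h (G m)\<close> decreases in \<open>m\<close>; so
    the partial sums may be replaced by their bounds under the summation.\<close>
  also have "\<dots> \<le> (\<Sum>m=1..M. h (G m) * (Z * sqrt (real (k m)) - Z * sqrt (real (k (m - 1)))))"
  proof -
    have "0 \<le> (\<Sum>m=1..M. h (G m) * ((Z * sqrt (real (k m)) - B m) - (Z * sqrt (real (k (m - 1))) - B (m - 1))))"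
    proof (rule sum_by_parts_antimono_nonneg)
      show "Z * sqrt (real (k 0)) - B 0 = 0" by (simp add: k0 B_def)
      show "0 \<le> Z * sqrt (real (k m)) - B m" if "m \<le> M" for m
        using T[of m] that by (cases "m = 0") (auto simp: k0 B_def)
      show "0 \<le> h (G m)" if "m \<in> {1..M}" for m
        using h[of "G m"] tail[OF that] by simp
      show "h (G (Suc m)) \<le> h (G m)" if "1 \<le> m" "m < M" for m
        using tail[of m] tail[of "Suc m"] that by (intro h_mono) auto
    qed
    then show ?thesis
      by (simp add: algebra_simps sum.distrib sum_subtractf)
  qed
  also have "\<dots> \<le> (\<Sum>m=1..M. 2 * G m * (Z * sqrt (real (k m)) - Z * sqrt (real (k (m - 1)))))"
    using h tail km Z by (intro sum_mono mult_right_mono) (auto intro!: mult_left_mono)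
  also have "\<dots> = 2 * Z * (\<Sum>m=1..M. G m * (sqrt (real (k m)) - sqrt (real (k (m - 1)))))"
    by (simp add: sum_distrib_left algebra_simps)
  \<comment> \<open>The difference of the squared roots is the length of a block, on which
    \<open>shrink\<close> is constant; hence the first factor becomes the sum of the squared
    eigenvalues.\<close>
  also have "(\<Sum>m=1..M. G m * (sqrt (real (k m)) - sqrt (real (k (m - 1)))))
     \<le> sqrt (\<Sum>m=1..M. (G m)\<^sup>2 * ((sqrt (real (k m)))\<^sup>2 - (sqrt (real (k (m - 1))))\<^sup>2))
       * sqrt (\<Sum>m=1..M. (sqrt (real (k m)) - sqrt (real (k (m - 1)))) / (sqrt (real (k m)) + sqrt (real (k (m - 1)))))"
    by (rule weighted_increment_Cauchy_Schwarz) (use km in auto)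
  also have "(\<Sum>m=1..M. (G m)\<^sup>2 * ((sqrt (real (k m)))\<^sup>2 - (sqrt (real (k (m - 1))))\<^sup>2))
     = (\<Sum>l=1..k M. (shrink M k w l)\<^sup>2)"
    unfolding blocks[where F = "\<lambda>g l. g\<^sup>2"]
    using km by (intro sum.cong) (auto simp: of_nat_diff)
  finally have *: "(\<Sum>l=1..k M. h (shrink M k w l) * b l) \<le> 2 * Z * (sqrt (\<Sum>l=1..k M. (shrink M k w l)\<^sup>2)
     * sqrt (\<Sum>m=1..M. (sqrt (real (k m)) - sqrt (real (k (m - 1)))) / (sqrt (real (k m)) + sqrt (real (k (m - 1))))))"
    using Z by (simp add: mult_left_mono)
  also have "\<dots> \<le> 2 * Z * (sqrt (\<Sum>l=1..k M. (shrink M k w l)\<^sup>2) * sqrt V)"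
    using Z V by (intro mult_left_mono) (auto simp: sum_nonneg)
  finally show ?thesis by (simp add: mult_ac)
qed

text \<open>Here the coefficients grow with \<open>l\<close>, so the summation runs over tails, and
  \<open>sqrt (S m)\<close>, the scale of the tail of \<open>a e\<close>, takes the place of
  \<open>sqrt (k m)\<close>. The last tail is empty, which is why \<open>T\<close> stops before
  \<open>M\<close>. The function \<open>h\<close> leaves room for \<open>1 - x\<close> (loss) and
  \<open>(1 - x)^2\<close> (risk).\<close>

lemma bias_term_bound:
  fixes k :: "nat \<Rightarrow> nat" and a e :: "nat \<Rightarrow> real" and h :: "real \<Rightarrow> real"
  assumes k0: "k 0 = 0" and k: "\<And>m. m < M \<Longrightarrow> k m < k (Suc m)"
    and w: "w \<in> weights M"
    and S: "\<And>m. m \<le> M \<Longrightarrow> S m = (\<Sum>l\<in>{k m<..k M}. (a l)\<^sup>2)"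
    and T: "\<And>m. m < M \<Longrightarrow> - (\<Sum>l\<in>{k m<..k M}. a l * e l) \<le> Z * sqrt (S m)"
    and Z: "0 \<le> Z"
    and h: "\<And>x. 0 \<le> x \<Longrightarrow> x \<le> 1 \<Longrightarrow> 0 \<le> h x \<and> h x \<le> 1 - x"
    and h_mono: "\<And>x y. 0 \<le> x \<Longrightarrow> x \<le> y \<Longrightarrow> y \<le> 1 \<Longrightarrow> h y \<le> h x"
    and V: "(\<Sum>m=1..M. (sqrt (S (m - 1)) - sqrt (S m)) / (sqrt (S (m - 1)) + sqrt (S m))) \<le> V"
  shows "- (\<Sum>l=1..k M. h (shrink M k w l) * (a l * e l)) \<le> Z * sqrt V * sqrt (\<Sum>l=1..k M. (1 - shrink M k w l)\<^sup>2 * (a l)\<^sup>2)"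
proof -
  define G where "G m = (\<Sum>i=m..M. w i)" for m
  define B where "B m = - (\<Sum>l\<in>{k m<..k M}. a l * e l)" for m
  note tail = weight_tail[OF w, folded G_def]
  have blocks: "(\<Sum>l=1..k M. F (shrink M k w l) l) = (\<Sum>m=1..M. \<Sum>l\<in>{k (m - 1)<..k m}. F (G m) l)"
    for F :: "real \<Rightarrow> nat \<Rightarrow> real"
    unfolding G_def by (rule sum_shrink_blocks[where k = k]) (fact k0, rule k)
  have split: "sum F {k (m - 1)<..k M} = sum F {k (m - 1)<..k m} + sum F {k m<..k M}"
    if m: "m \<in> {1..M}" for m and F :: "nat \<Rightarrow> real"
  proof -
    have "k (m - 1) \<le> k m"
      using k[of "m - 1"] m by force
    moreover have "k m \<le> k M"
      using strict_mono_upto_less[where k = k and M = M, OF k, of m M] m by (cases "m = M") force+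
    ultimately have "{k (m - 1)<..k M} = {k (m - 1)<..k m} \<union> {k m<..k M}" by auto
    then show ?thesis by (simp add: sum.union_disjoint)
  qed
  have S_nonneg: "0 \<le> S m" if "m \<le> M" for m
    using S[OF that] by (simp add: sum_nonneg)
  have S_diff: "S (m - 1) - S m = (\<Sum>l\<in>{k (m - 1)<..k m}. (a l)\<^sup>2)" if "m \<in> {1..M}" for m
    using S[of m] S[of "m - 1"] split[OF that, of "\<lambda>l. (a l)\<^sup>2"] that by force
  have S_mono: "S m \<le> S (m - 1)" if "m \<in> {1..M}" for m
    using S_diff[OF that] sum_nonneg[of "{k (m - 1)<..k m}" "\<lambda>l. (a l)\<^sup>2"] by simp
  have "- (\<Sum>l=1..k M. h (shrink M k w l) * (a l * e l)) = (\<Sum>m=1..M. h (G m) * (B (m - 1) - B m))"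
    unfolding blocks[where F = "\<lambda>g l. h g * (a l * e l)"] sum_negf[symmetric]
  proof (rule sum.cong[OF refl])
    fix m assume m: "m \<in> {1..M}"
    show "(\<Sum>l\<in>{k (m - 1)<..k m}. - (h (G m) * (a l * e l))) = h (G m) * (B (m - 1) - B m)"
      using split[OF m, of "\<lambda>l. a l * e l"] by (simp add: B_def sum_negf sum_distrib_left[symmetric])
  qed
  also have "\<dots> \<le> (\<Sum>m=1..M. h (G m) * (Z * sqrt (S (m - 1)) - Z * sqrt (S m)))"
  proof -
    have "0 \<le> (\<Sum>m=1..M. h (G m) * ((Z * sqrt (S (m - 1)) - B (m - 1)) - (Z * sqrt (S m) - B m)))"
    proof (rule sum_by_parts_mono_nonneg[where U = "\<lambda>m. Z * sqrt (S m) - B m"])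
      show "Z * sqrt (S M) - B M = 0" using S[of M] by (simp add: B_def)
      show "0 \<le> Z * sqrt (S m) - B m" if "m \<le> M" for m
        using T[of m] S[of M] that by (cases "m = M") (auto simp: B_def)
      show "0 \<le> h (G m)" if "m \<in> {1..M}" for m
        using h[of "G m"] tail[OF that] by simp
      show "h (G m) \<le> h (G (Suc m))" if "1 \<le> m" "m < M" for m
        using tail[of m] tail[of "Suc m"] that by (intro h_mono) auto
    qed
    then show ?thesis
      by (simp add: algebra_simps sum.distrib sum_subtractf)
  qed
  also have "\<dots> \<le> (\<Sum>m=1..M. (1 - G m) * (Z * sqrt (S (m - 1)) - Z * sqrt (S m)))"
    using h tail S_mono Z by (intro sum_mono mult_right_mono) (auto intro!: mult_left_mono)
  also have "\<dots> = Z * (\<Sum>m=1..M. (1 - G m) * (sqrt (S (m - 1)) - sqrt (S m)))"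
    unfolding sum_distrib_left by (rule sum.cong) (simp_all add: algebra_simps)
  also have "(\<Sum>m=1..M. (1 - G m) * (sqrt (S (m - 1)) - sqrt (S m)))
     \<le> sqrt (\<Sum>m=1..M. (1 - G m)\<^sup>2 * ((sqrt (S (m - 1)))\<^sup>2 - (sqrt (S m))\<^sup>2))
       * sqrt (\<Sum>m=1..M. (sqrt (S (m - 1)) - sqrt (S m)) / (sqrt (S (m - 1)) + sqrt (S m)))"
    by (rule weighted_increment_Cauchy_Schwarz) (use S_mono S_nonneg in auto)
  also have "(\<Sum>m=1..M. (1 - G m)\<^sup>2 * ((sqrt (S (m - 1)))\<^sup>2 - (sqrt (S m))\<^sup>2))
     = (\<Sum>l=1..k M. (1 - shrink M k w l)\<^sup>2 * (a l)\<^sup>2)"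
    unfolding blocks[where F = "\<lambda>g l. (1 - g)\<^sup>2 * (a l)\<^sup>2"]
    using S_nonneg S_diff by (intro sum.cong) (auto simp: sum_distrib_left[symmetric])
  finally have "- (\<Sum>l=1..k M. h (shrink M k w l) * (a l * e l)) \<le> Z * (sqrt (\<Sum>l=1..k M. (1 - shrink M k w l)\<^sup>2 * (a l)\<^sup>2)
     * sqrt (\<Sum>m=1..M. (sqrt (S (m - 1)) - sqrt (S m)) / (sqrt (S (m - 1)) + sqrt (S m))))"
    using Z by (simp add: mult_left_mono)
  also have "\<dots> \<le> Z * (sqrt (\<Sum>l=1..k M. (1 - shrink M k w l)\<^sup>2 * (a l)\<^sup>2) * sqrt V)"
    using Z V by (intro mult_left_mono) (auto simp: sum_nonneg)
  finally show ?thesis by (simp add: mult_ac)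
qed

section \<open>The pathwise oracle inequality\<close>

text \<open>The ratio equals \<open>(u - v) / (sqrt u + sqrt v)^2\<close>, and
  \<open>sqrt u + sqrt v\<close> is at least \<open>2 * sqrt v\<close>. This is the origin of the
  factor 4 in \<open>psi\<close>.\<close>

lemma ratio_le_quarter_increment:
  fixes u v :: real
  assumes "0 < v" "v \<le> u"
  shows "(sqrt u - sqrt v) / (sqrt u + sqrt v) \<le> (u - v) / (4 * v)"
proof -
  have sq: "u = (sqrt u)\<^sup>2" "v = (sqrt v)\<^sup>2" and pos: "0 < sqrt v" "sqrt v \<le> sqrt u"
    using assms by auto
  have "(sqrt u - sqrt v) / (sqrt u + sqrt v) = ((sqrt u)\<^sup>2 - (sqrt v)\<^sup>2) / (sqrt u + sqrt v)\<^sup>2"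
    using pos by (simp only: power2_eq_square square_diff_square_factored) simp
  also have "\<dots> = (u - v) / (sqrt u + sqrt v)\<^sup>2"
    using sq by simp
  also have "\<dots> \<le> (u - v) / (4 * v)"
  proof (rule divide_left_mono)
    have "(2 * sqrt v)\<^sup>2 \<le> (sqrt u + sqrt v)\<^sup>2"
      using pos by (intro power_mono) auto
    then show "4 * v \<le> (sqrt u + sqrt v)\<^sup>2"
      using assms by (simp add: power_mult_distrib)
    have "0 < sqrt u + sqrt v" using pos by linarith
    then show "0 < (sqrt u + sqrt v)\<^sup>2 * (4 * v)"
      using assms by simp
  qed (use assms in simp)
  finally show ?thesis .
qed

lemma ratio_le_1:
  fixes u v :: real
  assumes "0 \<le> v" "v \<le> u"
  shows "(sqrt u - sqrt v) / (sqrt u + sqrt v) \<le> 1"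
proof (cases "sqrt u + sqrt v = 0")
  case False
  then have "sqrt u + sqrt v > 0"
    using assms by (metis add_nonneg_nonneg less_eq_real_def order_trans real_sqrt_ge_zero)
  then show ?thesis using assms by (simp add: divide_le_eq)
qed simp

text \<open>The two bounds are the two arguments of the minimum in \<open>psi\<close>, as far as the
  sizes are concerned.\<close>

lemma sum_ratio_increasing_le:
  fixes d :: "nat \<Rightarrow> real"
  assumes "d 0 = 0" "\<And>m. m < M \<Longrightarrow> d m \<le> d (Suc m)" "\<And>m. m \<in> {1..M} \<Longrightarrow> 0 < d m" "1 \<le> M"
  shows "(\<Sum>m=1..M. (sqrt (d m) - sqrt (d (m - 1))) / (sqrt (d m) + sqrt (d (m - 1)))) \<le> real M" (is "?A \<le> _")
    and "(\<Sum>m=1..M. (sqrt (d m) - sqrt (d (m - 1))) / (sqrt (d m) + sqrt (d (m - 1))))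
       \<le> 1 + (\<Sum>j=1..M-1. (d (j + 1) - d j) / (4 * d j))"
proof -
  have nn: "0 \<le> d m" if "m \<le> M" for m
    using assms(1) assms(3)[of m] that by (cases "m = 0") (auto intro: less_imp_le)
  have mono: "d (m - 1) \<le> d m" if "m \<in> {1..M}" for m
    using assms(2)[of "m - 1"] that by force
  have "?A \<le> (\<Sum>m=1..M. 1)"
    by (intro sum_mono ratio_le_1 nn mono) auto
  then show "?A \<le> real M" by simp
  let ?r = "\<lambda>m. (sqrt (d m) - sqrt (d (m - 1))) / (sqrt (d m) + sqrt (d (m - 1)))"
  have "?A = ?r 1 + sum ?r {Suc 1..M}"
    using assms(4) by (rule sum.atLeast_Suc_atMost)
  also have "{Suc 1..M} = Suc ` {1..M-1}"
    using assms(4) by (simp add: image_Suc_atLeastAtMost)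
  also have "sum ?r (Suc ` {1..M-1}) = (\<Sum>j=1..M-1. (sqrt (d (j + 1)) - sqrt (d j)) / (sqrt (d (j + 1)) + sqrt (d j)))"
    by (subst sum.reindex) simp_all
  also have "?r 1 + (\<Sum>j=1..M-1. (sqrt (d (j + 1)) - sqrt (d j)) / (sqrt (d (j + 1)) + sqrt (d j)))
      \<le> 1 + (\<Sum>j=1..M-1. (d (j + 1) - d j) / (4 * d j))"
  proof (intro add_mono sum_mono)
    \<comment> \<open>The first ratio starts from \<open>d 0 = 0\<close>, where the quarter bound
      does not apply. It is the summand 1 in \<open>psi\<close>.\<close>
    show "?r 1 \<le> 1"
      using mono[of 1] nn[of 0] assms(4) by (intro ratio_le_1) auto
    fix j assume "j \<in> {1..M-1}"
    then show "(sqrt (d (j + 1)) - sqrt (d j)) / (sqrt (d (j + 1)) + sqrt (d j)) \<le> (d (j + 1) - d j) / (4 * d j)"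
      using assms(2)[of j] assms(3)[of j] by (intro ratio_le_quarter_increment) auto
  qed
  finally show "?A \<le> 1 + (\<Sum>j=1..M-1. (d (j + 1) - d j) / (4 * d j))" .
qed

text \<open>The same for signal tails, which may reach zero early. Before the first zero
  \<open>M'\<close> the quarter bound applies; the step into zero costs at most 1.\<close>

lemma sum_ratio_decreasing_le:
  fixes S :: "nat \<Rightarrow> real"
  assumes nn: "\<And>m. m \<le> M \<Longrightarrow> 0 \<le> S m" and mono: "\<And>m. m \<in> {1..M} \<Longrightarrow> S m \<le> S (m - 1)"
    and M': "1 \<le> M'" "M' \<le> M" "S M' = 0" "\<And>m. 1 \<le> m \<Longrightarrow> m < M' \<Longrightarrow> S m \<noteq> 0"
  shows "(\<Sum>m=1..M. (sqrt (S (m - 1)) - sqrt (S m)) / (sqrt (S (m - 1)) + sqrt (S m))) \<le> real M" (is "?A \<le> _")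
    and "(\<Sum>m=1..M. (sqrt (S (m - 1)) - sqrt (S m)) / (sqrt (S (m - 1)) + sqrt (S m)))
       \<le> 1 + (\<Sum>j=1..M'-1. (S (j - 1) - S j) / (4 * S j))"
proof -
  have "?A \<le> (\<Sum>m=1..M. 1)"
    by (intro sum_mono ratio_le_1 nn mono) auto
  then show "?A \<le> real M" by simp
  have zero: "S m = 0" if "M' \<le> m" "m \<le> M" for m
    using that
  proof (induction m rule: nat_induct_at_least)
    case base
    then show ?case using M' by simp
  next
    case (Suc m)
    then show ?case using mono[of "Suc m"] nn[of "Suc m"] by simp
  qed
  let ?r = "\<lambda>m. (sqrt (S (m - 1)) - sqrt (S m)) / (sqrt (S (m - 1)) + sqrt (S m))"
  have "{1..M} = {1..M'-1} \<union> {M'} \<union> {M'<..M}"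
    using M' by auto
  then have "?A = sum ?r ({1..M'-1} \<union> {M'}) + sum ?r {M'<..M}"
    by (simp only:) (rule sum.union_disjoint, auto)
  \<comment> \<open>After \<open>M'\<close> all tails vanish, and the ratios are
    \<open>0 / 0\<close>, which is 0 by convention.\<close>
  also have "sum ?r {M'<..M} = 0"
    by (rule sum.neutral) (auto simp: zero)
  also have "sum ?r ({1..M'-1} \<union> {M'}) = ?r M' + sum ?r {1..M'-1}"
    using M' by (subst sum.union_disjoint) auto
  also have "?r M' + sum ?r {1..M'-1} + 0 \<le> 1 + (\<Sum>j=1..M'-1. (S (j - 1) - S j) / (4 * S j)) + 0"
  proof (intro add_mono sum_mono order_refl)
    show "?r M' \<le> 1"
      using M' by (intro ratio_le_1 nn mono) auto
    fix j assume j: "j \<in> {1..M'-1}"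
    then have "0 < S j"
      using M'(4)[of j] nn[of j] M'(2) by force
    then show "?r j \<le> (S (j - 1) - S j) / (4 * S j)"
      using j M' by (intro ratio_le_quarter_increment mono) auto
  qed
  finally show "?A \<le> 1 + (\<Sum>j=1..M'-1. (S (j - 1) - S j) / (4 * S j))" by simp
qed

text \<open>\<open>nested_sizes\<close> leaves \<open>k 0\<close> arbitrary. Overwriting it by 0
  adds the empty model, so that the first block is treated like all others.\<close>

lemma nested_sizes_less:
  assumes "nested_sizes M k p" "m < M"
  shows "(k(0 := 0)) m < (k(0 := 0)) (Suc m)"
  using assms by (cases "m = 0") (auto simp: nested_sizes_def)

text \<open>\<open>V\<close> is the minimum in \<open>psi\<close>. Both increment sums in it are
  nonnegative, so it dominates each ratio sum separately.\<close>

lemma psi_dominates_ratio_sums: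
  fixes k :: "nat \<Rightarrow> nat" and X :: "nat \<Rightarrow> nat \<Rightarrow> real" and f :: "nat \<Rightarrow> real"
  assumes nest: "nested_sizes M k p" and n: "1 \<le> n"
  defines "kk \<equiv> k(0 := 0)"
  defines "S \<equiv> \<lambda>m. \<Sum>l\<in>{kk m<..kk M}. (inner_n n (phi n X l) f)\<^sup>2"
  obtains V where "psi n X f M k = V * (1 + ln (real M))\<^sup>2"
    and "(\<Sum>m=1..M. (sqrt (real (kk m)) - sqrt (real (kk (m - 1)))) / (sqrt (real (kk m)) + sqrt (real (kk (m - 1))))) \<le> V"
    and "(\<Sum>m=1..M. (sqrt (S (m - 1)) - sqrt (S m)) / (sqrt (S (m - 1)) + sqrt (S m))) \<le> V"
    and "0 \<le> V"
proof -
  have M: "1 \<le> M" using nest by (auto simp: nested_sizes_def)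
  have kless: "kk m < kk (Suc m)" if "m < M" for m
    unfolding kk_def by (rule nested_sizes_less[OF nest that])
  have kpos: "0 < kk m" if "m \<in> {1..M}" for m
    using strict_mono_upto_less[where k = kk and M = M, OF kless, of 0 m] that by (auto simp: kk_def)
  let ?St = "S_tail n X f M k"
  define M' where "M' = (LEAST j. 1 \<le> j \<and> j \<le> M \<and> ?St j = 0)"
  define A where "A = (\<Sum>j=1..M-1. (real (k (j+1)) - real (k j)) / (4 * real (k j)))"
  define B where "B = (\<Sum>j=1..M'-1. (?St (j-1) - ?St j) / (4 * ?St j))"
  define V where "V = min (real M) (1 + A + B)"
  have psi: "psi n X f M k = V * (1 + ln (real M))\<^sup>2"
    by (simp add: psi_def Let_def V_def A_def B_def M'_def)
  have St: "?St m = S m / real n" if "m \<le> M" for m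
  proof -
    have "{(if m = 0 then 0 else k m) + 1..k M} = {kk m<..kk M}"
      using M by (auto simp: kk_def)
    then have "?St m = (\<Sum>l\<in>{kk m<..kk M}. (theta n X f l)\<^sup>2)"
      by (simp add: S_tail_def)
    also have "\<dots> = S m / real n"
      using n by (simp add: S_def theta_def power_divide sum_divide_distrib)
    finally show ?thesis .
  qed
  have S_nn: "0 \<le> S m" for m by (simp add: S_def sum_nonneg)
  have S_mono: "S m \<le> S (m - 1)" if "m \<in> {1..M}" for m
    unfolding S_def using kless[of "m - 1"] that by (intro sum_mono2) force+
  have St_nn: "0 \<le> ?St m" if "m \<le> M" for m
    using St[OF that] S_nn by simp
  have St_mono: "?St m \<le> ?St (m - 1)" if "m \<in> {1..M}" for m
    using St[of m] St[of "m - 1"] S_mono[OF that] that by (force intro: divide_right_mono)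
  have M': "1 \<le> M' \<and> M' \<le> M \<and> ?St M' = 0"
    unfolding M'_def by (rule LeastI[of _ M]) (use M in \<open>auto simp: S_tail_def\<close>)
  have M'_least: "?St m \<noteq> 0" if "1 \<le> m" "m < M'" for m
    using not_less_Least[of m "\<lambda>j. 1 \<le> j \<and> j \<le> M \<and> ?St j = 0"] that M' unfolding M'_def by auto
  have A_eq: "A = (\<Sum>j=1..M-1. (real (kk (j+1)) - real (kk j)) / (4 * real (kk j)))"
    unfolding A_def by (rule sum.cong) (auto simp: kk_def)
  have A_nn: "0 \<le> A"
    unfolding A_eq
  proof (rule sum_nonneg)
    fix j assume "j \<in> {1..M-1}"
    then show "0 \<le> (real (kk (j+1)) - real (kk j)) / (4 * real (kk j))"
      using less_imp_le[OF kless[of j]] by (intro divide_nonneg_nonneg) force+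
  qed
  have B_nn: "0 \<le> B"
    unfolding B_def using M' St_nn St_mono by (intro sum_nonneg divide_nonneg_nonneg) auto
  have V1: "(\<Sum>m=1..M. (sqrt (real (kk m)) - sqrt (real (kk (m - 1)))) / (sqrt (real (kk m)) + sqrt (real (kk (m - 1))))) \<le> V"
    using sum_ratio_increasing_le[of "\<lambda>m. real (kk m)" M] kpos kless M B_nn
    by (auto simp: V_def A_eq kk_def less_imp_le)
  \<comment> \<open>\<open>S\<close> is built from inner products with \<open>f\<close>,
    \<open>S_tail\<close> from \<open>theta\<close>, which carries a factor
    \<open>1 / sqrt n\<close>. The ratios are invariant under this scaling.\<close>
  have "(\<Sum>m=1..M. (sqrt (S (m - 1)) - sqrt (S m)) / (sqrt (S (m - 1)) + sqrt (S m)))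
      = (\<Sum>m=1..M. (sqrt (?St (m - 1)) - sqrt (?St m)) / (sqrt (?St (m - 1)) + sqrt (?St m)))"
  proof (rule sum.cong[OF refl])
    fix m assume m: "m \<in> {1..M}"
    have "sqrt (?St (m - 1)) = sqrt (S (m - 1)) / sqrt n" "sqrt (?St m) = sqrt (S m) / sqrt n"
      using St[of m] St[of "m - 1"] m by (force simp: real_sqrt_divide)+
    then show "(sqrt (S (m - 1)) - sqrt (S m)) / (sqrt (S (m - 1)) + sqrt (S m))
      = (sqrt (?St (m - 1)) - sqrt (?St m)) / (sqrt (?St (m - 1)) + sqrt (?St m))"
      using n by (simp add: diff_divide_distrib[symmetric] add_divide_distrib[symmetric])
  qed
  also have "\<dots> \<le> V"
    using sum_ratio_decreasing_le[of M ?St M'] St_nn St_mono M' M'_least A_nn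
    by (auto simp: V_def B_def)
  finally have V2: "(\<Sum>m=1..M. (sqrt (S (m - 1)) - sqrt (S m)) / (sqrt (S (m - 1)) + sqrt (S m))) \<le> V" .
  have "0 \<le> V" using A_nn B_nn by (simp add: V_def)
  with psi V1 V2 show thesis by (rule that)
qed

section \<open>Risk, criterion and loss as sums over coordinates\<close>

context
  fixes n p M :: nat and X k
  assumes rank: "full_col_rank n p X" and kp: "\<forall>m\<in>{1..M}. k m \<le> k M" "k M \<le> p"
begin

lemma orthonormal_candidates: "orthonormal_on n {1..k M} (phi n X)"
  using phi_orthonormal[OF rank] kp unfolding orthonormal_on_def by auto

lemma Pw_eq_shrink:
  assumes "i < n" "i' < n"
  shows "Pw n X M k w i i' = (\<Sum>l=1..k M. (shrink M k w l * phi n X l i') * phi n X l i)"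
proof -
  have "Pw n X M k w i i' = (\<Sum>m=1..M. w m * (\<Sum>l=1..k m. phi n X l i * phi n X l i'))"
    unfolding Pw_def using kp assms
    by (intro sum.cong refl) (subst projmat_eq_sum_phi[OF rank], auto intro: order_trans)
  also have "\<dots> = (\<Sum>l=1..k M. shrink M k w l * (phi n X l i * phi n X l i'))"
    by (rule sum_shrink_eq[symmetric]) (use kp in auto)
  finally show ?thesis by (simp add: mult_ac)
qed

lemma mat_vec_Pw:
  assumes "i < n"
  shows "mat_vec n (Pw n X M k w) y i = (\<Sum>l=1..k M. (shrink M k w l * inner_n n (phi n X l) y) * phi n X l i)"
proof -
  have "mat_vec n (Pw n X M k w) y i = (\<Sum>i'<n. \<Sum>l=1..k M. shrink M k w l * phi n X l i' * phi n X l i * y i')"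
    using assms by (simp add: mat_vec_def Pw_eq_shrink sum_distrib_right)
  also have "\<dots> = (\<Sum>l=1..k M. \<Sum>i'<n. shrink M k w l * phi n X l i' * phi n X l i * y i')"
    by (rule sum.swap)
  finally show ?thesis
    by (simp add: inner_n_def sum_distrib_left sum_distrib_right mult_ac)
qed

lemma sum_diff_mat_vec_Pw:
  "(\<Sum>i<n. (u i - mat_vec n (Pw n X M k w) y i)\<^sup>2)
    = (\<Sum>i<n. (u i)\<^sup>2) - (\<Sum>l=1..k M. (inner_n n (phi n X l) u)\<^sup>2)
      + (\<Sum>l=1..k M. (inner_n n (phi n X l) u - shrink M k w l * inner_n n (phi n X l) y)\<^sup>2)"
  using norm_diff_orthonormal_comb[OF orthonormal_candidates finite_atLeastAtMost,
      of u "\<lambda>l. shrink M k w l * inner_n n (phi n X l) y"]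
  by (simp add: mat_vec_Pw)

lemma risk_eq_shrink:
  assumes "0 < n"
  shows "real n * risk n X M k \<sigma> f w = (\<Sum>i<n. (f i)\<^sup>2) - (\<Sum>l=1..k M. (inner_n n (phi n X l) f)\<^sup>2)
     + (\<Sum>l=1..k M. (1 - shrink M k w l)\<^sup>2 * (inner_n n (phi n X l) f)\<^sup>2) + \<sigma>\<^sup>2 * (\<Sum>l=1..k M. (shrink M k w l)\<^sup>2)"
proof -
  have "(\<Sum>i<n. \<Sum>l<n. (Pw n X M k w l i)\<^sup>2) = (\<Sum>i<n. \<Sum>l=1..k M. (shrink M k w l * phi n X l i)\<^sup>2)"
  proof (rule sum.cong[OF refl])
    fix i assume "i \<in> {..<n}"
    then have "(\<Sum>l<n. (Pw n X M k w l i)\<^sup>2) = (\<Sum>l'<n. (\<Sum>l=1..k M. (shrink M k w l * phi n X l i) * phi n X l l')\<^sup>2)"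
      by (simp add: Pw_eq_shrink)
    also have "\<dots> = (\<Sum>l=1..k M. (shrink M k w l * phi n X l i)\<^sup>2)"
      by (rule norm_orthonormal_comb[OF orthonormal_candidates]) simp
    finally show "(\<Sum>l<n. (Pw n X M k w l i)\<^sup>2) = (\<Sum>l=1..k M. (shrink M k w l * phi n X l i)\<^sup>2)" .
  qed
  also have "\<dots> = (\<Sum>l=1..k M. (shrink M k w l)\<^sup>2 * inner_n n (phi n X l) (phi n X l))"
    by (subst sum.swap) (simp add: inner_n_def sum_distrib_left power2_eq_square mult_ac)
  also have "\<dots> = (\<Sum>l=1..k M. (shrink M k w l)\<^sup>2)"
    using orthonormal_candidates by (intro sum.cong) (auto simp: orthonormal_on_def)
  finally have tr: "(\<Sum>i<n. \<Sum>l<n. (Pw n X M k w l i)\<^sup>2) = (\<Sum>l=1..k M. (shrink M k w l)\<^sup>2)" .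
  have "(inner_n n (phi n X l) f - shrink M k w l * inner_n n (phi n X l) f)\<^sup>2
     = (1 - shrink M k w l)\<^sup>2 * (inner_n n (phi n X l) f)\<^sup>2" for l
    by (simp add: power2_eq_square algebra_simps)
  then show ?thesis
    using assms unfolding risk_def sum_diff_mat_vec_Pw tr by (simp add: field_simps)
qed

lemma crit_eq_shrink:
  assumes "0 < n"
  shows "real n * mma_crit n X M k s y w = (\<Sum>i<n. (y i)\<^sup>2) - (\<Sum>l=1..k M. (inner_n n (phi n X l) y)\<^sup>2)
     + (\<Sum>l=1..k M. (1 - shrink M k w l)\<^sup>2 * (inner_n n (phi n X l) y)\<^sup>2) + 2 * s * (\<Sum>l=1..k M. shrink M k w l)"
proof -
  have "(\<Sum>m=1..M. real (k m) * w m) = (\<Sum>l=1..k M. shrink M k w l)"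
    using sum_shrink_eq[of M k "k M" w "\<lambda>_. 1"] kp by (simp add: mult.commute)
  moreover have "(inner_n n (phi n X l) y - shrink M k w l * inner_n n (phi n X l) y)\<^sup>2
     = (1 - shrink M k w l)\<^sup>2 * (inner_n n (phi n X l) y)\<^sup>2" for l
    by (simp add: power2_eq_square algebra_simps)
  ultimately show ?thesis
    using assms unfolding mma_crit_def sum_diff_mat_vec_Pw by (simp add: field_simps)
qed

lemma loss_eq_shrink:
  "(\<Sum>i<n. (mat_vec n (Pw n X M k w) y i - f i)\<^sup>2) = (\<Sum>i<n. (f i)\<^sup>2) - (\<Sum>l=1..k M. (inner_n n (phi n X l) f)\<^sup>2)
     + (\<Sum>l=1..k M. (shrink M k w l * inner_n n (phi n X l) y - inner_n n (phi n X l) f)\<^sup>2)"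
  using sum_diff_mat_vec_Pw[of f w y] by (simp add: power2_commute)

end

text \<open>Both the risk and the loss of \<open>w\<close> differ from the criterion by weighted sums of \<open>a e\<close> and
  \<open>e\<^sup>2 - s\<^sup>2\<close>. For the loss the weights are \<open>1 - g\<close> and \<open>g\<close>, for the risk \<open>(1 - g)\<^sup>2\<close> and
  \<open>2g - g\<^sup>2\<close>; in both cases they are monotone in \<open>l\<close>, so Abel summation applies.\<close>
lemma mma_pathwise_bound:
  fixes k :: "nat \<Rightarrow> nat" and a e :: "nat \<Rightarrow> real"
  assumes k0: "k 0 = 0" and k: "\<And>m. m < M \<Longrightarrow> k m < k (Suc m)"
    and w: "w \<in> weights M" and ws: "ws \<in> weights M"
    and S: "\<And>m. m \<le> M \<Longrightarrow> S m = (\<Sum>l\<in>{k m<..k M}. (a l)\<^sup>2)"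
    and T1: "\<And>m. m < M \<Longrightarrow> - (\<Sum>l\<in>{k m<..k M}. a l * e l) \<le> Z1 * s * sqrt (S m)"
    and T2: "\<And>m. m \<in> {1..M} \<Longrightarrow> (\<Sum>l=1..k m. (e l)\<^sup>2 - s\<^sup>2) \<le> Z2 * s\<^sup>2 * sqrt (real (k m))"
    and Z: "0 \<le> Z1" "0 \<le> Z2" and s: "0 < s" and b0: "0 \<le> b0"
    and V1: "(\<Sum>m=1..M. (sqrt (real (k m)) - sqrt (real (k (m - 1)))) / (sqrt (real (k m)) + sqrt (real (k (m - 1))))) \<le> V"
    and V2: "(\<Sum>m=1..M. (sqrt (S (m - 1)) - sqrt (S m)) / (sqrt (S (m - 1)) + sqrt (S m))) \<le> V"
    and V: "0 \<le> V"
    and crit: "(\<Sum>l=1..k M. (1 - shrink M k w l)\<^sup>2 * (a l + e l)\<^sup>2) + 2 * h * (\<Sum>l=1..k M. shrink M k w l)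
       \<le> (\<Sum>l=1..k M. (1 - shrink M k ws l)\<^sup>2 * (a l + e l)\<^sup>2) + 2 * h * (\<Sum>l=1..k M. shrink M k ws l)"
  defines "rsk \<equiv> \<lambda>w. b0 + (\<Sum>l=1..k M. (1 - shrink M k w l)\<^sup>2 * (a l)\<^sup>2) + s\<^sup>2 * (\<Sum>l=1..k M. (shrink M k w l)\<^sup>2)"
  defines "noise \<equiv> 2 * (\<Sum>l=1..k M. (1 - shrink M k ws l)\<^sup>2 * (a l * e l))
         - (\<Sum>l=1..k M. (2 * shrink M k ws l - (shrink M k ws l)\<^sup>2) * ((e l)\<^sup>2 - s\<^sup>2))"
  defines "B \<equiv> rsk ws + noise + 2 * s * sqrt V * (Z1 + Z2) * sqrt (rsk w)
         + 2 * \<bar>h - s\<^sup>2\<bar> * sqrt (real (k M)) / s * (sqrt (rsk ws) + sqrt (rsk w))"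
  shows "rsk w \<le> B" and "b0 + (\<Sum>l=1..k M. (shrink M k w l * (a l + e l) - a l)\<^sup>2) \<le> B"
proof -
  define g where "g = shrink M k w"
  define gs where "gs = shrink M k ws"
  define L where "L = {1..k M}"
  note defs = g_def gs_def L_def
  have rsks: "rsk ws = b0 + ((\<Sum>l\<in>L. (1 - gs l)\<^sup>2 * (a l)\<^sup>2) + s\<^sup>2 * (\<Sum>l\<in>L. (gs l)\<^sup>2))"
    and rskw: "rsk w = b0 + ((\<Sum>l\<in>L. (1 - g l)\<^sup>2 * (a l)\<^sup>2) + s\<^sup>2 * (\<Sum>l\<in>L. (g l)\<^sup>2))"
    by (simp_all only: rsk_def defs add.assoc)
  have g: "0 \<le> g l" "g l \<le> 1" for l using shrink_bounds[OF w] by (auto simp: g_def)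
  have gs: "0 \<le> gs l" "gs l \<le> 1" for l using shrink_bounds[OF ws] by (auto simp: gs_def)
  have bias_le: "(\<Sum>l\<in>L. (1 - g l)\<^sup>2 * (a l)\<^sup>2) \<le> rsk w"
    and var_le: "s\<^sup>2 * (\<Sum>l\<in>L. (g l)\<^sup>2) \<le> rsk w" and var_le': "s\<^sup>2 * (\<Sum>l\<in>L. (gs l)\<^sup>2) \<le> rsk ws"
    using b0 by (auto simp: rskw rsks sum_nonneg)
  \<comment> \<open>Cauchy--Schwarz against the constant 1: the variance part of the risk controls
    the effective number of parameters. This prices an error in the variance estimate.\<close>
  have size: "(\<Sum>l\<in>L. u l) \<le> sqrt (real (k M)) / s * sqrt r"
    if "s\<^sup>2 * (\<Sum>l\<in>L. (u l)\<^sup>2) \<le> r" "\<And>l. 0 \<le> u l" for u :: "nat \<Rightarrow> real" and r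
  proof -
    have "(\<Sum>l\<in>L. 1 * u l)\<^sup>2 \<le> (\<Sum>l\<in>L. 1\<^sup>2) * (\<Sum>l\<in>L. (u l)\<^sup>2)"
      by (rule Cauchy_Schwarz_ineq_sum)
    also have "\<dots> \<le> real (k M) * (r / s\<^sup>2)"
      using that(1) s by (intro mult_mono) (auto simp: L_def field_simps sum_nonneg)
    finally have "(\<Sum>l\<in>L. u l) \<le> sqrt (real (k M) * (r / s\<^sup>2))"
      by (intro real_le_rsqrt) simp
    then show ?thesis
      using s by (simp add: real_sqrt_mult real_sqrt_divide)
  qed
  have bias1: "- (\<Sum>l\<in>L. h1 (g l) * (a l * e l)) \<le> Z1 * s * sqrt V * sqrt (rsk w)"
    if "\<And>x. 0 \<le> x \<Longrightarrow> x \<le> 1 \<Longrightarrow> 0 \<le> h1 x \<and> h1 x \<le> 1 - x"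
      "\<And>x y. 0 \<le> x \<Longrightarrow> x \<le> y \<Longrightarrow> y \<le> 1 \<Longrightarrow> h1 y \<le> h1 x" for h1 :: "real \<Rightarrow> real"
  proof -
    have "- (\<Sum>l\<in>L. h1 (g l) * (a l * e l)) \<le> Z1 * s * sqrt V * sqrt (\<Sum>l\<in>L. (1 - g l)\<^sup>2 * (a l)\<^sup>2)"
      using bias_term_bound[where k = k and M = M and Z = "Z1 * s" and h = h1 and a = a and e = e and S = S,
          OF k0 k w S T1 _ that V2] Z s unfolding defs by simp
    also have "\<dots> \<le> Z1 * s * sqrt V * sqrt (rsk w)"
      using bias_le Z s V by (intro mult_left_mono) auto
    finally show ?thesis .
  qed
  have var1: "(\<Sum>l\<in>L. h1 (g l) * ((e l)\<^sup>2 - s\<^sup>2)) \<le> 2 * Z2 * s * sqrt V * sqrt (rsk w)"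
    if "\<And>x. 0 \<le> x \<Longrightarrow> x \<le> 1 \<Longrightarrow> 0 \<le> h1 x \<and> h1 x \<le> 2 * x"
      "\<And>x y. 0 \<le> x \<Longrightarrow> x \<le> y \<Longrightarrow> y \<le> 1 \<Longrightarrow> h1 x \<le> h1 y" for h1 :: "real \<Rightarrow> real"
  proof -
    have "(\<Sum>l\<in>L. h1 (g l) * ((e l)\<^sup>2 - s\<^sup>2)) \<le> 2 * (Z2 * s\<^sup>2) * sqrt V * sqrt (\<Sum>l\<in>L. (g l)\<^sup>2)"
      using variance_term_bound[where k = k and M = M and Z = "Z2 * s\<^sup>2" and h = h1 and b = "\<lambda>l. (e l)\<^sup>2 - s\<^sup>2",
          OF k0 k w T2 _ that V1] Z s unfolding defs by simp
    also have "\<dots> = 2 * Z2 * s * sqrt V * sqrt (s\<^sup>2 * (\<Sum>l\<in>L. (g l)\<^sup>2))"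
      using s by (simp add: real_sqrt_mult power2_eq_square)
    also have "\<dots> \<le> 2 * Z2 * s * sqrt V * sqrt (rsk w)"
      using var_le Z s V by (intro mult_left_mono) auto
    finally show ?thesis .
  qed
  have hdiff: "2 * (h - s\<^sup>2) * ((\<Sum>l\<in>L. gs l) - (\<Sum>l\<in>L. g l))
     \<le> 2 * \<bar>h - s\<^sup>2\<bar> * sqrt (real (k M)) / s * (sqrt (rsk ws) + sqrt (rsk w))"
  proof -
    have "(h - s\<^sup>2) * ((\<Sum>l\<in>L. gs l) - (\<Sum>l\<in>L. g l)) \<le> \<bar>h - s\<^sup>2\<bar> * \<bar>(\<Sum>l\<in>L. gs l) - (\<Sum>l\<in>L. g l)\<bar>"
      by (metis abs_ge_self abs_mult)
    also have "\<dots> \<le> \<bar>h - s\<^sup>2\<bar> * (sqrt (real (k M)) / s * sqrt (rsk ws) + sqrt (real (k M)) / s * sqrt (rsk w))"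
    proof (rule mult_left_mono)
      have "0 \<le> (\<Sum>l\<in>L. gs l)" "0 \<le> (\<Sum>l\<in>L. g l)" using g gs by (auto intro: sum_nonneg)
      then show "\<bar>(\<Sum>l\<in>L. gs l) - (\<Sum>l\<in>L. g l)\<bar> \<le> sqrt (real (k M)) / s * sqrt (rsk ws) + sqrt (real (k M)) / s * sqrt (rsk w)"
        using size[OF var_le g(1)] size[OF var_le' gs(1)] by linarith
    qed simp
    finally have "2 * ((h - s\<^sup>2) * ((\<Sum>l\<in>L. gs l) - (\<Sum>l\<in>L. g l)))
       \<le> 2 * (\<bar>h - s\<^sup>2\<bar> * (sqrt (real (k M)) / s * sqrt (rsk ws) + sqrt (real (k M)) / s * sqrt (rsk w)))"
      by simp
    also have "\<dots> = 2 * \<bar>h - s\<^sup>2\<bar> * sqrt (real (k M)) / s * (sqrt (rsk ws) + sqrt (rsk w))"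
      by (simp add: distrib_left mult.assoc)
    finally show ?thesis by (simp only: mult.assoc)
  qed
  have crit': "(\<Sum>l\<in>L. (1 - g l)\<^sup>2 * (a l + e l)\<^sup>2) + 2 * h * (\<Sum>l\<in>L. g l)
       \<le> (\<Sum>l\<in>L. (1 - gs l)\<^sup>2 * (a l + e l)\<^sup>2) + 2 * h * (\<Sum>l\<in>L. gs l)"
    using crit unfolding defs .
  \<comment> \<open>The identity holds coordinate by coordinate: the coefficients of
    \<open>(e l)^2\<close> cancel because \<open>(1 - u)^2 + (2 * u - u^2) = 1\<close>. The last sum
    does not depend on \<open>u\<close> and drops out when two weight vectors are compared.\<close>
  have risk_id: "(\<Sum>l\<in>L. (1 - u l)\<^sup>2 * (a l)\<^sup>2) + s\<^sup>2 * (\<Sum>l\<in>L. (u l)\<^sup>2)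
     = (\<Sum>l\<in>L. (1 - u l)\<^sup>2 * (a l + e l)\<^sup>2) + 2 * s\<^sup>2 * (\<Sum>l\<in>L. u l) - 2 * (\<Sum>l\<in>L. (1 - u l)\<^sup>2 * (a l * e l))
       + (\<Sum>l\<in>L. (2 * u l - (u l)\<^sup>2) * ((e l)\<^sup>2 - s\<^sup>2)) - (\<Sum>l\<in>L. (e l)\<^sup>2)" for u
    unfolding sum_distrib_left sum.distrib[symmetric] sum_subtractf[symmetric]
    by (rule sum.cong) (simp_all add: power2_eq_square algebra_simps)
  have loss_id: "(\<Sum>l\<in>L. (u l * (a l + e l) - a l)\<^sup>2)
     = (\<Sum>l\<in>L. (1 - u l)\<^sup>2 * (a l + e l)\<^sup>2) + 2 * s\<^sup>2 * (\<Sum>l\<in>L. u l) - 2 * (\<Sum>l\<in>L. (1 - u l) * (a l * e l))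
       + (\<Sum>l\<in>L. (2 * u l) * ((e l)\<^sup>2 - s\<^sup>2)) - (\<Sum>l\<in>L. (e l)\<^sup>2)" for u
    unfolding sum_distrib_left sum.distrib[symmetric] sum_subtractf[symmetric]
    by (rule sum.cong) (simp_all add: power2_eq_square algebra_simps)
  have b1: "- (\<Sum>l\<in>L. (1 - g l)\<^sup>2 * (a l * e l)) \<le> Z1 * s * sqrt V * sqrt (rsk w)"
  proof (rule bias1[where ?h1.0 = "\<lambda>x. (1 - x)\<^sup>2"])
    fix x y :: real
    show "0 \<le> x \<Longrightarrow> x \<le> 1 \<Longrightarrow> 0 \<le> (1 - x)\<^sup>2 \<and> (1 - x)\<^sup>2 \<le> 1 - x"
      by (simp add: power2_eq_square mult_left_le)
    show "0 \<le> x \<Longrightarrow> x \<le> y \<Longrightarrow> y \<le> 1 \<Longrightarrow> (1 - y)\<^sup>2 \<le> (1 - x)\<^sup>2"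
      by (rule power_mono) auto
  qed
  have b2: "- (\<Sum>l\<in>L. (1 - g l) * (a l * e l)) \<le> Z1 * s * sqrt V * sqrt (rsk w)"
    by (rule bias1[where ?h1.0 = "\<lambda>x. 1 - x"]) auto
  have v1: "(\<Sum>l\<in>L. (2 * g l - (g l)\<^sup>2) * ((e l)\<^sup>2 - s\<^sup>2)) \<le> 2 * Z2 * s * sqrt V * sqrt (rsk w)"
  proof (rule var1[where ?h1.0 = "\<lambda>x. 2 * x - x\<^sup>2"])
    fix x y :: real
    show "0 \<le> x \<Longrightarrow> x \<le> 1 \<Longrightarrow> 0 \<le> 2 * x - x\<^sup>2 \<and> 2 * x - x\<^sup>2 \<le> 2 * x"
      using mult_left_le[of x x] by (simp add: power2_eq_square)
    assume xy: "0 \<le> x" "x \<le> y" "y \<le> 1"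
    have "(1 - y)\<^sup>2 \<le> (1 - x)\<^sup>2" using xy by (intro power_mono) auto
    then show "2 * x - x\<^sup>2 \<le> 2 * y - y\<^sup>2" by (simp add: power2_diff)
  qed
  have v2: "(\<Sum>l\<in>L. (2 * g l) * ((e l)\<^sup>2 - s\<^sup>2)) \<le> 2 * Z2 * s * sqrt V * sqrt (rsk w)"
    by (rule var1[where ?h1.0 = "\<lambda>x. 2 * x"]) auto
  have split: "2 * s * sqrt V * (Z1 + Z2) * sqrt (rsk w)
     = 2 * (Z1 * s * sqrt V * sqrt (rsk w)) + 2 * Z2 * s * sqrt V * sqrt (rsk w)"
    by (simp add: algebra_simps)
  have hd: "2 * h * ((\<Sum>l\<in>L. gs l) - (\<Sum>l\<in>L. g l))
     \<le> 2 * s\<^sup>2 * ((\<Sum>l\<in>L. gs l) - (\<Sum>l\<in>L. g l)) + 2 * \<bar>h - s\<^sup>2\<bar> * sqrt (real (k M)) / s * (sqrt (rsk ws) + sqrt (rsk w))"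
    using hdiff by (simp add: algebra_simps)
  have noise: "noise = 2 * (\<Sum>l\<in>L. (1 - gs l)\<^sup>2 * (a l * e l)) - (\<Sum>l\<in>L. (2 * gs l - (gs l)\<^sup>2) * ((e l)\<^sup>2 - s\<^sup>2))"
    by (simp only: noise_def defs)
  \<comment> \<open>The optimal weights always enter through their risk, even when the loss of
    \<open>w\<close> is bounded; hence one and the same \<open>noise\<close> appears in both
    conclusions.\<close>
  note r = rsks[unfolded risk_id]
  show "b0 + (\<Sum>l=1..k M. (shrink M k w l * (a l + e l) - a l)\<^sup>2) \<le> B"
    unfolding B_def split noise g_def[symmetric] L_def[symmetric] loss_id
    using r crit' hd b2 v2 by (simp only: right_diff_distrib; linarith)
  have "b0 + ((\<Sum>l\<in>L. (1 - g l)\<^sup>2 * (a l)\<^sup>2) + s\<^sup>2 * (\<Sum>l\<in>L. (g l)\<^sup>2)) \<le> B"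
    unfolding B_def split noise risk_id
    using r crit' hd b1 v1 by (simp only: right_diff_distrib; linarith)
  then show "rsk w \<le> B"
    using rskw by simp
qed

section \<open>Comparison of the noise with a wide Gaussian\<close>

abbreviation gauss :: "real \<Rightarrow> real measure" where
  "gauss t \<equiv> density lborel (\<lambda>x. ennreal (normal_density 0 t x))"

text \<open>Completing the square: the tilted density is a constant multiple of another normal
  density, and the constant is the integral.\<close>

lemma nn_integral_gauss_exp_quadratic:
  assumes t: "0 < t" and a: "2 * \<alpha> * t\<^sup>2 < 1"
  shows "(\<integral>\<^sup>+x. ennreal (exp (\<alpha> * x\<^sup>2 + b * x)) \<partial>gauss t)
    = ennreal (exp (b\<^sup>2 * t\<^sup>2 / (2 * (1 - 2 * \<alpha> * t\<^sup>2))) / sqrt (1 - 2 * \<alpha> * t\<^sup>2))"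
proof -
  define d where "d = 1 - 2 * \<alpha> * t\<^sup>2"
  have d: "d > 0" using a by (simp add: d_def)
  \<comment> \<open>Standard deviation and mean of the tilted Gaussian, and the normalising
    constant.\<close>
  define \<tau> where "\<tau> = t / sqrt d"
  define \<mu> where "\<mu> = b * t\<^sup>2 / d"
  define c where "c = exp (b\<^sup>2 * t\<^sup>2 / (2 * d)) / sqrt d"
  have \<tau>: "\<tau> > 0" and \<tau>2: "\<tau>\<^sup>2 = t\<^sup>2 / d" using t d by (auto simp: \<tau>_def power_divide)
  have dens: "normal_density 0 t x * exp (\<alpha> * x\<^sup>2 + b * x) = c * normal_density \<mu> \<tau> x" for x
  proof -
    have ex: "- (x\<^sup>2 / (2 * t\<^sup>2)) + (\<alpha> * x\<^sup>2 + b * x) = b\<^sup>2 * t\<^sup>2 / (2 * d) + - ((x - \<mu>)\<^sup>2 / (2 * \<tau>\<^sup>2))"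
    proof -
      have \<alpha>: "\<alpha> = (1 - d) / (2 * t\<^sup>2)" using t by (simp add: d_def)
      show ?thesis
        unfolding \<tau>2 \<mu>_def \<alpha> using t d by (simp add: field_simps power2_eq_square)
    qed
    have "sqrt (2 * pi * \<tau>\<^sup>2) = sqrt (2 * pi * t\<^sup>2) / sqrt d"
      unfolding \<tau>2 by (simp add: real_sqrt_divide[symmetric])
    then have const: "1 / sqrt (2 * pi * t\<^sup>2) = 1 / sqrt d * (1 / sqrt (2 * pi * \<tau>\<^sup>2))"
      using d by simp
    have "normal_density 0 t x * exp (\<alpha> * x\<^sup>2 + b * x)
        = 1 / sqrt (2 * pi * t\<^sup>2) * exp (- (x\<^sup>2 / (2 * t\<^sup>2)) + (\<alpha> * x\<^sup>2 + b * x))"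
      by (simp only: exp_add) (simp add: normal_density_def)
    also have "\<dots> = c * normal_density \<mu> \<tau> x"
      unfolding ex const by (simp only: exp_add) (simp add: normal_density_def c_def)
    finally show ?thesis .
  qed
  have "(\<integral>\<^sup>+x. ennreal (exp (\<alpha> * x\<^sup>2 + b * x)) \<partial>gauss t)
    = (\<integral>\<^sup>+x. ennreal (normal_density 0 t x) * ennreal (exp (\<alpha> * x\<^sup>2 + b * x)) \<partial>lborel)"
    by (rule nn_integral_density) auto
  also have "\<dots> = (\<integral>\<^sup>+x. ennreal c * ennreal (normal_density \<mu> \<tau> x) \<partial>lborel)"
    by (rule nn_integral_cong) (simp add: ennreal_mult'[symmetric] dens c_def d less_imp_le)
  also have "\<dots> = ennreal c * (\<integral>\<^sup>+x. ennreal (normal_density \<mu> \<tau> x) \<partial>lborel)"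
    by (rule nn_integral_cmult) simp
  also have "(\<integral>\<^sup>+x. ennreal (normal_density \<mu> \<tau> x) \<partial>lborel) = 1"
  proof -
    interpret prob_space "density lborel (normal_density \<mu> \<tau>)"
      by (rule prob_space_normal_density[OF \<tau>])
    show ?thesis using emeasure_space_1 by (simp add: emeasure_density)
  qed
  finally show ?thesis by (simp add: c_def d_def)
qed

lemma nn_integral_gauss_exp_linear:
  assumes "0 < t"
  shows "(\<integral>\<^sup>+x. ennreal (exp (b * x)) \<partial>gauss t) = ennreal (exp (b\<^sup>2 * t\<^sup>2 / 2))"
  using nn_integral_gauss_exp_quadratic[of t 0 b] assms by simp

text \<open>Two terms of the series of \<open>ln (1 - v)\<close>. At \<open>v = 2 * u\<close> it
  yields \<open>exp (u + u^2) \<le> 1 / sqrt (1 - 2 * u)\<close>; the quadratic term will pay for a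
  second-order remainder of the noise. The derivative of the function below is
  \<open>- (x^2) * exp (x + x^2 / 2)\<close>.\<close>

lemma one_minus_le_exp:
  fixes v :: real
  assumes "0 \<le> v"
  shows "1 - v \<le> exp (- v - v\<^sup>2 / 2)"
proof -
  let ?f = "\<lambda>v::real. (1 - v) * exp (v + v\<^sup>2 / 2)"
  have "?f v \<le> ?f 0"
  proof (rule DERIV_nonpos_imp_nonincreasing[OF assms])
    fix x :: real assume "0 \<le> x" "x \<le> v"
    have "(?f has_real_derivative (- (x\<^sup>2) * exp (x + x\<^sup>2 / 2))) (at x)"
      by (auto intro!: derivative_eq_intros simp: field_simps power2_eq_square)
    moreover have "- (x\<^sup>2) * exp (x + x\<^sup>2 / 2) \<le> 0" by simp
    ultimately show "\<exists>y. (?f has_real_derivative y) (at x) \<and> y \<le> 0" by blast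
  qed
  then have "(1 - v) * exp (v + v\<^sup>2 / 2) * exp (- v - v\<^sup>2 / 2) \<le> 1 * exp (- v - v\<^sup>2 / 2)"
    by (intro mult_right_mono) auto
  also have "(1 - v) * exp (v + v\<^sup>2 / 2) * exp (- v - v\<^sup>2 / 2) = 1 - v"
    by (simp add: mult.assoc exp_add[symmetric])
  finally show ?thesis by simp
qed

section \<open>Exponential moments of a single noise variable\<close>

lemma noise_distD:
  assumes "noise_dist D \<sigma> K"
  shows "prob_space D" "sets D = sets borel" "\<sigma> > 0" "integrable D (\<lambda>x. x\<^sup>2)" "(\<integral>x. x\<^sup>2 \<partial>D) = \<sigma>\<^sup>2"
    "integrable D (\<lambda>x. x)" "(\<integral>x. x \<partial>D) = 0"
  using assms by (auto simp: noise_dist_def)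

lemma nn_integral_noise_exp:
  assumes "noise_dist D \<sigma> K"
  shows "(\<integral>\<^sup>+x. ennreal (exp (t * x)) \<partial>D) \<le> ennreal (exp (t\<^sup>2 * K\<^sup>2 * \<sigma>\<^sup>2 / 2))"
proof -
  have i: "integrable D (\<lambda>x. exp (t * x))" "(\<integral>x. exp (t * x) \<partial>D) \<le> exp (t\<^sup>2 * K\<^sup>2 * \<sigma>\<^sup>2 / 2)"
    using assms by (auto simp: noise_dist_def)
  show ?thesis
    by (subst nn_integral_eq_integral[OF i(1)]) (use i(2) in \<open>auto intro: ennreal_leI\<close>)
qed

lemma gauss_sigma_finite: "0 < t \<Longrightarrow> sigma_finite_measure (gauss t)"
  using prob_space_normal_density[of t 0] by (metis prob_space_imp_sigma_finite)

text \<open>\<open>exp (\<gamma> * x^2)\<close> is the mean of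
  \<open>exp (sqrt (2 * \<gamma>) * x * h)\<close> over a standard Gaussian \<open>h\<close>. After
  exchanging the integrals the sub-Gaussian condition applies, and a Gaussian integral
  remains.\<close>

lemma nn_integral_noise_exp_square:
  assumes nd: "noise_dist D \<sigma> K" and g: "0 \<le> \<gamma>" "2 * \<gamma> * (K\<^sup>2 * \<sigma>\<^sup>2) < 1"
  shows "(\<integral>\<^sup>+x. ennreal (exp (\<gamma> * x\<^sup>2)) \<partial>D) \<le> ennreal (1 / sqrt (1 - 2 * \<gamma> * (K\<^sup>2 * \<sigma>\<^sup>2)))"
proof -
  interpret D: prob_space D using noise_distD[OF nd] by simp
  interpret N: sigma_finite_measure "gauss 1" by (rule gauss_sigma_finite) simp
  interpret pair_sigma_finite D "gauss 1" ..
  have [measurable_cong]: "sets D = sets borel" using noise_distD[OF nd] by simp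
  have "(\<integral>\<^sup>+x. ennreal (exp (\<gamma> * x\<^sup>2)) \<partial>D) = (\<integral>\<^sup>+x. \<integral>\<^sup>+h. ennreal (exp ((sqrt (2 * \<gamma>) * x) * h)) \<partial>gauss 1 \<partial>D)"
    using g by (simp add: nn_integral_gauss_exp_linear power_mult_distrib)
  also have "\<dots> = (\<integral>\<^sup>+h. \<integral>\<^sup>+x. ennreal (exp ((sqrt (2 * \<gamma>) * x) * h)) \<partial>D \<partial>gauss 1)"
    by (rule Fubini'[symmetric]) measurable
  also have "\<dots> \<le> (\<integral>\<^sup>+h. ennreal (exp ((\<gamma> * (K\<^sup>2 * \<sigma>\<^sup>2)) * h\<^sup>2 + 0 * h)) \<partial>gauss 1)"
  proof (rule nn_integral_mono)
    fix h :: real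
    have "(\<integral>\<^sup>+x. ennreal (exp ((sqrt (2 * \<gamma>) * x) * h)) \<partial>D) = (\<integral>\<^sup>+x. ennreal (exp ((sqrt (2 * \<gamma>) * h) * x)) \<partial>D)"
      by (simp add: mult_ac)
    also have "\<dots> \<le> ennreal (exp ((sqrt (2 * \<gamma>) * h)\<^sup>2 * K\<^sup>2 * \<sigma>\<^sup>2 / 2))"
      by (rule nn_integral_noise_exp[OF nd])
    also have "(sqrt (2 * \<gamma>) * h)\<^sup>2 * K\<^sup>2 * \<sigma>\<^sup>2 / 2 = (\<gamma> * (K\<^sup>2 * \<sigma>\<^sup>2)) * h\<^sup>2 + 0 * h"
      using g by (simp add: power_mult_distrib)
    finally show "(\<integral>\<^sup>+x. ennreal (exp ((sqrt (2 * \<gamma>) * x) * h)) \<partial>D) \<le> ennreal (exp ((\<gamma> * (K\<^sup>2 * \<sigma>\<^sup>2)) * h\<^sup>2 + 0 * h))" .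
  qed
  also have "\<dots> = ennreal (1 / sqrt (1 - 2 * \<gamma> * (K\<^sup>2 * \<sigma>\<^sup>2)))"
    by (subst nn_integral_gauss_exp_quadratic) (use g in \<open>auto simp: mult_ac\<close>)
  finally show ?thesis .
qed

lemma exp_le_taylor2:
  fixes u :: real
  assumes "0 \<le> u"
  shows "exp u \<le> 1 + u + u\<^sup>2 / 2 * exp u"
proof -
  let ?f = "\<lambda>u::real. 1 + u + u\<^sup>2 / 2 * exp u - exp u"
  have "?f 0 \<le> ?f u"
  proof (rule DERIV_nonneg_imp_nondecreasing[OF assms])
    fix x :: real assume x: "0 \<le> x" "x \<le> u"
    have "(?f has_real_derivative (1 + x * exp x + x\<^sup>2 / 2 * exp x - exp x)) (at x)"
      by (auto intro!: derivative_eq_intros simp: field_simps power2_eq_square)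
    moreover have "0 \<le> 1 + x * exp x + x\<^sup>2 / 2 * exp x - exp x"
    proof -
      have "(1 - x) * exp x \<le> exp (- x) * exp x"
        using exp_ge_add_one_self[of "- x"] by (intro mult_right_mono) auto
      then have "exp x - x * exp x \<le> 1" by (simp add: exp_minus left_diff_distrib)
      moreover have "0 \<le> x\<^sup>2 / 2 * exp x" by simp
      ultimately show ?thesis by linarith
    qed
    ultimately show "\<exists>y. (?f has_real_derivative y) (at x) \<and> 0 \<le> y" by blast
  qed
  then show ?thesis by simp
qed

lemma half_square_le_exp:
  fixes u :: real
  assumes "0 \<le> u"
  shows "u\<^sup>2 / 2 \<le> exp u"
  using exp_lower_Taylor_quadratic[OF assms] assms by simp

text \<open>The preceding bound has the wrong first-order term, the proxy
  \<open>K^2 * \<sigma>^2\<close> instead of the variance. Expanding the exponential to second order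
  keeps the exact mean; the crude bound is spent only on the remainder.\<close>

lemma nn_integral_noise_exp_square_sharp:
  assumes nd: "noise_dist D \<sigma> K" and K: "0 < K" and a: "0 \<le> \<alpha>" "64 * \<alpha> * (K\<^sup>2 * \<sigma>\<^sup>2) \<le> 1"
  shows "(\<integral>\<^sup>+x. ennreal (exp (2 * \<alpha> * x\<^sup>2)) \<partial>D) \<le> ennreal (exp (2 * \<alpha> * \<sigma>\<^sup>2 + 512 * (\<alpha> * (K\<^sup>2 * \<sigma>\<^sup>2))\<^sup>2))"
proof -
  interpret D: prob_space D using noise_distD[OF nd] by simp
  have [measurable_cong]: "sets D = sets borel" using noise_distD[OF nd] by simp
  define v where "v = K\<^sup>2 * \<sigma>\<^sup>2"
  have v: "0 < v" using K noise_distD(3)[OF nd] by (simp add: v_def)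
  \<comment> \<open>With this value the crude bound on the mean of
    \<open>exp (\<gamma> * x^2)\<close> is \<open>sqrt 2\<close>, rounded up to 2 below.\<close>
  define \<gamma> where "\<gamma> = 1 / (4 * v)"
  have \<gamma>: "0 < \<gamma>" "2 * \<gamma> * v = 1 / 2" using v by (auto simp: \<gamma>_def)
  have a\<gamma>: "2 * \<alpha> \<le> \<gamma> / 2"
    using a(2) v by (simp add: \<gamma>_def v_def[symmetric] field_simps)
  have pw: "exp (2 * \<alpha> * x\<^sup>2) \<le> 1 + 2 * \<alpha> * x\<^sup>2 + 256 * (\<alpha> * v)\<^sup>2 * exp (\<gamma> * x\<^sup>2)" for x :: real
  proof -
    \<comment> \<open>One half of the exponent \<open>\<gamma> * x^2\<close> absorbs the fourth
      power, the other half absorbs \<open>exp (2 * \<alpha> * x^2)\<close>.\<close>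
    have "x^4 \<le> 8 / \<gamma>\<^sup>2 * exp (\<gamma> / 2 * x\<^sup>2)"
      using half_square_le_exp[of "\<gamma> / 2 * x\<^sup>2"] \<gamma>(1)
      by (simp add: field_simps power_mult_distrib power2_eq_square power4_eq_xxxx)
    moreover have "2 * \<alpha> * x\<^sup>2 \<le> \<gamma> / 2 * x\<^sup>2"
      using a\<gamma> by (rule mult_right_mono) simp
    ultimately have "x^4 * exp (2 * \<alpha> * x\<^sup>2) \<le> (8 / \<gamma>\<^sup>2 * exp (\<gamma> / 2 * x\<^sup>2)) * exp (\<gamma> / 2 * x\<^sup>2)"
      by (intro mult_mono) simp_all
    also have "\<dots> = 8 / \<gamma>\<^sup>2 * exp (\<gamma> * x\<^sup>2)"
      by (simp add: exp_add[symmetric])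
    finally have "2 * \<alpha>\<^sup>2 * (x^4 * exp (2 * \<alpha> * x\<^sup>2)) \<le> 2 * \<alpha>\<^sup>2 * (8 / \<gamma>\<^sup>2 * exp (\<gamma> * x\<^sup>2))"
      by (intro mult_left_mono) auto
    also have "\<dots> = 256 * (\<alpha> * v)\<^sup>2 * exp (\<gamma> * x\<^sup>2)"
      using v by (simp add: \<gamma>_def power_divide power_mult_distrib)
    finally have "2 * \<alpha>\<^sup>2 * (x^4 * exp (2 * \<alpha> * x\<^sup>2)) \<le> 256 * (\<alpha> * v)\<^sup>2 * exp (\<gamma> * x\<^sup>2)" .
    moreover have "(2 * \<alpha> * x\<^sup>2)\<^sup>2 / 2 * exp (2 * \<alpha> * x\<^sup>2) = 2 * \<alpha>\<^sup>2 * (x^4 * exp (2 * \<alpha> * x\<^sup>2))"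
      by (simp add: power_mult_distrib)
    ultimately show ?thesis
      using exp_le_taylor2[of "2 * \<alpha> * x\<^sup>2"] a by auto
  qed
  have "(\<integral>\<^sup>+x. ennreal (exp (2 * \<alpha> * x\<^sup>2)) \<partial>D)
     \<le> (\<integral>\<^sup>+x. ennreal (1 + 2 * \<alpha> * x\<^sup>2) + ennreal (256 * (\<alpha> * v)\<^sup>2) * ennreal (exp (\<gamma> * x\<^sup>2)) \<partial>D)"
    using pw a by (intro nn_integral_mono) (auto simp: ennreal_mult'[symmetric] ennreal_plus[symmetric] simp del: ennreal_plus intro!: ennreal_leI)
  also have "\<dots> = (\<integral>\<^sup>+x. ennreal (1 + 2 * \<alpha> * x\<^sup>2) \<partial>D) + ennreal (256 * (\<alpha> * v)\<^sup>2) * (\<integral>\<^sup>+x. ennreal (exp (\<gamma> * x\<^sup>2)) \<partial>D)"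
    by (subst nn_integral_add) (auto simp: nn_integral_cmult)
  also have "(\<integral>\<^sup>+x. ennreal (1 + 2 * \<alpha> * x\<^sup>2) \<partial>D) = ennreal (1 + 2 * \<alpha> * \<sigma>\<^sup>2)"
    using noise_distD[OF nd] a by (subst nn_integral_eq_integral) (auto simp: D.prob_space)
  also have "ennreal (1 + 2 * \<alpha> * \<sigma>\<^sup>2) + ennreal (256 * (\<alpha> * v)\<^sup>2) * (\<integral>\<^sup>+x. ennreal (exp (\<gamma> * x\<^sup>2)) \<partial>D)
      \<le> ennreal (1 + 2 * \<alpha> * \<sigma>\<^sup>2) + ennreal (256 * (\<alpha> * v)\<^sup>2) * ennreal 2"
  proof (intro add_mono mult_left_mono order_refl)
    have "(\<integral>\<^sup>+x. ennreal (exp (\<gamma> * x\<^sup>2)) \<partial>D) \<le> ennreal (1 / sqrt (1 - 2 * \<gamma> * (K\<^sup>2 * \<sigma>\<^sup>2)))"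
      by (rule nn_integral_noise_exp_square[OF nd]) (use \<gamma> in \<open>auto simp: v_def\<close>)
    also have "1 / sqrt (1 - 2 * \<gamma> * (K\<^sup>2 * \<sigma>\<^sup>2)) \<le> 2"
    proof -
      have half: "1 / 2 \<le> sqrt (1 / 2 :: real)" by (rule real_le_rsqrt) (simp add: power2_eq_square)
      have eq: "1 - 2 * \<gamma> * (K\<^sup>2 * \<sigma>\<^sup>2) = 1 / 2"
        unfolding v_def[symmetric] \<gamma>(2) by simp
      show ?thesis unfolding eq using half by (simp add: divide_le_eq)
    qed
    finally show "(\<integral>\<^sup>+x. ennreal (exp (\<gamma> * x\<^sup>2)) \<partial>D) \<le> ennreal 2" by (simp add: ennreal_leI)
  qed simp
  also have "\<dots> = ennreal (1 + (2 * \<alpha> * \<sigma>\<^sup>2 + 512 * (\<alpha> * v)\<^sup>2))"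
    using a by (subst ennreal_mult'[symmetric], simp, subst ennreal_plus[symmetric]) auto
  also have "\<dots> \<le> ennreal (exp (2 * \<alpha> * \<sigma>\<^sup>2 + 512 * (\<alpha> * v)\<^sup>2))"
    by (intro ennreal_leI exp_ge_add_one_self)
  finally show ?thesis by (simp add: v_def)
qed

text \<open>Replacing the noise by a Gaussian of the larger variance \<open>t\<^sup>2 = 16K\<^sup>2\<sigma>\<^sup>2\<close> gains the factor
  \<open>exp (- \<alpha>(t\<^sup>2 - \<sigma>\<^sup>2))\<close>, exactly the difference of the means of \<open>\<alpha>x\<^sup>2\<close>. So the centred
  quadratic forms of the noise inherit the Gaussian deviation bound, although \<open>t > \<sigma>\<close>.\<close>
lemma nn_integral_noise_le_gauss:
  assumes nd: "noise_dist D \<sigma> K" and K: "0 < K" and a: "0 \<le> \<alpha>" "4 * \<alpha> * t\<^sup>2 \<le> 1" and t: "t = 4 * K * \<sigma>"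
  shows "(\<integral>\<^sup>+x. ennreal (exp (\<alpha> * x\<^sup>2 + b * x)) \<partial>D)
    \<le> ennreal (exp (- \<alpha> * (t\<^sup>2 - \<sigma>\<^sup>2))) * (\<integral>\<^sup>+x. ennreal (exp (\<alpha> * x\<^sup>2 + b * x)) \<partial>gauss t)"
proof -
  have [measurable_cong]: "sets D = sets borel" using noise_distD[OF nd] by simp
  have s: "0 < \<sigma>" using noise_distD[OF nd] by simp
  have tpos: "0 < t" using K s t by simp
  define v where "v = K\<^sup>2 * \<sigma>\<^sup>2"
  have tv: "t\<^sup>2 = 16 * v" by (simp add: t v_def power_mult_distrib)
  have v: "0 \<le> v" by (simp add: v_def)
  \<comment> \<open>The means of \<open>exp (2 * \<alpha> * x^2)\<close> and
    \<open>exp (2 * b * x)\<close> are at most \<open>exp (2 * p)\<close> and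
    \<open>exp (2 * r)\<close>.\<close>
  define p where "p = \<alpha> * \<sigma>\<^sup>2 + 256 * (\<alpha> * v)\<^sup>2"
  define r where "r = b\<^sup>2 * v"
  have pw: "exp (\<alpha> * x\<^sup>2 + b * x) \<le> exp (r - p) / 2 * exp (2 * \<alpha> * x\<^sup>2) + exp (p - r) / 2 * exp (2 * b * x)" for x :: real
  proof -
    \<comment> \<open>The arithmetic-geometric mean inequality separates the quadratic from the
      linear factor. The shift by \<open>(r - p) / 2\<close> balances the two summands, so that
      after integration they add up to exactly \<open>exp (p + r)\<close>.\<close>
    define A where "A = exp ((r - p) / 2 + \<alpha> * x\<^sup>2)"
    define B where "B = exp ((p - r) / 2 + b * x)"
    have "2 * (A * B) \<le> A\<^sup>2 + B\<^sup>2"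
      using zero_le_power2[of "A - B"] by (simp add: power2_diff)
    moreover have "A * B = exp (\<alpha> * x\<^sup>2 + b * x)"
      by (simp add: A_def B_def exp_add[symmetric] diff_divide_distrib)
    moreover have "A\<^sup>2 = exp (r - p) * exp (2 * \<alpha> * x\<^sup>2)" "B\<^sup>2 = exp (p - r) * exp (2 * b * x)"
      by (simp_all add: A_def B_def power2_eq_square exp_add[symmetric])
    ultimately show ?thesis by simp
  qed
  have sharp: "(\<integral>\<^sup>+x. ennreal (exp (2 * \<alpha> * x\<^sup>2)) \<partial>D) \<le> ennreal (exp (2 * p))"
    using nn_integral_noise_exp_square_sharp[OF nd K a(1)] a(2)[unfolded tv] unfolding v_def[symmetric] p_def
    by (simp add: mult_ac distrib_left)
  have lin: "(\<integral>\<^sup>+x. ennreal (exp (2 * b * x)) \<partial>D) \<le> ennreal (exp (2 * r))"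
    using nn_integral_noise_exp[OF nd, of "2 * b"] by (simp add: r_def v_def power_mult_distrib mult_ac)
  have "(\<integral>\<^sup>+x. ennreal (exp (\<alpha> * x\<^sup>2 + b * x)) \<partial>D)
     \<le> (\<integral>\<^sup>+x. ennreal (exp (r - p) / 2) * ennreal (exp (2 * \<alpha> * x\<^sup>2)) + ennreal (exp (p - r) / 2) * ennreal (exp (2 * b * x)) \<partial>D)"
    using pw by (intro nn_integral_mono) (auto simp: ennreal_mult'[symmetric] ennreal_plus[symmetric] simp del: ennreal_plus intro!: ennreal_leI)
  also have "\<dots> = ennreal (exp (r - p) / 2) * (\<integral>\<^sup>+x. ennreal (exp (2 * \<alpha> * x\<^sup>2)) \<partial>D)
      + ennreal (exp (p - r) / 2) * (\<integral>\<^sup>+x. ennreal (exp (2 * b * x)) \<partial>D)"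
    by (subst nn_integral_add) (auto simp: nn_integral_cmult)
  also have "\<dots> \<le> ennreal (exp (r - p) / 2) * ennreal (exp (2 * p)) + ennreal (exp (p - r) / 2) * ennreal (exp (2 * r))"
    by (intro add_mono mult_left_mono sharp lin) auto
  also have "\<dots> = ennreal (exp (r - p) / 2 * exp (2 * p) + exp (p - r) / 2 * exp (2 * r))"
    by (simp add: ennreal_mult'[symmetric] ennreal_plus[symmetric] del: ennreal_plus)
  also have "exp (r - p) / 2 * exp (2 * p) + exp (p - r) / 2 * exp (2 * r) = exp (p + r)"
    by (simp add: exp_add[symmetric] add.commute)
  also have "ennreal (exp (p + r)) \<le> ennreal (exp (- \<alpha> * (t\<^sup>2 - \<sigma>\<^sup>2)) * (exp (b\<^sup>2 * t\<^sup>2 / (2 * (1 - 2 * \<alpha> * t\<^sup>2))) / sqrt (1 - 2 * \<alpha> * t\<^sup>2)))"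
  proof (rule ennreal_leI)
    \<comment> \<open>This explains \<open>t = 4 * K * \<sigma>\<close>: since
      \<open>t^2 = 16 * v\<close>, the remainder \<open>256 * (\<alpha> * v)^2\<close> in
      \<open>p\<close> is exactly \<open>u^2\<close>, and the Gaussian factor
      \<open>1 / sqrt (1 - 2 * u)\<close> covers \<open>exp (u + u^2)\<close>.\<close>
    define u where "u = \<alpha> * t\<^sup>2"
    have u: "0 \<le> u" "4 * u \<le> 1" using a by (auto simp: u_def)
    have d: "1 - 2 * \<alpha> * t\<^sup>2 = 1 - 2 * u" by (simp add: u_def)
    have "1 - 2 * u \<le> (exp (- u - u\<^sup>2))\<^sup>2"
      using one_minus_le_exp[of "2 * u"] u by (simp add: exp_double[symmetric] power_mult_distrib)
    then have "sqrt (1 - 2 * u) \<le> sqrt ((exp (- u - u\<^sup>2))\<^sup>2)"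
      by (rule real_sqrt_le_mono)
    then have "sqrt (1 - 2 * u) \<le> exp (- u - u\<^sup>2)" by simp
    then have "exp (u + u\<^sup>2) * sqrt (1 - 2 * u) \<le> exp (u + u\<^sup>2) * exp (- u - u\<^sup>2)"
      by (intro mult_left_mono) auto
    then have S: "exp (u + u\<^sup>2) \<le> 1 / sqrt (1 - 2 * u)"
      using u by (simp add: exp_add[symmetric] le_divide_eq)
    have "b\<^sup>2 * v \<le> b\<^sup>2 * t\<^sup>2 / 2"
      unfolding tv using v by (simp add: mult_left_mono)
    also have "\<dots> \<le> b\<^sup>2 * t\<^sup>2 / (2 * (1 - 2 * u))"
      using u by (intro divide_left_mono) auto
    finally have E: "exp r \<le> exp (b\<^sup>2 * t\<^sup>2 / (2 * (1 - 2 * u)))"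
      by (simp add: r_def)
    have "p = - \<alpha> * (t\<^sup>2 - \<sigma>\<^sup>2) + (u + u\<^sup>2)"
      by (simp add: p_def u_def tv power_mult_distrib algebra_simps)
    then have "exp (p + r) = exp (- \<alpha> * (t\<^sup>2 - \<sigma>\<^sup>2)) * (exp r * exp (u + u\<^sup>2))"
      by (simp add: exp_add[symmetric])
    also have "\<dots> \<le> exp (- \<alpha> * (t\<^sup>2 - \<sigma>\<^sup>2)) * (exp (b\<^sup>2 * t\<^sup>2 / (2 * (1 - 2 * u))) * (1 / sqrt (1 - 2 * u)))"
      by (intro mult_left_mono mult_mono E S) auto
    finally show "exp (p + r) \<le> exp (- \<alpha> * (t\<^sup>2 - \<sigma>\<^sup>2)) * (exp (b\<^sup>2 * t\<^sup>2 / (2 * (1 - 2 * \<alpha> * t\<^sup>2))) / sqrt (1 - 2 * \<alpha> * t\<^sup>2))"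
      unfolding d by simp
  qed
  also have "\<dots> = ennreal (exp (- \<alpha> * (t\<^sup>2 - \<sigma>\<^sup>2))) * (\<integral>\<^sup>+x. ennreal (exp (\<alpha> * x\<^sup>2 + b * x)) \<partial>gauss t)"
    by (subst nn_integral_gauss_exp_quadratic) (use tpos a in \<open>auto simp: ennreal_mult'[symmetric]\<close>)
  finally show ?thesis .
qed

section \<open>Deviations of linear and quadratic forms\<close>

text \<open>Lindeberg's replacement: an inequality in one coordinate, valid for all values of the
  others, is applied to the coordinates in turn. Once coordinate \<open>i\<close> has been
  exchanged, Fubini moves it outside and the induction hypothesis is used with it frozen.\<close>

lemma nn_integral_PiM_le_replace:
  fixes q :: "('i \<Rightarrow> real) \<Rightarrow> ennreal" and c :: "'i \<Rightarrow> ennreal"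
  assumes "sigma_finite_measure D" "sigma_finite_measure N"
    and sets: "sets D = sets borel" "sets N = sets borel"
    and "finite I" and "q \<in> borel_measurable (PiM I (\<lambda>_. borel))"
    and "\<And>i x. i \<in> I \<Longrightarrow> (\<integral>\<^sup>+y. q (x(i := y)) \<partial>D) \<le> c i * (\<integral>\<^sup>+y. q (x(i := y)) \<partial>N)"
  shows "(\<integral>\<^sup>+x. q x \<partial>PiM I (\<lambda>_. D)) \<le> (\<Prod>i\<in>I. c i) * (\<integral>\<^sup>+x. q x \<partial>PiM I (\<lambda>_. N))"
  using assms(5-7)
proof (induction I arbitrary: q rule: finite_induct)
  case empty
  have eq: "PiM {} (\<lambda>_. D) = PiM {} (\<lambda>_. N)" by (simp add: PiM_empty)
  show ?case unfolding eq by simp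
next
  case (insert i J)
  interpret D: product_sigma_finite "\<lambda>_::'i. D" using assms(1) by (simp add: product_sigma_finite_def)
  interpret N: product_sigma_finite "\<lambda>_::'i. N" using assms(2) by (simp add: product_sigma_finite_def)
  interpret DJ: sigma_finite_measure "PiM J (\<lambda>_. D)" by (rule D.sigma_finite) fact
  interpret NN: sigma_finite_measure N by fact
  interpret P: pair_sigma_finite "PiM J (\<lambda>_. D)" N ..
  note [measurable_cong] = sets
  have setsP: "sets (PiM I' (\<lambda>_. D)) = sets (PiM I' (\<lambda>_. borel))" "sets (PiM I' (\<lambda>_. N)) = sets (PiM I' (\<lambda>_. borel))" for I' :: "'i set"
    using sets by (auto intro!: sets_PiM_cong)
  have qD[measurable]: "q \<in> borel_measurable (PiM (insert i J) (\<lambda>_. D))"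
    and qN[measurable]: "q \<in> borel_measurable (PiM (insert i J) (\<lambda>_. N))"
    using insert.prems(1) setsP by (auto cong: measurable_cong_sets)
  have upd[measurable]: "(\<lambda>(x, y). q (x(i := y))) \<in> borel_measurable (PiM J (\<lambda>_. borel) \<Otimes>\<^sub>M borel)"
    using measurable_compose[OF measurable_add_dim[of i J "\<lambda>_. borel"] insert.prems(1)]
    by (simp add: case_prod_beta')
  have updD[measurable]: "(\<lambda>(x, y). q (x(i := y))) \<in> borel_measurable (PiM J (\<lambda>_. D) \<Otimes>\<^sub>M N)"
  proof -
    have "sets (PiM J (\<lambda>_. D) \<Otimes>\<^sub>M N) = sets (PiM J (\<lambda>_. borel) \<Otimes>\<^sub>M borel)"
      by (rule sets_pair_measure_cong) (use sets setsP in auto)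
    then show ?thesis using upd by (simp cong: measurable_cong_sets)
  qed
  have "(\<integral>\<^sup>+x. q x \<partial>PiM (insert i J) (\<lambda>_. D)) = (\<integral>\<^sup>+x. \<integral>\<^sup>+y. q (x(i := y)) \<partial>D \<partial>PiM J (\<lambda>_. D))"
    by (rule D.product_nn_integral_insert) (use insert.hyps in auto)
  also have "\<dots> \<le> (\<integral>\<^sup>+x. c i * (\<integral>\<^sup>+y. q (x(i := y)) \<partial>N) \<partial>PiM J (\<lambda>_. D))"
    by (rule nn_integral_mono) (rule insert.prems(2), simp)
  also have "\<dots> = c i * (\<integral>\<^sup>+x. \<integral>\<^sup>+y. q (x(i := y)) \<partial>N \<partial>PiM J (\<lambda>_. D))"
    by (rule nn_integral_cmult) measurable
  also have "(\<integral>\<^sup>+x. \<integral>\<^sup>+y. q (x(i := y)) \<partial>N \<partial>PiM J (\<lambda>_. D)) = (\<integral>\<^sup>+y. \<integral>\<^sup>+x. q (x(i := y)) \<partial>PiM J (\<lambda>_. D) \<partial>N)"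
    by (rule P.Fubini'[symmetric]) measurable
  also have "c i * \<dots> \<le> c i * (\<integral>\<^sup>+y. (\<Prod>j\<in>J. c j) * (\<integral>\<^sup>+x. q (x(i := y)) \<partial>PiM J (\<lambda>_. N)) \<partial>N)"
  proof (intro mult_left_mono nn_integral_mono insert.IH)
    fix y :: real
    have "(\<lambda>x. (x, y)) \<in> measurable (PiM J (\<lambda>_. borel)) (PiM J (\<lambda>_. borel) \<Otimes>\<^sub>M borel)"
      by (rule measurable_Pair) auto
    from measurable_compose[OF this upd]
    show "(\<lambda>x. q (x(i := y))) \<in> borel_measurable (PiM J (\<lambda>_. borel))" by simp
    fix j x assume j: "j \<in> J"
    then have twist: "x(j := z, i := y) = x(i := y, j := z)" for z
      using insert.hyps by (intro fun_upd_twist) auto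
    show "(\<integral>\<^sup>+z. q (x(j := z, i := y)) \<partial>D) \<le> c j * (\<integral>\<^sup>+z. q (x(j := z, i := y)) \<partial>N)"
      unfolding twist by (rule insert.prems(2)) (use j in simp)
  qed simp
  also have "(\<integral>\<^sup>+y. (\<Prod>j\<in>J. c j) * (\<integral>\<^sup>+x. q (x(i := y)) \<partial>PiM J (\<lambda>_. N)) \<partial>N)
     = (\<Prod>j\<in>J. c j) * (\<integral>\<^sup>+y. \<integral>\<^sup>+x. q (x(i := y)) \<partial>PiM J (\<lambda>_. N) \<partial>N)"
  proof (rule nn_integral_cmult)
    interpret NJ: sigma_finite_measure "PiM J (\<lambda>_. N)" by (rule N.sigma_finite) fact
    have "sets (N \<Otimes>\<^sub>M PiM J (\<lambda>_. N)) = sets (borel \<Otimes>\<^sub>M PiM J (\<lambda>_. borel))"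
      by (rule sets_pair_measure_cong) (use sets setsP in auto)
    moreover have "(\<lambda>(y, x). q (x(i := y))) \<in> borel_measurable (borel \<Otimes>\<^sub>M PiM J (\<lambda>_. borel))"
      using measurable_compose[OF measurable_Pair[OF measurable_snd measurable_fst] upd]
      by (simp add: case_prod_beta')
    ultimately have "(\<lambda>(y, x). q (x(i := y))) \<in> borel_measurable (N \<Otimes>\<^sub>M PiM J (\<lambda>_. N))"
      by (simp cong: measurable_cong_sets)
    then show "(\<lambda>y. \<integral>\<^sup>+x. q (x(i := y)) \<partial>PiM J (\<lambda>_. N)) \<in> borel_measurable N"
      by (rule NJ.borel_measurable_nn_integral)
  qed
  also have "(\<integral>\<^sup>+y. \<integral>\<^sup>+x. q (x(i := y)) \<partial>PiM J (\<lambda>_. N) \<partial>N) = (\<integral>\<^sup>+x. q x \<partial>PiM (insert i J) (\<lambda>_. N))"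
    by (rule N.product_nn_integral_insert_rev[symmetric]) (use insert.hyps in auto)
  finally show ?case
    using insert.hyps by (simp add: mult.assoc)
qed

lemma nn_integral_PiM_exp_linear:
  assumes "sigma_finite_measure D" and [measurable_cong]: "sets D = sets borel" and "finite I"
    and "\<And>i. i \<in> I \<Longrightarrow> (\<integral>\<^sup>+x. ennreal (exp (c i * x)) \<partial>D) = ennreal (r i)"
  shows "(\<integral>\<^sup>+x. ennreal (exp (\<Sum>i\<in>I. c i * x i)) \<partial>PiM I (\<lambda>_. D)) = (\<Prod>i\<in>I. ennreal (r i))"
proof -
  interpret D: product_sigma_finite "\<lambda>_. D" using assms(1) by (simp add: product_sigma_finite_def)
  have "(\<integral>\<^sup>+x. ennreal (exp (\<Sum>i\<in>I. c i * x i)) \<partial>PiM I (\<lambda>_. D)) = (\<integral>\<^sup>+x. (\<Prod>i\<in>I. ennreal (exp (c i * x i))) \<partial>PiM I (\<lambda>_. D))"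
    using assms(3) by (simp add: exp_sum prod_ennreal)
  also have "\<dots> = (\<Prod>i\<in>I. (\<integral>\<^sup>+x. ennreal (exp (c i * x)) \<partial>D))"
    by (rule D.product_nn_integral_prod) (use assms(3) in auto)
  also have "\<dots> = (\<Prod>i\<in>I. ennreal (r i))"
    using assms(4) by (intro prod.cong) auto
  finally show ?thesis .
qed

text \<open>The square is linearised by an auxiliary standard Gaussian vector \<open>h\<close> with one
  coordinate for each \<open>l \<in> L\<close>.\<close>
lemma nn_integral_gauss_quadratic_form:
  assumes on: "orthonormal_on n L q" and L: "finite L" and t: "0 < t" and lam: "0 \<le> lam" "2 * lam * t\<^sup>2 < 1"
  shows "(\<integral>\<^sup>+x. ennreal (exp (lam * (\<Sum>l\<in>L. (inner_n n (q l) x)\<^sup>2))) \<partial>PiM {..<n} (\<lambda>_. gauss t))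
    = ennreal ((1 / sqrt (1 - 2 * lam * t\<^sup>2)) ^ card L)"
proof -
  \<comment> \<open>Then the Gaussian mean of \<open>exp (c * z * h)\<close> over \<open>h\<close>
    is \<open>exp (lam * z^2)\<close>.\<close>
  define c where "c = sqrt (2 * lam)"
  have c2: "c\<^sup>2 = 2 * lam" using lam by (simp add: c_def)
  have meas: "(\<lambda>x. ennreal (exp ((lam * t\<^sup>2) * x\<^sup>2 + 0 * x))) \<in> borel_measurable (gauss 1)"
    by measurable
  define N where "N = PiM {..<n} (\<lambda>_. gauss t)"
  define H where "H = PiM L (\<lambda>_. gauss 1)"
  have sfg: "sigma_finite_measure (gauss t)" "sigma_finite_measure (gauss 1)"
    using gauss_sigma_finite t by auto
  interpret Nt: product_sigma_finite "\<lambda>_::nat. gauss t" using sfg by (simp add: product_sigma_finite_def)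
  interpret N1: product_sigma_finite "\<lambda>_::nat. gauss 1" using sfg by (simp add: product_sigma_finite_def)
  interpret N: sigma_finite_measure N unfolding N_def by (rule Nt.sigma_finite) simp
  interpret H: sigma_finite_measure H unfolding H_def by (rule N1.sigma_finite) fact
  interpret P: pair_sigma_finite N H ..
  have [measurable]: "(\<lambda>x. x i) \<in> borel_measurable N" if "i < n" for i
    using measurable_component_singleton[of i "{..<n}" "\<lambda>_. gauss t"] that
      measurable_cong_sets[of N N "gauss t" borel] by (simp add: N_def)
  have [measurable]: "(\<lambda>x. x l) \<in> borel_measurable H" if "l \<in> L" for l
    using measurable_component_singleton[of l L "\<lambda>_. gauss 1"] that
      measurable_cong_sets[of H H "gauss 1" borel] by (simp add: H_def)
  have "(\<integral>\<^sup>+x. ennreal (exp (lam * (\<Sum>l\<in>L. (inner_n n (q l) x)\<^sup>2))) \<partial>N)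
      = (\<integral>\<^sup>+x. \<integral>\<^sup>+h. ennreal (exp (\<Sum>l\<in>L. (c * inner_n n (q l) x) * h l)) \<partial>H \<partial>N)"
  proof (rule nn_integral_cong)
    fix x
    have "(\<integral>\<^sup>+h. ennreal (exp (\<Sum>l\<in>L. (c * inner_n n (q l) x) * h l)) \<partial>H)
       = (\<Prod>l\<in>L. ennreal (exp ((c * inner_n n (q l) x)\<^sup>2 * 1\<^sup>2 / 2)))"
      unfolding H_def by (rule nn_integral_PiM_exp_linear[OF sfg(2) _ L]) (simp, rule nn_integral_gauss_exp_linear, simp)
    also have "\<dots> = ennreal (exp (lam * (\<Sum>l\<in>L. (inner_n n (q l) x)\<^sup>2)))"
      using L by (simp add: prod_ennreal exp_sum[symmetric] power_mult_distrib c2 sum_distrib_left)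
    finally show "ennreal (exp (lam * (\<Sum>l\<in>L. (inner_n n (q l) x)\<^sup>2)))
       = (\<integral>\<^sup>+h. ennreal (exp (\<Sum>l\<in>L. (c * inner_n n (q l) x) * h l)) \<partial>H)" by simp
  qed
  also have "\<dots> = (\<integral>\<^sup>+h. \<integral>\<^sup>+x. ennreal (exp (\<Sum>l\<in>L. (c * inner_n n (q l) x) * h l)) \<partial>N \<partial>H)"
    by (rule P.Fubini'[symmetric]) (unfold inner_n_def, measurable)
  also have "\<dots> = (\<integral>\<^sup>+h. (\<Prod>l\<in>L. ennreal (exp ((lam * t\<^sup>2) * (h l)\<^sup>2 + 0 * h l))) \<partial>H)"
  proof (rule nn_integral_cong)
    fix h :: "nat \<Rightarrow> real"
    define b where "b i = c * (\<Sum>l\<in>L. h l * q l i)" for i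
    have swap: "(\<Sum>l\<in>L. (c * inner_n n (q l) x) * h l) = (\<Sum>i<n. b i * x i)" for x
    proof -
      have "(\<Sum>l\<in>L. (c * inner_n n (q l) x) * h l) = (\<Sum>l\<in>L. \<Sum>i<n. c * (h l * q l i) * x i)"
        by (simp add: inner_n_def sum_distrib_left sum_distrib_right mult_ac)
      also have "\<dots> = (\<Sum>i<n. \<Sum>l\<in>L. c * (h l * q l i) * x i)"
        by (rule sum.swap)
      also have "\<dots> = (\<Sum>i<n. b i * x i)"
        by (simp add: b_def sum_distrib_left sum_distrib_right)
      finally show ?thesis .
    qed
    have "(\<integral>\<^sup>+x. ennreal (exp (\<Sum>l\<in>L. (c * inner_n n (q l) x) * h l)) \<partial>N) = (\<Prod>i<n. ennreal (exp ((b i)\<^sup>2 * t\<^sup>2 / 2)))"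
      unfolding swap N_def
      by (rule nn_integral_PiM_exp_linear[OF sfg(1)]) (simp_all, rule nn_integral_gauss_exp_linear, rule t)
    also have "\<dots> = ennreal (exp ((\<Sum>i<n. (b i)\<^sup>2) * t\<^sup>2 / 2))"
      by (simp add: prod_ennreal exp_sum[symmetric] sum_divide_distrib sum_distrib_right)
    \<comment> \<open>By orthonormality the squared length of \<open>b\<close> involves only the sum
      of the squares of \<open>h\<close>, so the remaining integral factorises over
      \<open>L\<close>.\<close>
    also have "(\<Sum>i<n. (b i)\<^sup>2) = 2 * lam * (\<Sum>l\<in>L. (h l)\<^sup>2)"
      by (simp add: b_def power_mult_distrib c2 sum_distrib_left[symmetric] norm_orthonormal_comb[OF on L])
    also have "2 * lam * (\<Sum>l\<in>L. (h l)\<^sup>2) * t\<^sup>2 / 2 = (\<Sum>l\<in>L. (lam * t\<^sup>2) * (h l)\<^sup>2 + 0 * h l)"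
      by (simp add: sum_distrib_left mult_ac)
    finally show "(\<integral>\<^sup>+x. ennreal (exp (\<Sum>l\<in>L. (c * inner_n n (q l) x) * h l)) \<partial>N)
       = (\<Prod>l\<in>L. ennreal (exp ((lam * t\<^sup>2) * (h l)\<^sup>2 + 0 * h l)))"
      using L by (simp add: prod_ennreal exp_sum)
  qed
  also have "\<dots> = (\<Prod>l\<in>L. (\<integral>\<^sup>+x. ennreal (exp ((lam * t\<^sup>2) * x\<^sup>2 + 0 * x)) \<partial>gauss 1))"
    unfolding H_def by (rule N1.product_nn_integral_prod[OF L meas])
  also have "\<dots> = (\<Prod>l\<in>L. ennreal (1 / sqrt (1 - 2 * lam * t\<^sup>2)))"
    by (subst nn_integral_gauss_exp_quadratic) (use lam in \<open>auto simp: mult_ac\<close>)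
  also have "\<dots> = ennreal ((1 / sqrt (1 - 2 * lam * t\<^sup>2)) ^ card L)"
    using lam by (simp add: ennreal_power)
  finally show ?thesis by (simp add: N_def)
qed

lemma inner_n_upd:
  assumes "i < n"
  shows "inner_n n u (x(i := y)) = u i * y + inner_n n u (x(i := 0))"
proof -
  have "inner_n n u (x(i := z)) = u i * z + (\<Sum>j\<in>{..<n} - {i}. u j * x j)" for z
    unfolding inner_n_def using assms by (subst sum.remove[of _ i]) auto
  then show ?thesis by (metis add_0 mult_zero_right)
qed

text \<open>A Hanson--Wright bound for projections. In one coordinate the form is quadratic with
  leading coefficient \<open>lam * \<kappa> i\<close>, where \<open>\<kappa> i\<close> is the
  diagonal entry of the projection onto the span of \<open>q\<close>: at most 1 by Bessel, and with
  trace \<open>card L\<close>. Each replacement gains a factor, and the trace collects these factors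
  into the exponent.\<close>

lemma nn_integral_noise_quadratic_form:
  assumes nd: "noise_dist D \<sigma> K" and K: "0 < K" and on: "orthonormal_on n L q" and L: "finite L"
    and t: "t = 4 * K * \<sigma>" and lam: "0 \<le> lam" "4 * lam * t\<^sup>2 \<le> 1"
  shows "(\<integral>\<^sup>+x. ennreal (exp (lam * (\<Sum>l\<in>L. (inner_n n (q l) x)\<^sup>2))) \<partial>noise_space n D)
    \<le> ennreal (exp (- lam * card L * (t\<^sup>2 - \<sigma>\<^sup>2)) * (1 / sqrt (1 - 2 * lam * t\<^sup>2)) ^ card L)"
proof -
  have tpos: "0 < t" using K noise_distD(3)[OF nd] t by simp
  interpret D: prob_space D using noise_distD[OF nd] by simp
  have [measurable_cong]: "sets D = sets borel" using noise_distD[OF nd] by simp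
  define \<kappa> where "\<kappa> i = (\<Sum>l\<in>L. (q l i)\<^sup>2)" for i
  have \<kappa>0: "0 \<le> \<kappa> i" for i by (simp add: \<kappa>_def sum_nonneg)
  have \<kappa>1: "\<kappa> i \<le> 1" if "i < n" for i
  proof -
    have "inner_n n (q l) (\<lambda>j. if j = i then 1 else 0) = q l i" for l
      using that by (simp add: inner_n_def if_distrib[of "\<lambda>x. _ * x"] cong: if_cong)
    moreover have "(\<Sum>j<n. (if j = i then 1 else 0 :: real)\<^sup>2) = 1"
      using that by (simp add: if_distrib[of "\<lambda>x. x ^ _"] cong: if_cong)
    ultimately show ?thesis
      using bessel_inequality[OF on L, of "\<lambda>j. if j = i then 1 else 0"] by (simp add: \<kappa>_def)
  qed
  have \<kappa>sum: "(\<Sum>i<n. \<kappa> i) = card L"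
  proof -
    have "(\<Sum>i<n. \<kappa> i) = (\<Sum>l\<in>L. inner_n n (q l) (q l))"
      unfolding \<kappa>_def inner_n_def by (subst sum.swap) (simp add: power2_eq_square)
    also have "\<dots> = card L" using on by (simp add: orthonormal_on_def)
    finally show ?thesis .
  qed
  let ?q = "\<lambda>x. ennreal (exp (lam * (\<Sum>l\<in>L. (inner_n n (q l) x)\<^sup>2)))"
  have "(\<integral>\<^sup>+x. ?q x \<partial>PiM {..<n} (\<lambda>_. D))
     \<le> (\<Prod>i<n. ennreal (exp (- (lam * \<kappa> i) * (t\<^sup>2 - \<sigma>\<^sup>2)))) * (\<integral>\<^sup>+x. ?q x \<partial>PiM {..<n} (\<lambda>_. gauss t))"
  proof (rule nn_integral_PiM_le_replace)
    show "sigma_finite_measure D" ..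
    show "sigma_finite_measure (gauss t)" using tpos by (rule gauss_sigma_finite)
    show "?q \<in> borel_measurable (PiM {..<n} (\<lambda>_. borel))"
      unfolding inner_n_def by measurable
    fix i x assume "i \<in> {..<n}"
    then have i: "i < n" by simp
    define r where "r l = inner_n n (q l) (x(i := 0))" for l
    define b where "b = 2 * lam * (\<Sum>l\<in>L. q l i * r l)"
    define w where "w = exp (lam * (\<Sum>l\<in>L. (r l)\<^sup>2))"
    have q_eq: "?q (x(i := y)) = ennreal w * ennreal (exp ((lam * \<kappa> i) * y\<^sup>2 + b * y))" for y
    proof -
      have "(\<Sum>l\<in>L. (inner_n n (q l) (x(i := y)))\<^sup>2) = (\<Sum>l\<in>L. (q l i)\<^sup>2 * y\<^sup>2 + 2 * (q l i * r l) * y + (r l)\<^sup>2)"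
        by (simp add: inner_n_upd[OF i, of _ x y] r_def power2_sum power_mult_distrib mult_ac add_ac)
      also have "\<dots> = \<kappa> i * y\<^sup>2 + 2 * (\<Sum>l\<in>L. q l i * r l) * y + (\<Sum>l\<in>L. (r l)\<^sup>2)"
        by (simp add: sum.distrib \<kappa>_def sum_distrib_left sum_distrib_right)
      finally have "lam * (\<Sum>l\<in>L. (inner_n n (q l) (x(i := y)))\<^sup>2)
         = lam * (\<Sum>l\<in>L. (r l)\<^sup>2) + ((lam * \<kappa> i) * y\<^sup>2 + b * y)"
        by (simp add: b_def algebra_simps)
      then show ?thesis
        by (simp only: exp_add w_def ennreal_mult' exp_ge_zero)
    qed
    have "(\<integral>\<^sup>+y. ?q (x(i := y)) \<partial>D) = ennreal w * (\<integral>\<^sup>+y. ennreal (exp ((lam * \<kappa> i) * y\<^sup>2 + b * y)) \<partial>D)"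
      unfolding q_eq by (rule nn_integral_cmult) measurable
    also have "\<dots> \<le> ennreal w * (ennreal (exp (- (lam * \<kappa> i) * (t\<^sup>2 - \<sigma>\<^sup>2))) * (\<integral>\<^sup>+y. ennreal (exp ((lam * \<kappa> i) * y\<^sup>2 + b * y)) \<partial>gauss t))"
    proof (intro mult_left_mono nn_integral_noise_le_gauss[OF nd K _ _ t])
      show "0 \<le> lam * \<kappa> i" using lam \<kappa>0 by simp
      have "4 * (lam * \<kappa> i) * t\<^sup>2 = (4 * lam * t\<^sup>2) * \<kappa> i" by simp
      also have "\<dots> \<le> 1 * 1"
        using lam \<kappa>0 \<kappa>1[OF i] by (intro mult_mono) auto
      finally show "4 * (lam * \<kappa> i) * t\<^sup>2 \<le> 1" by simp
    qed simp
    also have "\<dots> = ennreal (exp (- (lam * \<kappa> i) * (t\<^sup>2 - \<sigma>\<^sup>2))) * (ennreal w * (\<integral>\<^sup>+y. ennreal (exp ((lam * \<kappa> i) * y\<^sup>2 + b * y)) \<partial>gauss t))"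
      by (simp only: mult_ac)
    also have "ennreal w * (\<integral>\<^sup>+y. ennreal (exp ((lam * \<kappa> i) * y\<^sup>2 + b * y)) \<partial>gauss t) = (\<integral>\<^sup>+y. ?q (x(i := y)) \<partial>gauss t)"
      unfolding q_eq by (rule nn_integral_cmult[symmetric]) measurable
    finally show "(\<integral>\<^sup>+y. ?q (x(i := y)) \<partial>D) \<le> ennreal (exp (- (lam * \<kappa> i) * (t\<^sup>2 - \<sigma>\<^sup>2))) * (\<integral>\<^sup>+y. ?q (x(i := y)) \<partial>gauss t)" .
  qed (use noise_distD[OF nd] in auto)
  also have "(\<Prod>i<n. ennreal (exp (- (lam * \<kappa> i) * (t\<^sup>2 - \<sigma>\<^sup>2)))) = ennreal (exp (- lam * card L * (t\<^sup>2 - \<sigma>\<^sup>2)))"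
  proof -
    have "(\<Sum>i<n. - (lam * \<kappa> i) * (t\<^sup>2 - \<sigma>\<^sup>2)) = - lam * (\<Sum>i<n. \<kappa> i) * (t\<^sup>2 - \<sigma>\<^sup>2)"
      by (simp only: sum_distrib_left sum_distrib_right mult_minus_left)
    then show ?thesis
      unfolding \<kappa>sum by (simp only: prod_ennreal exp_ge_zero exp_sum[symmetric] finite_lessThan)
  qed
  also have "(\<integral>\<^sup>+x. ?q x \<partial>PiM {..<n} (\<lambda>_. gauss t)) = ennreal ((1 / sqrt (1 - 2 * lam * t\<^sup>2)) ^ card L)"
    using lam by (intro nn_integral_gauss_quadratic_form[OF on L tpos]) auto
  finally show ?thesis
    by (simp only: noise_space_def ennreal_mult'[symmetric] exp_ge_zero)
qed

text \<open>With \<open>u = lam t\<^sup>2 = 1 / (4 sqrt k)\<close> the bound above is at most \<open>exp (4 k u\<^sup>2)\<close>.\<close>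
lemma noise_chi_square_deviation:
  assumes nd: "noise_dist D \<sigma> K" and K: "0 < K" and on: "orthonormal_on n L q" and L: "finite L" "L \<noteq> {}"
  shows "(\<integral>\<^sup>+x. ennreal (exp ((\<Sum>l\<in>L. (inner_n n (q l) x)\<^sup>2 - \<sigma>\<^sup>2) / (64 * K\<^sup>2 * \<sigma>\<^sup>2 * sqrt (card L)))) \<partial>noise_space n D) \<le> 2"
proof -
  define t where "t = 4 * K * \<sigma>"
  define k where "k = real (card L)"
  have k: "1 \<le> k" using L by (simp add: k_def Suc_le_eq card_gt_0_iff)
  have s: "0 < \<sigma>" using noise_distD[OF nd] by simp
  have t: "0 < t" "64 * K\<^sup>2 * \<sigma>\<^sup>2 = 4 * t\<^sup>2" using K s by (auto simp: t_def power_mult_distrib)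
  define lam where "lam = 1 / (4 * t\<^sup>2 * sqrt k)"
  define u where "u = lam * t\<^sup>2"
  have sk: "1 \<le> sqrt k" using k by simp
  have u: "u = 1 / (4 * sqrt k)" using t by (simp add: u_def lam_def)
  have u4: "0 \<le> u" "4 * u \<le> 1" using sk by (auto simp: u divide_le_eq)
  have uk: "4 * k * u\<^sup>2 = 1 / 4" using k by (simp add: u power_divide power_mult_distrib)
  have lam: "0 \<le> lam" "4 * lam * t\<^sup>2 \<le> 1"
    using u4 sk by (auto simp: u_def lam_def)
  have split: "ennreal (exp ((\<Sum>l\<in>L. (inner_n n (q l) x)\<^sup>2 - \<sigma>\<^sup>2) / (64 * K\<^sup>2 * \<sigma>\<^sup>2 * sqrt (card L))))
     = ennreal (exp (- lam * k * \<sigma>\<^sup>2)) * ennreal (exp (lam * (\<Sum>l\<in>L. (inner_n n (q l) x)\<^sup>2)))" for x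
  proof -
    have "(\<Sum>l\<in>L. (inner_n n (q l) x)\<^sup>2 - \<sigma>\<^sup>2) / (64 * K\<^sup>2 * \<sigma>\<^sup>2 * sqrt (card L))
       = lam * (\<Sum>l\<in>L. (inner_n n (q l) x)\<^sup>2 - \<sigma>\<^sup>2)"
      by (simp only: t(2) lam_def k_def) simp
    also have "\<dots> = - lam * k * \<sigma>\<^sup>2 + lam * (\<Sum>l\<in>L. (inner_n n (q l) x)\<^sup>2)"
      by (simp add: sum_subtractf k_def algebra_simps)
    finally show ?thesis
      by (simp only: exp_add ennreal_mult' exp_ge_zero)
  qed
  have [measurable_cong]: "sets D = sets borel" using noise_distD[OF nd] by simp
  have "(\<integral>\<^sup>+x. ennreal (exp ((\<Sum>l\<in>L. (inner_n n (q l) x)\<^sup>2 - \<sigma>\<^sup>2) / (64 * K\<^sup>2 * \<sigma>\<^sup>2 * sqrt (card L)))) \<partial>noise_space n D)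
     = ennreal (exp (- lam * k * \<sigma>\<^sup>2)) * (\<integral>\<^sup>+x. ennreal (exp (lam * (\<Sum>l\<in>L. (inner_n n (q l) x)\<^sup>2))) \<partial>noise_space n D)"
    unfolding split by (rule nn_integral_cmult) (unfold inner_n_def noise_space_def, measurable)
  also have "\<dots> \<le> ennreal (exp (- lam * k * \<sigma>\<^sup>2)) * ennreal (exp (- lam * k * (t\<^sup>2 - \<sigma>\<^sup>2)) * (1 / sqrt (1 - 2 * lam * t\<^sup>2)) ^ card L)"
    unfolding k_def by (intro mult_left_mono nn_integral_noise_quadratic_form[OF nd K on L(1) t_def lam]) simp
  also have "\<dots> = ennreal (exp (- lam * k * \<sigma>\<^sup>2) * (exp (- lam * k * (t\<^sup>2 - \<sigma>\<^sup>2)) * (1 / sqrt (1 - 2 * lam * t\<^sup>2)) ^ card L))"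
    by (rule ennreal_mult'[symmetric]) simp
  also have "\<dots> \<le> ennreal 2"
  proof (rule ennreal_leI)
    \<comment> \<open>Here a lower bound on \<open>1 - 2 * u\<close> is needed:
      \<open>ln (1 - x) \<ge> - x - 2 * x^2\<close> at \<open>x = 2 * u\<close>, then halved by the
      square root.\<close>
    have "exp (- u - 4 * u\<^sup>2) ^ 2 = exp (- (2 * u) - 2 * (2 * u)\<^sup>2)"
      by (simp add: exp_double[symmetric] power_mult_distrib)
    also have "\<dots> \<le> exp (ln (1 - 2 * u))"
      unfolding exp_le_cancel_iff using u4 by (intro ln_one_minus_pos_lower_bound) auto
    also have "\<dots> = 1 - 2 * u"
      using u4 by simp
    finally have "exp (- u - 4 * u\<^sup>2) \<le> sqrt (1 - 2 * u)"
      by (rule real_le_rsqrt)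
    then have "1 / sqrt (1 - 2 * u) \<le> 1 / exp (- u - 4 * u\<^sup>2)"
      using u4 by (intro divide_left_mono) auto
    also have "\<dots> = exp (u + 4 * u\<^sup>2)"
      by (simp add: exp_minus[symmetric] divide_inverse)
    finally have "(1 / sqrt (1 - 2 * u)) ^ card L \<le> exp (u + 4 * u\<^sup>2) ^ card L"
      using u4 by (intro power_mono) auto
    also have "\<dots> = exp (k * (u + 4 * u\<^sup>2))"
      by (simp add: exp_of_nat_mult k_def)
    finally have "exp (- lam * k * \<sigma>\<^sup>2) * (exp (- lam * k * (t\<^sup>2 - \<sigma>\<^sup>2)) * (1 / sqrt (1 - 2 * u)) ^ card L)
       \<le> exp (- lam * k * \<sigma>\<^sup>2) * (exp (- lam * k * (t\<^sup>2 - \<sigma>\<^sup>2)) * exp (k * (u + 4 * u\<^sup>2)))"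
      by (intro mult_left_mono) auto
    \<comment> \<open>All first-order terms cancel: \<open>lam * k * \<sigma>^2\<close> and
      \<open>lam * k * (t^2 - \<sigma>^2)\<close> together make \<open>k * u\<close>. What is left
      is \<open>exp (1 / 4)\<close>.\<close>
    also have "\<dots> = exp (4 * k * u\<^sup>2)"
      by (simp add: exp_add[symmetric] u_def algebra_simps)
    also have "\<dots> \<le> 2"
      using exp_bound[of "1 / 4"] unfolding uk by (simp add: power2_eq_square)
    finally show "exp (- lam * k * \<sigma>\<^sup>2) * (exp (- lam * k * (t\<^sup>2 - \<sigma>\<^sup>2)) * (1 / sqrt (1 - 2 * lam * t\<^sup>2)) ^ card L) \<le> 2"
      by (simp add: u_def mult.assoc)
  qed
  finally show ?thesis by simp
qed

lemma noise_linear_deviation: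
  assumes nd: "noise_dist D \<sigma> K" and K: "0 < K" and v: "(\<Sum>i<n. (v i)\<^sup>2) = 1"
  shows "(\<integral>\<^sup>+x. ennreal (exp (inner_n n v x / (K * \<sigma>))) \<partial>noise_space n D) \<le> 2"
proof -
  interpret D: prob_space D using noise_distD[OF nd] by simp
  interpret P: product_sigma_finite "\<lambda>_::nat. D" by unfold_locales
  have [measurable_cong]: "sets D = sets borel" using noise_distD[OF nd] by simp
  have s: "0 < \<sigma>" using noise_distD[OF nd] by simp
  have "(\<integral>\<^sup>+x. ennreal (exp (inner_n n v x / (K * \<sigma>))) \<partial>noise_space n D)
     = (\<integral>\<^sup>+x. (\<Prod>i<n. ennreal (exp (v i / (K * \<sigma>) * x i))) \<partial>noise_space n D)"
    by (simp add: inner_n_def sum_divide_distrib exp_sum prod_ennreal)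
  also have "\<dots> = (\<Prod>i<n. (\<integral>\<^sup>+x. ennreal (exp (v i / (K * \<sigma>) * x)) \<partial>D))"
    unfolding noise_space_def by (rule P.product_nn_integral_prod) auto
  also have "\<dots> \<le> (\<Prod>i<n. ennreal (exp ((v i)\<^sup>2 / 2)))"
  proof (rule prod_mono_ennreal)
    fix i
    have "(v i / (K * \<sigma>))\<^sup>2 * K\<^sup>2 * \<sigma>\<^sup>2 / 2 = (v i)\<^sup>2 / 2"
      using K s by (simp add: power_divide power_mult_distrib)
    then show "(\<integral>\<^sup>+x. ennreal (exp (v i / (K * \<sigma>) * x)) \<partial>D) \<le> ennreal (exp ((v i)\<^sup>2 / 2))"
      using nn_integral_noise_exp[OF nd, of "v i / (K * \<sigma>)"] by simp
  qed
  also have "\<dots> = ennreal (exp (1 / 2))"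
    using v by (simp add: prod_ennreal exp_sum[symmetric] sum_divide_distrib[symmetric])
  also have "\<dots> \<le> ennreal 2"
    using exp_bound[of "1 / 2"] by (intro ennreal_leI) (simp add: power2_eq_square)
  finally show ?thesis by simp
qed

section \<open>Moments\<close>

lemma integrable_mult_of_squares:
  fixes U W :: "'a \<Rightarrow> real"
  assumes [measurable]: "U \<in> borel_measurable M" "W \<in> borel_measurable M"
    and int: "integrable M (\<lambda>x. (U x)\<^sup>2)" "integrable M (\<lambda>x. (W x)\<^sup>2)"
  shows "integrable M (\<lambda>x. U x * W x)"
proof (rule Bochner_Integration.integrable_bound[OF Bochner_Integration.integrable_add[OF int]])
  have "\<bar>U x * W x\<bar> \<le> (U x)\<^sup>2 + (W x)\<^sup>2" for x
    using sum_squares_bound[of "\<bar>U x\<bar>" "\<bar>W x\<bar>"] by (simp add: abs_mult)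
      (metis add.commute add_increasing2 mult_2 mult.assoc order_trans zero_le_mult_iff abs_ge_zero le_add_same_cancel1)
  then show "AE x in M. norm (U x * W x) \<le> norm ((U x)\<^sup>2 + (W x)\<^sup>2)" by simp
qed measurable

lemma integral_Cauchy_Schwarz:
  fixes U W :: "'a \<Rightarrow> real"
  assumes meas: "U \<in> borel_measurable M" "W \<in> borel_measurable M"
    and int: "integrable M (\<lambda>x. (U x)\<^sup>2)" "integrable M (\<lambda>x. (W x)\<^sup>2)"
  shows "(\<integral>x. U x * W x \<partial>M) \<le> sqrt (\<integral>x. (U x)\<^sup>2 \<partial>M) * sqrt (\<integral>x. (W x)\<^sup>2 \<partial>M)"
proof -
  define p where "p = (\<integral>x. (U x)\<^sup>2 \<partial>M)"
  define q where "q = (\<integral>x. (W x)\<^sup>2 \<partial>M)"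
  define r where "r = (\<integral>x. U x * W x \<partial>M)"
  have p: "0 \<le> p" and q: "0 \<le> q" by (auto simp: p_def q_def)
  have quad: "0 \<le> c\<^sup>2 * p - 2 * c * r + q" for c
  proof -
    have "0 \<le> (\<integral>x. (c * U x - W x)\<^sup>2 \<partial>M)" by simp
    also have "\<dots> = (\<integral>x. c\<^sup>2 * (U x)\<^sup>2 - 2 * c * (U x * W x) + (W x)\<^sup>2 \<partial>M)"
      by (rule Bochner_Integration.integral_cong) (simp_all add: power2_eq_square algebra_simps)
    also have "\<dots> = c\<^sup>2 * p - 2 * c * r + q"
      using int integrable_mult_of_squares[OF meas int] by (simp add: p_def q_def r_def)
    finally show ?thesis .
  qed
  have "r\<^sup>2 \<le> p * q"
  proof (cases "p = 0")
    case True
    have "r = 0"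
    proof (rule ccontr)
      assume "r \<noteq> 0"
      \<comment> \<open>At this \<open>c\<close> the form, linear because \<open>p = 0\<close>,
        takes the value -1.\<close>
      then show False using quad[of "(q + 1) / (2 * r)"] True by simp
    qed
    then show ?thesis using True by simp
  next
    case False
    then have "p > 0" using p by simp
    have "0 \<le> (r / p)\<^sup>2 * p - 2 * (r / p) * r + q" by (rule quad)
    also have "\<dots> = q - r\<^sup>2 / p" using \<open>p > 0\<close> by (simp add: power2_eq_square field_simps)
    finally show ?thesis using \<open>p > 0\<close> by (simp add: field_simps)
  qed
  then show ?thesis
    unfolding p_def[symmetric] q_def[symmetric] r_def[symmetric] real_sqrt_mult[symmetric]
    by (rule real_le_rsqrt)
qed

text \<open>A substitute for Jensen's inequality, as the squared logarithm is not concave near 1.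
  With \<open>b\<close> a bound for the mean of \<open>S\<close>, the linear term contributes only a
  constant in expectation.\<close>

lemma ln_square_le_linear:
  fixes S b :: real
  assumes "1 \<le> S" "1 \<le> b"
  shows "(ln S)\<^sup>2 \<le> 2 * (ln b)\<^sup>2 + 8 * (S / b)"
proof (cases "S \<le> b")
  case True
  then have "(ln S)\<^sup>2 \<le> (ln b)\<^sup>2" using assms by (intro power_mono) auto
  moreover have "0 \<le> 8 * (S / b)" "0 \<le> (ln b)\<^sup>2" using assms by auto
  ultimately show ?thesis by linarith
next
  case False
  define u where "u = S / b"
  have u: "1 < u" using False assms by (simp add: u_def)
  have "ln (sqrt u) \<le> sqrt u - 1" using u by (intro ln_le_minus_one) simp
  then have "ln u \<le> 2 * sqrt u" using u by (simp add: ln_sqrt)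
  then have "(ln u)\<^sup>2 \<le> (2 * sqrt u)\<^sup>2" using u by (intro power_mono) auto
  then have lu: "(ln u)\<^sup>2 \<le> 4 * u" using u by (simp add: power_mult_distrib)
  have "ln S = ln b + ln u" using assms u by (simp add: u_def ln_div)
  then have "(ln S)\<^sup>2 \<le> 2 * (ln b)\<^sup>2 + 2 * (ln u)\<^sup>2"
    using sum_squares_bound[of "ln b" "ln u"] by (simp add: power2_sum)
  then show ?thesis using lu by (simp add: u_def)
qed

text \<open>A smooth upper bound for the maximum of the \<open>Y j\<close>, cheap because only exponential
  moments of the single \<open>Y j\<close> enter.\<close>
definition soft_max :: "'j set \<Rightarrow> ('j \<Rightarrow> 'a \<Rightarrow> real) \<Rightarrow> 'a \<Rightarrow> real" where
  "soft_max J Y x = ln (1 + (\<Sum>j\<in>J. exp (Y j x)))"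

lemma soft_max_nonneg: "0 \<le> soft_max J Y x"
  by (simp add: soft_max_def sum_nonneg)

lemma le_soft_max:
  assumes "finite J" "j \<in> J"
  shows "Y j x \<le> soft_max J Y x"
proof -
  have "exp (Y j x) \<le> (\<Sum>j\<in>J. exp (Y j x))"
    using assms by (intro member_le_sum) auto
  then have "exp (Y j x) \<le> 1 + (\<Sum>j\<in>J. exp (Y j x))" by simp
  then show ?thesis
    unfolding soft_max_def by (subst ln_ge_iff) (auto intro!: add_pos_nonneg sum_nonneg)
qed

lemma
  assumes P: "prob_space P" and J: "finite J" "J \<noteq> {}"
    and meas: "\<And>j. j \<in> J \<Longrightarrow> Y j \<in> borel_measurable P"
    and Y: "\<And>j. j \<in> J \<Longrightarrow> (\<integral>\<^sup>+x. ennreal (exp (Y j x)) \<partial>P) \<le> 2"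
  shows soft_max_measurable: "soft_max J Y \<in> borel_measurable P"
    and soft_max_square_integrable: "integrable P (\<lambda>x. (soft_max J Y x)\<^sup>2)"
    and soft_max_second_moment: "(\<integral>x. (soft_max J Y x)\<^sup>2 \<partial>P) \<le> 16 * (1 + ln (card J))\<^sup>2"
proof -
  interpret prob_space P by fact
  note meas[measurable]
  show m[measurable]: "soft_max J Y \<in> borel_measurable P"
    unfolding soft_max_def[abs_def] by measurable
  have int: "integrable P (\<lambda>x. exp (Y j x))" and le: "(\<integral>x. exp (Y j x) \<partial>P) \<le> 2" if "j \<in> J" for j
  proof -
    have "(\<integral>\<^sup>+x. ennreal (exp (Y j x)) \<partial>P) < \<infinity>"
      using Y[OF that] by (rule le_less_trans) simp
    then show *: "integrable P (\<lambda>x. exp (Y j x))"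
      using that by (intro integrableI_nonneg) auto
    have "ennreal (\<integral>x. exp (Y j x) \<partial>P) \<le> ennreal 2"
      using Y[OF that] nn_integral_eq_integral[OF *] by simp
    then show "(\<integral>x. exp (Y j x) \<partial>P) \<le> 2"
      by (subst (asm) ennreal_le_iff) auto
  qed
  define m where "m = real (card J)"
  have m1: "1 \<le> m" using J by (simp add: m_def Suc_le_eq card_gt_0_iff)
  define S where "S x = 1 + (\<Sum>j\<in>J. exp (Y j x))" for x
  have S1: "1 \<le> S x" for x by (simp add: S_def sum_nonneg)
  have intS: "integrable P S"
    unfolding S_def[abs_def] using int by auto
  have "(\<integral>x. S x \<partial>P) = 1 + (\<Sum>j\<in>J. (\<integral>x. exp (Y j x) \<partial>P))"
    unfolding S_def using int by (simp add: prob_space)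
  also have "\<dots> \<le> 1 + (\<Sum>j\<in>J. 2)"
    using le by (intro add_mono sum_mono) auto
  finally have ES: "(\<integral>x. S x \<partial>P) \<le> 3 * m" using m1 by (simp add: m_def)
  have pw: "(soft_max J Y x)\<^sup>2 \<le> 2 * (ln (3 * m))\<^sup>2 + 8 * (S x / (3 * m))" for x
    using ln_square_le_linear[OF S1[of x], of "3 * m"] m1 by (simp add: soft_max_def S_def)
  have intb: "integrable P (\<lambda>x. 2 * (ln (3 * m))\<^sup>2 + 8 * (S x / (3 * m)))"
    using intS by simp
  show i: "integrable P (\<lambda>x. (soft_max J Y x)\<^sup>2)"
  proof (rule Bochner_Integration.integrable_bound[OF intb])
    show "AE x in P. norm ((soft_max J Y x)\<^sup>2) \<le> norm (2 * (ln (3 * m))\<^sup>2 + 8 * (S x / (3 * m)))"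
      using pw by (auto intro: order_trans[OF _ abs_ge_self])
  qed measurable
  have "(\<integral>x. (soft_max J Y x)\<^sup>2 \<partial>P) \<le> (\<integral>x. 2 * (ln (3 * m))\<^sup>2 + 8 * (S x / (3 * m)) \<partial>P)"
    by (rule integral_mono[OF i intb pw])
  also have "\<dots> = 2 * (ln (3 * m))\<^sup>2 + 8 * ((\<integral>x. S x \<partial>P) / (3 * m))"
    using intS by (simp add: prob_space)
  \<comment> \<open>The factor 16 is \<open>2 * 2^2 + 8\<close>.\<close>
  also have "\<dots> \<le> 2 * (2 * (1 + ln m))\<^sup>2 + 8 * (1 + ln m)\<^sup>2"
  proof (intro add_mono mult_left_mono power_mono)
    have "ln (3 * m) = ln 3 + ln m" using m1 by (simp add: ln_mult)
    also have "\<dots> \<le> 2 + ln m" using ln_le_minus_one[of "3::real"] by simp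
    also have "\<dots> \<le> 2 * (1 + ln m)" using m1 by simp
    finally show "ln (3 * m) \<le> 2 * (1 + ln m)" .
    have "(\<integral>x. S x \<partial>P) / (3 * m) \<le> 1" using ES m1 by simp
    also have "\<dots> \<le> (1 + ln m)\<^sup>2" using m1 by (intro one_le_power) simp
    finally show "(\<integral>x. S x \<partial>P) / (3 * m) \<le> (1 + ln m)\<^sup>2" .
  qed (use m1 in auto)
  also have "\<dots> = 16 * (1 + ln (card J))\<^sup>2" unfolding m_def by (simp only: power_mult_distrib) simp
  finally show "(\<integral>x. (soft_max J Y x)\<^sup>2 \<partial>P) \<le> 16 * (1 + ln (card J))\<^sup>2" .
qed

section \<open>First and second moments of linear forms in the noise\<close>

lemma noise_space_prob: "noise_dist D \<sigma> K \<Longrightarrow> prob_space (noise_space n D)"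
  unfolding noise_space_def using noise_distD(1) by (intro prob_space_PiM) blast

lemma inner_n_measurable_noise:
  assumes "noise_dist D \<sigma> K"
  shows "inner_n n v \<in> borel_measurable (noise_space n D)"
proof -
  have [measurable_cong]: "sets D = sets borel" using noise_distD[OF assms] by simp
  show ?thesis unfolding inner_n_def[abs_def] noise_space_def by measurable
qed

text \<open>A coordinate is written as a product over all coordinates with factors 1 elsewhere, so
  that integrals of products over the product measure apply. The covariances below are obtained in
  the same way.\<close>

lemma
  assumes nd: "noise_dist D \<sigma> K" and i: "i < n"
  shows noise_coord_integrable: "integrable (noise_space n D) (\<lambda>x. x i)"
    and noise_coord_mean: "(\<integral>x. x i \<partial>noise_space n D) = 0"
proof -
  interpret D: prob_space D using noise_distD[OF nd] by simp
  interpret P: product_sigma_finite "\<lambda>_::nat. D" by unfold_locales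
  let ?f = "\<lambda>l y::real. if l = i then y else 1"
  have int: "integrable D (?f l)" for l using noise_distD[OF nd] by (cases "l = i") auto
  have eq: "x i = (\<Prod>l<n. ?f l (x l))" for x :: "nat \<Rightarrow> real"
    using i by (simp add: prod.delta)
  show "integrable (noise_space n D) (\<lambda>x. x i)"
    unfolding eq noise_space_def by (rule P.product_integrable_prod) (use int in auto)
  have "(\<integral>x. x i \<partial>noise_space n D) = (\<Prod>l<n. (\<integral>y. ?f l y \<partial>D))"
    unfolding eq noise_space_def by (rule P.product_integral_prod) (use int in auto)
  also have "\<dots> = 0"
    using i noise_distD[OF nd] by (intro prod_zero) (auto intro!: bexI[of _ i])
  finally show "(\<integral>x. x i \<partial>noise_space n D) = 0" .
qed

lemma
  assumes nd: "noise_dist D \<sigma> K" and i: "i < n" "j < n"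
  shows noise_coord_prod_integrable: "integrable (noise_space n D) (\<lambda>x. x i * x j)"
    and noise_coord_covariance: "(\<integral>x. x i * x j \<partial>noise_space n D) = (if i = j then \<sigma>\<^sup>2 else 0)"
proof -
  interpret D: prob_space D using noise_distD[OF nd] by simp
  interpret P: product_sigma_finite "\<lambda>_::nat. D" by unfold_locales
  let ?f = "\<lambda>l y::real. (if l = i then y else 1) * (if l = j then y else 1)"
  have int: "integrable D (?f l)" for l
    using noise_distD[OF nd] by (cases "l = i"; cases "l = j") (auto simp: power2_eq_square[symmetric])
  have eq: "x i * x j = (\<Prod>l<n. ?f l (x l))" for x :: "nat \<Rightarrow> real"
    using i by (simp add: prod.distrib prod.delta)
  show "integrable (noise_space n D) (\<lambda>x. x i * x j)"
    unfolding eq noise_space_def by (rule P.product_integrable_prod) (use int in auto)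
  have "(\<integral>x. x i * x j \<partial>noise_space n D) = (\<Prod>l<n. (\<integral>y. ?f l y \<partial>D))"
    unfolding eq noise_space_def by (rule P.product_integral_prod) (use int in auto)
  also have "\<dots> = (if i = j then \<sigma>\<^sup>2 else 0)"
  proof (cases "i = j")
    case True
    have "(\<integral>y. ?f l y \<partial>D) = (if l = i then \<sigma>\<^sup>2 else 1)" for l
      using True noise_distD[OF nd] by (simp add: power2_eq_square[symmetric] D.prob_space)
    then show ?thesis using True i by (simp add: prod.delta)
  next
    case False
    then have z: "(\<integral>y. ?f i y \<partial>D) = 0"
      using noise_distD[OF nd] by simp
    have "(\<Prod>l<n. (\<integral>y. ?f l y \<partial>D)) = 0"
    proof (rule prod_zero[OF finite_lessThan])
      show "\<exists>l\<in>{..<n}. (\<integral>y. ?f l y \<partial>D) = 0"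
        by (rule bexI[where x = i]) (fact z, use i in simp)
    qed
    then show ?thesis using False by simp
  qed
  finally show "(\<integral>x. x i * x j \<partial>noise_space n D) = (if i = j then \<sigma>\<^sup>2 else 0)" .
qed

lemma
  assumes nd: "noise_dist D \<sigma> K"
  shows noise_inner_integrable: "integrable (noise_space n D) (\<lambda>x. inner_n n v x)"
    and noise_inner_mean: "(\<integral>x. inner_n n v x \<partial>noise_space n D) = 0"
    and noise_inner_square_integrable: "integrable (noise_space n D) (\<lambda>x. (inner_n n v x)\<^sup>2)"
    and noise_inner_variance: "(\<integral>x. (inner_n n v x)\<^sup>2 \<partial>noise_space n D) = \<sigma>\<^sup>2 * inner_n n v v"
proof -
  show "integrable (noise_space n D) (\<lambda>x. inner_n n v x)" "(\<integral>x. inner_n n v x \<partial>noise_space n D) = 0"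
    unfolding inner_n_def using noise_coord_integrable[OF nd] noise_coord_mean[OF nd] by auto
  have sq: "(inner_n n v x)\<^sup>2 = (\<Sum>i<n. \<Sum>j<n. (v i * v j) * (x i * x j))" for x
    by (simp add: inner_n_def power2_eq_square sum_product mult_ac)
  show "integrable (noise_space n D) (\<lambda>x. (inner_n n v x)\<^sup>2)"
    unfolding sq by (intro Bochner_Integration.integrable_sum integrable_mult_right noise_coord_prod_integrable[OF nd]) auto
  have "(\<integral>x. (inner_n n v x)\<^sup>2 \<partial>noise_space n D) = (\<Sum>i<n. \<Sum>j<n. (v i * v j) * (if i = j then \<sigma>\<^sup>2 else 0))"
    unfolding sq
  proof (subst Bochner_Integration.integral_sum)
    fix i assume "i \<in> {..<n}"
    then show "integrable (noise_space n D) (\<lambda>x. \<Sum>j<n. (v i * v j) * (x i * x j))"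
      by (intro Bochner_Integration.integrable_sum integrable_mult_right noise_coord_prod_integrable[OF nd]) auto
  next
    show "(\<Sum>i<n. \<integral>x. (\<Sum>j<n. (v i * v j) * (x i * x j)) \<partial>noise_space n D)
      = (\<Sum>i<n. \<Sum>j<n. (v i * v j) * (if i = j then \<sigma>\<^sup>2 else 0))"
    proof (rule sum.cong[OF refl])
      fix i assume i: "i \<in> {..<n}"
      have "(\<integral>x. (\<Sum>j<n. (v i * v j) * (x i * x j)) \<partial>noise_space n D)
          = (\<Sum>j<n. \<integral>x. (v i * v j) * (x i * x j) \<partial>noise_space n D)"
        using i by (intro Bochner_Integration.integral_sum integrable_mult_right noise_coord_prod_integrable[OF nd]) auto
      also have "\<dots> = (\<Sum>j<n. (v i * v j) * (if i = j then \<sigma>\<^sup>2 else 0))"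
      proof (rule sum.cong[OF refl])
        fix j assume "j \<in> {..<n}"
        then show "(\<integral>x. (v i * v j) * (x i * x j) \<partial>noise_space n D) = (v i * v j) * (if i = j then \<sigma>\<^sup>2 else 0)"
          using i noise_coord_covariance[OF nd, of i n j]
          by (subst integral_mult_right_zero) simp
      qed
      finally show "(\<integral>x. (\<Sum>j<n. (v i * v j) * (x i * x j)) \<partial>noise_space n D)
          = (\<Sum>j<n. (v i * v j) * (if i = j then \<sigma>\<^sup>2 else 0))" .
    qed
  qed
  also have "\<dots> = \<sigma>\<^sup>2 * inner_n n v v"
    by (simp add: inner_n_def sum_distrib_left if_distrib[of "\<lambda>x. _ * x"] mult_ac cong: if_cong)
  finally show "(\<integral>x. (inner_n n v x)\<^sup>2 \<partial>noise_space n D) = \<sigma>\<^sup>2 * inner_n n v v" .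
qed

text \<open>Solves \<open>x \<le> R + B sqrt x + 2 sqrt (A R)\<close> for \<open>x\<close> and inserts the result in its right-hand side.\<close>
lemma quadratic_selfbound:
  fixes x R A b1 :: real
  assumes x: "0 \<le> x" "x \<le> R + (b1 + sqrt 8 * sqrt A) * sqrt x + 2 * sqrt A * sqrt R"
    and nn: "0 \<le> R" "0 \<le> A" "0 \<le> b1"
  shows "R + (b1 + sqrt 8 * sqrt A) * sqrt x + 2 * sqrt A * sqrt R
    \<le> R + 3 * b1\<^sup>2 + 25 * A + b1 * sqrt R + 5 * (sqrt A * sqrt R)"
proof -
  define B where "B = b1 + sqrt 8 * sqrt A"
  define sx where "sx = sqrt x"
  define sR where "sR = sqrt R"
  define sA where "sA = sqrt A"
  have B0: "0 \<le> B" using nn by (simp add: B_def)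
  have sq: "sx\<^sup>2 = x" "sR\<^sup>2 = R" "sA\<^sup>2 = A" and pos: "0 \<le> sx" "0 \<le> sR" "0 \<le> sA"
    using x nn by (auto simp: sx_def sR_def sA_def)
  have main: "sx\<^sup>2 \<le> sR\<^sup>2 + B * sx + 2 * sA * sR"
    using x(2) unfolding sq unfolding B_def sx_def sR_def sA_def by simp
  \<comment> \<open>Otherwise \<open>(sx - B) * sx\<close> would exceed \<open>(sR + sA)^2\<close>,
    while \<open>main\<close> bounds it by \<open>sR^2 + 2 * sA * sR\<close>. The argument first
    compares without strictness, which forces \<open>sA = 0\<close>, and then strictly.\<close>
  have le: "sx \<le> B + sR + sA"
  proof (rule ccontr)
    assume "\<not> ?thesis"
    then have c: "sx > B + sR + sA" by simp
    then have "sx - B > sR + sA" "sx \<ge> sR + sA" using B0 by auto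
    then have "(sR + sA) * (sR + sA) \<le> (sx - B) * sx"
      using pos by (intro mult_mono) auto
    moreover have "(sx - B) * sx \<le> sR\<^sup>2 + 2 * sA * sR"
      using main by (simp add: power2_eq_square algebra_simps)
    ultimately have "sA\<^sup>2 \<le> 0" by (simp add: power2_eq_square algebra_simps)
    then have "sA = 0" by simp
    then have "(sx - B) * sx \<le> sR * sR" using \<open>(sx - B) * sx \<le> _\<close> by (simp add: power2_eq_square)
    moreover have "sR * sR < (sx - B) * sx"
      using \<open>sx - B > sR + sA\<close> \<open>sx \<ge> sR + sA\<close> \<open>sA = 0\<close> pos B0 by (intro mult_strict_mono') auto
    ultimately show False by simp
  qed
  have "B * sx \<le> B * (B + sR + sA)" using le B0 by (rule mult_left_mono)
  also have "\<dots> = B\<^sup>2 + B * sR + B * sA" by (simp add: power2_eq_square algebra_simps)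
  also have "B * sA \<le> (B\<^sup>2 + sA\<^sup>2) / 2"
    using sum_squares_bound[of B sA] by simp
  finally have Bsx: "B * sx \<le> 3 / 2 * B\<^sup>2 + B * sR + sA\<^sup>2 / 2" by (simp add: add_divide_distrib)
  have B2: "B\<^sup>2 \<le> 2 * b1\<^sup>2 + 16 * sA\<^sup>2"
    using sum_squares_bound[of b1 "sqrt 8 * sA"] by (simp add: B_def sA_def power2_sum power_mult_distrib)
  have "sqrt 8 \<le> sqrt (3\<^sup>2)" by (rule real_sqrt_le_mono) simp
  then have "sqrt 8 * (sA * sR) \<le> 3 * (sA * sR)" using pos by (intro mult_right_mono) auto
  then have "B * sR \<le> b1 * sR + 3 * (sA * sR)"
    by (simp add: B_def sA_def algebra_simps)
  \<comment> \<open>The constants: \<open>3 / 2 * 2 = 3\<close>, then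
    \<open>3 / 2 * 16 + 1 / 2 \<le> 25\<close>, and \<open>3 + 2 = 5\<close> with
    \<open>sqrt 8\<close> rounded up to 3.\<close>
  then have "sR\<^sup>2 + B * sx + 2 * sA * sR \<le> sR\<^sup>2 + 3 * b1\<^sup>2 + 25 * sA\<^sup>2 + b1 * sR + 5 * (sA * sR)"
    using Bsx B2 zero_le_power2[of sA] by linarith
  then show ?thesis
    unfolding sq unfolding B_def sx_def sR_def sA_def by simp
qed

section \<open>The expected loss and risk\<close>

lemma shrink_upd_0: "shrink M (k(0 := 0)) w = shrink M k w"
proof -
  have "{m\<in>{1..M}. l \<le> (k(0 := 0)) m} = {m\<in>{1..M}. l \<le> k m}" for l
    by auto
  then show ?thesis by (simp add: shrink_def fun_eq_iff)
qed

lemma sum_integrable_mean_zero: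
  fixes h :: "'j \<Rightarrow> 'a \<Rightarrow> real"
  assumes "\<And>j. j \<in> J \<Longrightarrow> integrable P (h j)" "\<And>j. j \<in> J \<Longrightarrow> (\<integral>x. h j x \<partial>P) = 0"
  shows "integrable P (\<lambda>x. \<Sum>j\<in>J. c j * h j x)" "(\<integral>x. (\<Sum>j\<in>J. c j * h j x) \<partial>P) = 0"
proof -
  show "integrable P (\<lambda>x. \<Sum>j\<in>J. c j * h j x)"
    using assms by (intro Bochner_Integration.integrable_sum integrable_mult_right) auto
  have "(\<integral>x. (\<Sum>j\<in>J. c j * h j x) \<partial>P) = (\<Sum>j\<in>J. (\<integral>x. c j * h j x \<partial>P))"
    using assms by (intro Bochner_Integration.integral_sum integrable_mult_right) auto
  also have "\<dots> = 0"
    using assms by (intro sum.neutral) simp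
  finally show "(\<integral>x. (\<Sum>j\<in>J. c j * h j x) \<partial>P) = 0" .
qed

lemma inner_n_obs: "inner_n n u (obs n f \<epsilon>) = inner_n n u f + inner_n n u \<epsilon>"
  by (simp add: inner_n_def obs_def distrib_left sum.distrib)

text \<open>Normalisation puts all deviations on one scale, so that a soft maximum over
  \<open>M\<close> variables covers each family. Tails are indexed by \<open>0..M-1\<close> and
  partial sums by \<open>1..M\<close>, since the last tail and the empty partial sum vanish.\<close>

lemma maximal_deviations:
  fixes k :: "nat \<Rightarrow> nat" and a :: "nat \<Rightarrow> real" and q :: "nat \<Rightarrow> nat \<Rightarrow> real"
  assumes K: "0 < K" and nd: "noise_dist D \<sigma> K" and M: "1 \<le> M"
    and k: "\<forall>m\<in>{1..M}. 0 < k m \<and> k m \<le> k M" and on: "orthonormal_on n {1..k M} q"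
  defines "e \<equiv> \<lambda>\<epsilon> l. inner_n n (q l) \<epsilon>"
  obtains Zb Zv where
    "Zb \<in> borel_measurable (noise_space n D)" "integrable (noise_space n D) (\<lambda>x. (Zb x)\<^sup>2)"
    "(\<integral>x. (Zb x)\<^sup>2 \<partial>noise_space n D) \<le> 16 * (1 + ln (real M))\<^sup>2" "\<And>\<epsilon>. 0 \<le> Zb \<epsilon>"
    "Zv \<in> borel_measurable (noise_space n D)" "integrable (noise_space n D) (\<lambda>x. (Zv x)\<^sup>2)"
    "(\<integral>x. (Zv x)\<^sup>2 \<partial>noise_space n D) \<le> 16 * (1 + ln (real M))\<^sup>2" "\<And>\<epsilon>. 0 \<le> Zv \<epsilon>"
    "\<And>m \<epsilon>. m < M \<Longrightarrow> - (\<Sum>l\<in>{k m<..k M}. a l * e \<epsilon> l) \<le> K * Zb \<epsilon> * \<sigma> * sqrt (\<Sum>l\<in>{k m<..k M}. (a l)\<^sup>2)"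
    "\<And>m \<epsilon>. m \<in> {1..M} \<Longrightarrow> (\<Sum>l=1..k m. (e \<epsilon> l)\<^sup>2 - \<sigma>\<^sup>2) \<le> 64 * K\<^sup>2 * Zv \<epsilon> * \<sigma>\<^sup>2 * sqrt (real (k m))"
proof -
  define P where "P = noise_space n D"
  interpret P: prob_space P unfolding P_def by (rule noise_space_prob[OF nd])
  have s: "0 < \<sigma>" using noise_distD[OF nd] by simp
  have em[measurable]: "(\<lambda>\<epsilon>. e \<epsilon> l) \<in> borel_measurable P" for l
    unfolding e_def P_def by (rule inner_n_measurable_noise[OF nd])
  have on': "orthonormal_on n L q" if "L \<subseteq> {1..k M}" for L
    using on that unfolding orthonormal_on_def by blast
  define S where "S m = (\<Sum>l\<in>{k m<..k M}. (a l)\<^sup>2)" for m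
  have S0: "0 \<le> S m" for m by (simp add: S_def sum_nonneg)
  \<comment> \<open>The unit vector in direction of the negated tail of the signal. If the tail is
    zero, division by zero makes it the zero vector, and both sides of the first deviation bound
    vanish.\<close>
  define v where "v m i = (\<Sum>l\<in>{k m<..k M}. (- a l / sqrt (S m)) * q l i)" for m i
  define Y1 where "Y1 m \<epsilon> = inner_n n (v m) \<epsilon> / (K * \<sigma>)" for m \<epsilon>
  define Y2 where "Y2 m \<epsilon> = (\<Sum>l\<in>{1..k m}. (e \<epsilon> l)\<^sup>2 - \<sigma>\<^sup>2) / (64 * K\<^sup>2 * \<sigma>\<^sup>2 * sqrt (real (k m)))" for m \<epsilon>
  have Y1m: "Y1 m \<in> borel_measurable P" for m
    unfolding Y1_def[abs_def] P_def using inner_n_measurable_noise[OF nd, of n "v m"] by measurable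
  have Y2m: "Y2 m \<in> borel_measurable P" for m
    unfolding Y2_def[abs_def] by measurable
  have Y1e: "(\<integral>\<^sup>+\<epsilon>. ennreal (exp (Y1 m \<epsilon>)) \<partial>P) \<le> 2" if "m \<in> {..<M}" for m
  proof (cases "S m = 0")
    case True
    then have "Y1 m \<epsilon> = 0" for \<epsilon> by (simp add: Y1_def v_def inner_n_def)
    then show ?thesis by (simp add: P.emeasure_space_1)
  next
    case False
    have "(\<Sum>i<n. (v m i)\<^sup>2) = (\<Sum>l\<in>{k m<..k M}. (- a l / sqrt (S m))\<^sup>2)"
      unfolding v_def by (rule norm_orthonormal_comb[OF on']) auto
    also have "\<dots> = S m / S m"
      using S0[of m] by (simp add: power_divide sum_divide_distrib[symmetric] S_def[symmetric])
    finally have "(\<Sum>i<n. (v m i)\<^sup>2) = 1" using False by simp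
    then show ?thesis unfolding Y1_def P_def by (rule noise_linear_deviation[OF nd K])
  qed
  have Y2e: "(\<integral>\<^sup>+\<epsilon>. ennreal (exp (Y2 m \<epsilon>)) \<partial>P) \<le> 2" if m: "m \<in> {1..M}" for m
  proof -
    have "k m \<le> k M" using k[rule_format, OF m] by simp
    then have "orthonormal_on n {1..k m} q" by (intro on') auto
    moreover have "{1..k m} \<noteq> {}" using k[rule_format, OF m] by auto
    ultimately show ?thesis
      using noise_chi_square_deviation[OF nd K, of n "{1..k m}" q]
      unfolding Y2_def e_def P_def by simp
  qed
  define Zb where "Zb = soft_max {..<M} Y1"
  define Zv where "Zv = soft_max {1..M} Y2"
  define Lg where "Lg = 1 + ln (real M)"
  have J: "{..<M} \<noteq> {}" "{1..M} \<noteq> {}" using M by (auto simp: lessThan_empty_iff)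
  have Zbm[measurable]: "Zb \<in> borel_measurable P" and Zbi: "integrable P (\<lambda>x. (Zb x)\<^sup>2)"
    unfolding Zb_def by (rule soft_max_measurable[OF P.prob_space_axioms finite_lessThan J(1)]
      soft_max_square_integrable[OF P.prob_space_axioms finite_lessThan J(1)]; rule Y1m Y1e; assumption?)+
  have Zvm[measurable]: "Zv \<in> borel_measurable P" and Zvi: "integrable P (\<lambda>x. (Zv x)\<^sup>2)"
    unfolding Zv_def by (rule soft_max_measurable[OF P.prob_space_axioms finite_atLeastAtMost J(2)]
      soft_max_square_integrable[OF P.prob_space_axioms finite_atLeastAtMost J(2)]; rule Y2m Y2e; assumption?)+
  have "(\<integral>x. (Zb x)\<^sup>2 \<partial>P) \<le> 16 * (1 + ln (real (card {..<M})))\<^sup>2"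
    unfolding Zb_def by (rule soft_max_second_moment[OF P.prob_space_axioms finite_lessThan J(1)]; rule Y1m Y1e; assumption?)
  then have Zb2: "(\<integral>x. (Zb x)\<^sup>2 \<partial>P) \<le> 16 * Lg\<^sup>2" by (simp add: Lg_def)
  have "(\<integral>x. (Zv x)\<^sup>2 \<partial>P) \<le> 16 * (1 + ln (real (card {1..M})))\<^sup>2"
    unfolding Zv_def by (rule soft_max_second_moment[OF P.prob_space_axioms finite_atLeastAtMost J(2)]; rule Y2m Y2e; assumption?)
  then have Zv2: "(\<integral>x. (Zv x)\<^sup>2 \<partial>P) \<le> 16 * Lg\<^sup>2" by (simp add: Lg_def)
  have Z0: "0 \<le> Zb \<epsilon>" "0 \<le> Zv \<epsilon>" for \<epsilon> by (simp_all add: Zb_def Zv_def soft_max_nonneg)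
  have T1: "- (\<Sum>l\<in>{k m<..k M}. a l * e \<epsilon> l) \<le> K * Zb \<epsilon> * \<sigma> * sqrt (S m)" if "m < M" for m \<epsilon>
  proof -
    have eq: "- (\<Sum>l\<in>{k m<..k M}. a l * e \<epsilon> l) = Y1 m \<epsilon> * (K * \<sigma> * sqrt (S m))"
    proof (cases "S m = 0")
      case True
      then have "a l = 0" if "l \<in> {k m<..k M}" for l
        using that by (simp add: S_def sum_nonneg_eq_0_iff)
      then show ?thesis using True by simp
    next
      case False
      have "Y1 m \<epsilon> = (\<Sum>l\<in>{k m<..k M}. (- a l / sqrt (S m)) * e \<epsilon> l) / (K * \<sigma>)"
        unfolding Y1_def v_def inner_n_sum_left e_def ..
      also have "\<dots> = - (\<Sum>l\<in>{k m<..k M}. a l * e \<epsilon> l) / sqrt (S m) / (K * \<sigma>)"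
        by (simp add: sum_divide_distrib[symmetric] sum_negf)
      finally show ?thesis using False K s by simp
    qed
    have "Y1 m \<epsilon> \<le> Zb \<epsilon>" unfolding Zb_def by (rule le_soft_max) (use that in auto)
    then have "Y1 m \<epsilon> * (K * \<sigma> * sqrt (S m)) \<le> Zb \<epsilon> * (K * \<sigma> * sqrt (S m))"
      using K s S0 by (intro mult_right_mono) auto
    then show ?thesis unfolding eq by (simp add: mult_ac)
  qed
  have T2: "(\<Sum>l=1..k m. (e \<epsilon> l)\<^sup>2 - \<sigma>\<^sup>2) \<le> 64 * K\<^sup>2 * Zv \<epsilon> * \<sigma>\<^sup>2 * sqrt (real (k m))" if m: "m \<in> {1..M}" for m \<epsilon>
  proof -
    have "Y2 m \<epsilon> \<le> Zv \<epsilon>" unfolding Zv_def by (rule le_soft_max) (use that in auto)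
    then have "Y2 m \<epsilon> * (64 * K\<^sup>2 * \<sigma>\<^sup>2 * sqrt (real (k m))) \<le> Zv \<epsilon> * (64 * K\<^sup>2 * \<sigma>\<^sup>2 * sqrt (real (k m)))"
      by (intro mult_right_mono) auto
    then show ?thesis
      using K s k[rule_format, OF m] by (simp add: Y2_def mult_ac)
  qed
  show thesis
    by (rule that[of Zb Zv]; (fact Z0 | fact T1[unfolded S_def] | fact T2 | use Zbm Zbi Zb2 Zvm Zvi Zv2 in \<open>simp add: P_def Lg_def\<close>))
qed

text \<open>After the mean-zero noise is gone, Cauchy--Schwarz bounds the mean of
  \<open>(Z + 2 * d) * sqrt r\<close> by a multiple of the root of the mean of \<open>r\<close>. The
  constant bound on \<open>r\<close> makes this mean finite, which has to be known before it is
  bounded by itself. The loss inherits integrability from its majorant.\<close>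

lemma (in prob_space) expected_selfbound:
  fixes r loss noise Z d :: "'a \<Rightarrow> real"
  assumes rm: "r \<in> borel_measurable M" and lm: "loss \<in> borel_measurable M"
    and Zm: "Z \<in> borel_measurable M" and dm: "d \<in> borel_measurable M"
    and r: "\<And>x. 0 \<le> r x" "\<And>x. r x \<le> r_max" and loss0: "\<And>x. 0 \<le> loss x"
    and noise: "integrable M noise" "(\<integral>x. noise x \<partial>M) = 0"
    and Z2: "integrable M (\<lambda>x. (Z x)\<^sup>2)" "2 * (\<integral>x. (Z x)\<^sup>2 \<partial>M) \<le> b\<^sup>2"
    and d2: "integrable M (\<lambda>x. (d x)\<^sup>2)" "(\<integral>x. (d x)\<^sup>2 \<partial>M) = A"
    and nn: "0 \<le> R" "0 \<le> b"
    and pathwise: "\<And>x. r x \<le> R + noise x + Z x * sqrt (r x) + 2 * d x * (sqrt R + sqrt (r x))"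
      "\<And>x. loss x \<le> R + noise x + Z x * sqrt (r x) + 2 * d x * (sqrt R + sqrt (r x))"
  defines "bound \<equiv> R + 3 * b\<^sup>2 + 25 * A + b * sqrt R + 5 * (sqrt A * sqrt R)"
  shows "(\<integral>x. r x \<partial>M) \<le> bound" "(\<integral>x. loss x \<partial>M) \<le> bound"
proof -
  note [measurable] = rm lm Zm dm
  have A0: "0 \<le> A" unfolding d2(2)[symmetric] by simp
  define U where "U x = Z x + 2 * d x" for x
  have Um[measurable]: "U \<in> borel_measurable M" unfolding U_def[abs_def] by measurable
  have U2: "(U x)\<^sup>2 \<le> 2 * (Z x)\<^sup>2 + 8 * (d x)\<^sup>2" for x
    using sum_squares_bound[of "Z x" "2 * d x"] by (simp add: U_def power2_sum power_mult_distrib)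
  have U2i: "integrable M (\<lambda>x. 2 * (Z x)\<^sup>2 + 8 * (d x)\<^sup>2)" using Z2(1) d2(1) by simp
  have Ui: "integrable M (\<lambda>x. (U x)\<^sup>2)"
    by (rule Bochner_Integration.integrable_bound[OF U2i]) (use U2 in \<open>auto intro: order_trans[OF _ abs_ge_self]\<close>)
  have "(\<integral>x. (U x)\<^sup>2 \<partial>M) \<le> (\<integral>x. 2 * (Z x)\<^sup>2 + 8 * (d x)\<^sup>2 \<partial>M)"
    by (rule integral_mono[OF Ui U2i U2])
  also have "\<dots> = 2 * (\<integral>x. (Z x)\<^sup>2 \<partial>M) + 8 * A"
    using Z2(1) d2 by simp
  also have "\<dots> \<le> b\<^sup>2 + 8 * A" using Z2(2) by simp
  \<comment> \<open>The discarded cross term is nonnegative. The 8 comes from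
    \<open>(Z + 2 * d)^2 \<le> 2 * Z^2 + 8 * d^2\<close>.\<close>
  also have "\<dots> \<le> (b + sqrt 8 * sqrt A)\<^sup>2"
    using nn A0 by (simp add: power2_sum power_mult_distrib)
  finally have sqEU: "sqrt (\<integral>x. (U x)\<^sup>2 \<partial>M) \<le> b + sqrt 8 * sqrt A"
    by (rule real_le_lsqrt[rotated -1]) (use nn A0 in auto)
  have ri: "integrable M r"
    by (rule integrable_const_bound[where B = r_max]) (use r in auto)
  define x0 where "x0 = (\<integral>x. r x \<partial>M)"
  have x0: "0 \<le> x0" unfolding x0_def using r(1) by simp
  have sri: "integrable M (\<lambda>x. (sqrt (r x))\<^sup>2)" and Esr: "(\<integral>x. (sqrt (r x))\<^sup>2 \<partial>M) = x0"
    using ri r(1) by (simp_all add: x0_def)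
  have srm: "(\<lambda>x. sqrt (r x)) \<in> borel_measurable M" by measurable
  have Ur1: "integrable M (\<lambda>x. U x * sqrt (r x))" by (rule integrable_mult_of_squares[OF Um srm Ui sri])
  have "(\<integral>x. U x * sqrt (r x) \<partial>M) \<le> sqrt (\<integral>x. (U x)\<^sup>2 \<partial>M) * sqrt x0"
    using integral_Cauchy_Schwarz[OF Um srm Ui sri] unfolding Esr .
  also have "\<dots> \<le> (b + sqrt 8 * sqrt A) * sqrt x0"
    using sqEU x0 by (intro mult_right_mono) auto
  finally have Ur2: "(\<integral>x. U x * sqrt (r x) \<partial>M) \<le> (b + sqrt 8 * sqrt A) * sqrt x0" .
  have d1: "integrable M d" "(\<integral>x. d x \<partial>M) \<le> sqrt A"
    using integrable_mult_of_squares[OF dm _ d2(1), of "\<lambda>_. 1"] integral_Cauchy_Schwarz[OF dm _ d2(1), of "\<lambda>_. 1"]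
    by (simp_all add: d2(2) prob_space)
  define G where "G x = R + noise x + U x * sqrt (r x) + 2 * sqrt R * d x" for x
  have rG: "r x \<le> G x" and lG: "loss x \<le> G x" for x
    using pathwise[of x] by (simp_all add: G_def U_def algebra_simps)
  have Gi: "integrable M G"
    unfolding G_def[abs_def] using noise(1) Ur1 d1(1) by simp
  have "(\<integral>x. G x \<partial>M) = R + (\<integral>x. U x * sqrt (r x) \<partial>M) + 2 * sqrt R * (\<integral>x. d x \<partial>M)"
    unfolding G_def using noise Ur1 d1(1) by (simp add: prob_space)
  also have "\<dots> \<le> R + (b + sqrt 8 * sqrt A) * sqrt x0 + 2 * sqrt R * sqrt A"
    using Ur2 d1(2) nn by (intro add_mono mult_left_mono) auto
  finally have EG: "(\<integral>x. G x \<partial>M) \<le> R + (b + sqrt 8 * sqrt A) * sqrt x0 + 2 * sqrt A * sqrt R"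
    by (simp add: mult_ac)
  have xG: "x0 \<le> (\<integral>x. G x \<partial>M)"
    unfolding x0_def by (rule integral_mono[OF ri Gi rG])
  have fin: "R + (b + sqrt 8 * sqrt A) * sqrt x0 + 2 * sqrt A * sqrt R \<le> bound"
    unfolding bound_def using xG EG by (intro quadratic_selfbound x0 nn A0) simp
  have li: "integrable M loss"
  proof (rule Bochner_Integration.integrable_bound[OF Gi])
    show "AE x in M. norm (loss x) \<le> norm (G x)"
      using loss0 lG by (auto intro: order_trans[OF _ abs_ge_self])
  qed measurable
  have "(\<integral>x. loss x \<partial>M) \<le> (\<integral>x. G x \<partial>M)"
    by (rule integral_mono[OF li Gi lG])
  then show "(\<integral>x. loss x \<partial>M) \<le> bound" using EG fin by simp
  show "(\<integral>x. r x \<partial>M) \<le> bound" using xG EG fin by (simp add: x0_def)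
qed

text \<open>The oracle inequality multiplied by \<open>n\<close>: in this scaling the coordinates
  are plain inner products, and \<open>b\<close> and \<open>A\<close> carry the costs of selection
  and of estimating the variance.\<close>

lemma mma_expected_loss_bound:
  fixes n M :: nat and X :: "nat \<Rightarrow> nat \<Rightarrow> real" and f :: "nat \<Rightarrow> real" and k :: "nat \<Rightarrow> nat"
    and sh :: "(nat \<Rightarrow> real) \<Rightarrow> real" and wh :: "(nat \<Rightarrow> real) \<Rightarrow> nat \<Rightarrow> real"
  assumes K: "0 < K" and nd: "noise_dist D \<sigma> K" and n: "1 \<le> n"
    and rank: "full_col_rank n p X" and nest: "nested_sizes M k p"
    and shm: "(\<lambda>\<epsilon>. sh (obs n f \<epsilon>)) \<in> borel_measurable (noise_space n D)"
    and shi: "integrable (noise_space n D) (\<lambda>\<epsilon>. (sh (obs n f \<epsilon>))\<^sup>2)"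
    and wh: "\<And>y. wh y \<in> weights M"
    and opt: "\<And>y w. w \<in> weights M \<Longrightarrow> mma_crit n X M k (sh y) y (wh y) \<le> mma_crit n X M k (sh y) y w"
    and whm: "\<And>m. (\<lambda>\<epsilon>. wh (obs n f \<epsilon>) m) \<in> borel_measurable (noise_space n D)"
    and ws: "ws \<in> weights M"
  defines "R \<equiv> real n * risk n X M k \<sigma> f ws"
    and "A \<equiv> real (k M) / \<sigma>\<^sup>2 * (\<integral>\<epsilon>. (sh (obs n f \<epsilon>) - \<sigma>\<^sup>2)\<^sup>2 \<partial>noise_space n D)"
    and "b \<equiv> 16 * sqrt (K\<^sup>2 + 4096 * K^4) * \<sigma> * sqrt (psi n X f M k)"
  defines "bound \<equiv> R + 3 * b\<^sup>2 + 25 * A + b * sqrt R + 5 * (sqrt A * sqrt R)"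
  shows "(\<integral>\<epsilon>. (\<Sum>i<n. (mat_vec n (Pw n X M k (wh (obs n f \<epsilon>))) (obs n f \<epsilon>) i - f i)\<^sup>2) \<partial>noise_space n D) \<le> bound"
    and "(\<integral>\<epsilon>. real n * risk n X M k \<sigma> f (wh (obs n f \<epsilon>)) \<partial>noise_space n D) \<le> bound"
    and "0 \<le> R" and "0 \<le> A"
proof -
  define P where "P = noise_space n D"
  interpret P: prob_space P unfolding P_def by (rule noise_space_prob[OF nd])
  note [measurable] = shm[folded P_def] whm[folded P_def]
  have s: "0 < \<sigma>" using noise_distD[OF nd] by simp
  have M: "1 \<le> M" using nest by (simp add: nested_sizes_def)
  define kk where "kk = k(0 := 0)"
  have kkM: "kk M = k M" using M by (simp add: kk_def)
  have kk0: "kk 0 = 0" by (simp add: kk_def)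
  have kless: "kk m < kk (Suc m)" if "m < M" for m
    unfolding kk_def by (rule nested_sizes_less[OF nest that])
  have kkpos: "0 < kk m" if "m \<in> {1..M}" for m
    using strict_mono_upto_less[where k = kk and M = M, OF kless, of 0 m] that by (auto simp: kk_def)
  have kp: "\<forall>m\<in>{1..M}. k m \<le> k M" "k M \<le> p"
  proof (intro ballI)
    fix m assume m: "m \<in> {1..M}"
    have "kk m \<le> kk M"
      using strict_mono_upto_less[where k = kk and M = M, OF kless, of m M] m by (cases "m = M") force+
    then show "k m \<le> k M" using m by (simp add: kk_def)
  qed (use nest in \<open>simp add: nested_sizes_def\<close>)
  have shrink_kk: "shrink M k = shrink M kk" by (simp add: kk_def shrink_upd_0 fun_eq_iff)
  define a where "a l = inner_n n (phi n X l) f" for l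
  define e where "e \<epsilon> l = inner_n n (phi n X l) \<epsilon>" for \<epsilon> l
  have em[measurable]: "(\<lambda>\<epsilon>. e \<epsilon> l) \<in> borel_measurable P" for l
    unfolding e_def P_def by (rule inner_n_measurable_noise[OF nd])
  \<comment> \<open>Energy of \<open>f\<close> outside the largest candidate; no choice of weights
    can reduce it.\<close>
  define b0 where "b0 = (\<Sum>i<n. (f i)\<^sup>2) - (\<Sum>l=1..kk M. (a l)\<^sup>2)"
  have on: "orthonormal_on n {1..kk M} (phi n X)"
    unfolding kkM by (rule orthonormal_candidates[OF rank kp])
  have b0: "0 \<le> b0"
    unfolding b0_def a_def using bessel_inequality[OF on, of f] by simp
  define rsk where "rsk w = b0 + (\<Sum>l=1..kk M. (1 - shrink M kk w l)\<^sup>2 * (a l)\<^sup>2) + \<sigma>\<^sup>2 * (\<Sum>l=1..kk M. (shrink M kk w l)\<^sup>2)" for w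
  have rsk: "real n * risk n X M k \<sigma> f w = rsk w" for w
    using risk_eq_shrink[OF rank kp, of \<sigma> f w] n unfolding rsk_def b0_def a_def kkM shrink_kk by simp
  have rsk0: "0 \<le> rsk w" for w
    using b0 by (auto simp: rsk_def intro!: add_nonneg_nonneg sum_nonneg mult_nonneg_nonneg)
  have R_eq: "R = rsk ws" unfolding R_def by (rule rsk)
  show R0: "0 \<le> R" using R_eq rsk0 by simp
  have A_P: "A = real (k M) / \<sigma>\<^sup>2 * (\<integral>\<epsilon>. (sh (obs n f \<epsilon>) - \<sigma>\<^sup>2)\<^sup>2 \<partial>P)"
    by (simp add: A_def P_def)
  show A0: "0 \<le> A" by (simp add: A_P)
  define S where "S m = (\<Sum>l\<in>{kk m<..kk M}. (a l)\<^sup>2)" for m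
  obtain V where psi: "psi n X f M k = V * (1 + ln (real M))\<^sup>2"
    and V1: "(\<Sum>m=1..M. (sqrt (real (kk m)) - sqrt (real (kk (m - 1)))) / (sqrt (real (kk m)) + sqrt (real (kk (m - 1))))) \<le> V"
    and V2: "(\<Sum>m=1..M. (sqrt (S (m - 1)) - sqrt (S m)) / (sqrt (S (m - 1)) + sqrt (S m))) \<le> V"
    and V: "0 \<le> V"
    using psi_dominates_ratio_sums[OF nest n, where X = X and f = f] unfolding kk_def[symmetric] a_def[symmetric] S_def[symmetric] .

  define Lg where "Lg = 1 + ln (real M)"
  have kk: "\<forall>m\<in>{1..M}. 0 < kk m \<and> kk m \<le> kk M"
  proof
    fix m assume m: "m \<in> {1..M}"
    then show "0 < kk m \<and> kk m \<le> kk M"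
      using kkpos[OF m] kp(1)[rule_format, OF m] kkM by (simp add: kk_def)
  qed
  obtain Zb Zv where Zbm[measurable]: "Zb \<in> borel_measurable P" and Zbi: "integrable P (\<lambda>x. (Zb x)\<^sup>2)"
    and Zb2: "(\<integral>x. (Zb x)\<^sup>2 \<partial>P) \<le> 16 * Lg\<^sup>2" and Zb0: "\<And>\<epsilon>. 0 \<le> Zb \<epsilon>"
    and Zvm[measurable]: "Zv \<in> borel_measurable P" and Zvi: "integrable P (\<lambda>x. (Zv x)\<^sup>2)"
    and Zv2: "(\<integral>x. (Zv x)\<^sup>2 \<partial>P) \<le> 16 * Lg\<^sup>2" and Zv0: "\<And>\<epsilon>. 0 \<le> Zv \<epsilon>"
    and T1: "\<And>m \<epsilon>. m < M \<Longrightarrow> - (\<Sum>l\<in>{kk m<..kk M}. a l * e \<epsilon> l) \<le> K * Zb \<epsilon> * \<sigma> * sqrt (S m)"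
    and T2: "\<And>m \<epsilon>. m \<in> {1..M} \<Longrightarrow> (\<Sum>l=1..kk m. (e \<epsilon> l)\<^sup>2 - \<sigma>\<^sup>2) \<le> 64 * K\<^sup>2 * Zv \<epsilon> * \<sigma>\<^sup>2 * sqrt (real (kk m))"
    unfolding P_def Lg_def e_def S_def by (rule maximal_deviations[where k = kk and a = a and M = M, OF K nd M kk on]) blast+
  have Z0: "0 \<le> Zb \<epsilon>" "0 \<le> Zv \<epsilon>" for \<epsilon> by (simp_all add: Zb0 Zv0)

  define y where "y \<epsilon> = obs n f \<epsilon>" for \<epsilon>
  define w where "w \<epsilon> = wh (y \<epsilon>)" for \<epsilon>
  define d where "d \<epsilon> = sh (y \<epsilon>) - \<sigma>\<^sup>2" for \<epsilon>
  define r where "r \<epsilon> = rsk (w \<epsilon>)" for \<epsilon>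
  define noise where "noise \<epsilon> = 2 * (\<Sum>l=1..kk M. (1 - shrink M kk ws l)\<^sup>2 * (a l * e \<epsilon> l))
         - (\<Sum>l=1..kk M. (2 * shrink M kk ws l - (shrink M kk ws l)\<^sup>2) * ((e \<epsilon> l)\<^sup>2 - \<sigma>\<^sup>2))" for \<epsilon>
  define loss where "loss \<epsilon> = b0 + (\<Sum>l=1..kk M. (shrink M kk (w \<epsilon>) l * (a l + e \<epsilon> l) - a l)\<^sup>2)" for \<epsilon>
  have loss_eq: "(\<Sum>i<n. (mat_vec n (Pw n X M k (wh (obs n f \<epsilon>))) (obs n f \<epsilon>) i - f i)\<^sup>2) = loss \<epsilon>" for \<epsilon>
    unfolding loss_eq_shrink[OF rank kp] loss_def b0_def a_def e_def w_def y_def kkM shrink_kk inner_n_obs ..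
  define da where "da \<epsilon> = \<bar>d \<epsilon>\<bar> * sqrt (real (k M)) / \<sigma>" for \<epsilon>
  define Z where "Z \<epsilon> = 2 * \<sigma> * sqrt V * (K * Zb \<epsilon> + 64 * K\<^sup>2 * Zv \<epsilon>)" for \<epsilon>
  have pathwise: "r \<epsilon> \<le> R + noise \<epsilon> + Z \<epsilon> * sqrt (r \<epsilon>) + 2 * da \<epsilon> * (sqrt R + sqrt (r \<epsilon>))" (is "_ \<le> ?G")
    "loss \<epsilon> \<le> R + noise \<epsilon> + Z \<epsilon> * sqrt (r \<epsilon>) + 2 * da \<epsilon> * (sqrt R + sqrt (r \<epsilon>))" for \<epsilon>
  proof -
    have cr: "real n * mma_crit n X M k (sh (y \<epsilon>)) (y \<epsilon>) (w \<epsilon>) \<le> real n * mma_crit n X M k (sh (y \<epsilon>)) (y \<epsilon>) ws"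
      unfolding w_def by (intro mult_left_mono opt ws) simp
    have crit: "(\<Sum>l=1..kk M. (1 - shrink M kk (w \<epsilon>) l)\<^sup>2 * (a l + e \<epsilon> l)\<^sup>2) + 2 * sh (y \<epsilon>) * (\<Sum>l=1..kk M. shrink M kk (w \<epsilon>) l)
       \<le> (\<Sum>l=1..kk M. (1 - shrink M kk ws l)\<^sup>2 * (a l + e \<epsilon> l)\<^sup>2) + 2 * sh (y \<epsilon>) * (\<Sum>l=1..kk M. shrink M kk ws l)"
      using cr n unfolding crit_eq_shrink[OF rank kp n[unfolded One_nat_def Suc_le_eq]] a_def e_def kkM shrink_kk
      unfolding y_def inner_n_obs by simp
    have wM: "w \<epsilon> \<in> weights M" by (simp add: w_def wh)
    have Z: "0 \<le> K * Zb \<epsilon>" "0 \<le> 64 * K\<^sup>2 * Zv \<epsilon>" using K Z0 by auto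
    have B: "rsk ws + noise \<epsilon> + 2 * \<sigma> * sqrt V * (K * Zb \<epsilon> + 64 * K\<^sup>2 * Zv \<epsilon>) * sqrt (rsk (w \<epsilon>))
         + 2 * \<bar>sh (y \<epsilon>) - \<sigma>\<^sup>2\<bar> * sqrt (real (kk M)) / \<sigma> * (sqrt (rsk ws) + sqrt (rsk (w \<epsilon>))) = ?G"
      unfolding Z_def da_def d_def r_def R_eq kkM by simp
    note pb = mma_pathwise_bound[where k = kk and M = M and a = a and e = "e \<epsilon>" and S = S and w = "w \<epsilon>" and ws = ws
        and ?Z1.0 = "K * Zb \<epsilon>" and ?Z2.0 = "64 * K\<^sup>2 * Zv \<epsilon>" and s = \<sigma> and ?b0.0 = b0 and V = V and h = "sh (y \<epsilon>)",
        OF kk0 kless wM ws S_def T1 T2 Z s b0 V1 V2 V crit, folded rsk_def noise_def, unfolded B, folded r_def loss_def]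
    show "r \<epsilon> \<le> ?G" "loss \<epsilon> \<le> ?G" by (rule pb; assumption)+
  qed

  have shP: "integrable P (\<lambda>\<epsilon>. (sh (y \<epsilon>))\<^sup>2)"
    using shi by (simp add: P_def y_def)
  have sh1: "integrable P (\<lambda>\<epsilon>. sh (y \<epsilon>))"
  proof (rule Bochner_Integration.integrable_bound)
    show "integrable P (\<lambda>\<epsilon>. 1 + (sh (y \<epsilon>))\<^sup>2)" using shP by simp
    show "(\<lambda>\<epsilon>. sh (y \<epsilon>)) \<in> borel_measurable P" unfolding y_def by measurable
    have "\<bar>t\<bar> \<le> 1 + t\<^sup>2" for t :: real
      using sum_squares_bound[of "\<bar>t\<bar>" 1] by simp
    then show "AE \<epsilon> in P. norm (sh (y \<epsilon>)) \<le> norm (1 + (sh (y \<epsilon>))\<^sup>2)" by simp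
  qed
  have d_int: "integrable P (\<lambda>\<epsilon>. (d \<epsilon>)\<^sup>2)"
    unfolding d_def power2_diff using sh1 shP by simp
  have dm[measurable]: "d \<in> borel_measurable P" unfolding d_def[abs_def] y_def by measurable
  have da2: "(da \<epsilon>)\<^sup>2 = real (k M) / \<sigma>\<^sup>2 * (d \<epsilon>)\<^sup>2" for \<epsilon>
    by (simp add: da_def power_divide power_mult_distrib)
  have dai: "integrable P (\<lambda>\<epsilon>. (da \<epsilon>)\<^sup>2)" unfolding da2 using d_int by simp
  have Eda: "(\<integral>\<epsilon>. (da \<epsilon>)\<^sup>2 \<partial>P) = A"
    unfolding da2 A_P by (simp add: d_def y_def)
  have dam: "da \<in> borel_measurable P" unfolding da_def[abs_def] by measurable
  have Zm: "Z \<in> borel_measurable P" unfolding Z_def[abs_def] by measurable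
  have Z2: "(Z \<epsilon>)\<^sup>2 \<le> 8 * (\<sigma>\<^sup>2 * V) * (K\<^sup>2 * (Zb \<epsilon>)\<^sup>2 + 4096 * K^4 * (Zv \<epsilon>)\<^sup>2)" for \<epsilon>
  proof -
    have "(Z \<epsilon>)\<^sup>2 = 4 * (\<sigma>\<^sup>2 * V) * (K * Zb \<epsilon> + 64 * K\<^sup>2 * Zv \<epsilon>)\<^sup>2"
      using V by (simp add: Z_def power_mult_distrib)
    also have "\<dots> \<le> 4 * (\<sigma>\<^sup>2 * V) * (2 * (K * Zb \<epsilon>)\<^sup>2 + 2 * (64 * K\<^sup>2 * Zv \<epsilon>)\<^sup>2)"
      using V sum_squares_bound[of "K * Zb \<epsilon>" "64 * K\<^sup>2 * Zv \<epsilon>"] by (intro mult_left_mono) (auto simp: power2_sum)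
    also have "\<dots> = 8 * (\<sigma>\<^sup>2 * V) * (K\<^sup>2 * (Zb \<epsilon>)\<^sup>2 + 4096 * K^4 * (Zv \<epsilon>)\<^sup>2)"
      by (simp add: power_mult_distrib algebra_simps)
    finally show ?thesis .
  qed
  have Z2bi: "integrable P (\<lambda>\<epsilon>. 8 * (\<sigma>\<^sup>2 * V) * (K\<^sup>2 * (Zb \<epsilon>)\<^sup>2 + 4096 * K^4 * (Zv \<epsilon>)\<^sup>2))"
    using Zbi Zvi by simp
  have Zi: "integrable P (\<lambda>\<epsilon>. (Z \<epsilon>)\<^sup>2)"
    by (rule Bochner_Integration.integrable_bound[OF Z2bi])
      (use Z2 Zm in \<open>auto intro: order_trans[OF _ abs_ge_self]\<close>)
  have b0': "0 \<le> b"
    using s V by (simp add: b_def psi)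
  \<comment> \<open>The 256 is \<open>2 * 8 * 16\<close>: the factor required by
    \<open>expected_selfbound\<close>, the expansion in \<open>Z2\<close> and the moment bound of
    the soft maxima. The 4096 is the square of the 64 in the quadratic deviation.\<close>
  have b2: "b\<^sup>2 = 256 * (\<sigma>\<^sup>2 * V) * (K\<^sup>2 + 4096 * K^4) * Lg\<^sup>2"
    using V by (simp add: b_def psi power_mult_distrib Lg_def)
  have EZ: "2 * (\<integral>\<epsilon>. (Z \<epsilon>)\<^sup>2 \<partial>P) \<le> b\<^sup>2"
  proof -
    have "(\<integral>\<epsilon>. (Z \<epsilon>)\<^sup>2 \<partial>P) \<le> (\<integral>\<epsilon>. 8 * (\<sigma>\<^sup>2 * V) * (K\<^sup>2 * (Zb \<epsilon>)\<^sup>2 + 4096 * K^4 * (Zv \<epsilon>)\<^sup>2) \<partial>P)"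
      by (rule integral_mono[OF Zi Z2bi Z2])
    also have "\<dots> = 8 * (\<sigma>\<^sup>2 * V) * (K\<^sup>2 * (\<integral>\<epsilon>. (Zb \<epsilon>)\<^sup>2 \<partial>P) + 4096 * K^4 * (\<integral>\<epsilon>. (Zv \<epsilon>)\<^sup>2 \<partial>P))"
      using Zbi Zvi by simp
    also have "\<dots> \<le> 8 * (\<sigma>\<^sup>2 * V) * (K\<^sup>2 * (16 * Lg\<^sup>2) + 4096 * K^4 * (16 * Lg\<^sup>2))"
      using V Zb2 Zv2 by (intro add_mono mult_left_mono) auto
    finally show ?thesis unfolding b2 by (simp add: algebra_simps)
  qed

  have shrm[measurable]: "(\<lambda>\<epsilon>. shrink M kk (w \<epsilon>) l) \<in> borel_measurable P" for l
    unfolding shrink_def w_def y_def by measurable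
  have rm[measurable]: "r \<in> borel_measurable P" unfolding r_def[abs_def] rsk_def by measurable
  have lm[measurable]: "loss \<in> borel_measurable P" unfolding loss_def[abs_def] by measurable
  have r0: "0 \<le> r \<epsilon>" for \<epsilon> by (simp add: r_def rsk0)
  \<comment> \<open>All eigenvalues lie in the unit interval, so the risk at random weights has a
    deterministic bound.\<close>
  have r_le: "r \<epsilon> \<le> b0 + (\<Sum>l=1..kk M. (a l)\<^sup>2) + \<sigma>\<^sup>2 * real (kk M)" for \<epsilon>
  proof -
    have g: "0 \<le> shrink M kk (w \<epsilon>) l" "shrink M kk (w \<epsilon>) l \<le> 1" for l
      using shrink_bounds[OF wh] by (auto simp: w_def)
    have g2: "(1 - shrink M kk (w \<epsilon>) l)\<^sup>2 \<le> 1" "(shrink M kk (w \<epsilon>) l)\<^sup>2 \<le> 1" for l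
      using g[of l] by (auto intro!: power_le_one)
    have "(\<Sum>l=1..kk M. (shrink M kk (w \<epsilon>) l)\<^sup>2) \<le> (\<Sum>l=1..kk M. 1)"
      by (intro sum_mono g2)
    moreover have "(\<Sum>l=1..kk M. (1 - shrink M kk (w \<epsilon>) l)\<^sup>2 * (a l)\<^sup>2) \<le> (\<Sum>l=1..kk M. (a l)\<^sup>2)"
      using g2 by (intro sum_mono) (simp add: mult_left_le_one_le)
    ultimately show ?thesis
      unfolding r_def rsk_def by (intro add_mono mult_left_mono) auto
  qed
  have noise: "integrable P noise" "(\<integral>\<epsilon>. noise \<epsilon> \<partial>P) = 0"
  proof -
    have e1: "integrable P (\<lambda>\<epsilon>. a l * e \<epsilon> l)" "(\<integral>\<epsilon>. a l * e \<epsilon> l \<partial>P) = 0" for l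
      using noise_inner_integrable[OF nd, of n "phi n X l"] noise_inner_mean[OF nd, of n "phi n X l"]
      by (simp_all add: e_def P_def)
    have e2: "integrable P (\<lambda>\<epsilon>. (e \<epsilon> l)\<^sup>2 - \<sigma>\<^sup>2)" "(\<integral>\<epsilon>. (e \<epsilon> l)\<^sup>2 - \<sigma>\<^sup>2 \<partial>P) = 0" if "l \<in> {1..kk M}" for l
    proof -
      have i: "integrable P (\<lambda>\<epsilon>. (e \<epsilon> l)\<^sup>2)"
        unfolding e_def P_def by (rule noise_inner_square_integrable[OF nd])
      then show "integrable P (\<lambda>\<epsilon>. (e \<epsilon> l)\<^sup>2 - \<sigma>\<^sup>2)" by simp
      have "inner_n n (phi n X l) (phi n X l) = 1" using on that unfolding orthonormal_on_def by auto
      then have "(\<integral>\<epsilon>. (e \<epsilon> l)\<^sup>2 \<partial>P) = \<sigma>\<^sup>2"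
        unfolding e_def P_def using noise_inner_variance[OF nd, of n "phi n X l"] by simp
      then show "(\<integral>\<epsilon>. (e \<epsilon> l)\<^sup>2 - \<sigma>\<^sup>2 \<partial>P) = 0" using i by (simp add: P.prob_space)
    qed
    note z1 = sum_integrable_mean_zero[where J = "{1..kk M}" and h = "\<lambda>l \<epsilon>. a l * e \<epsilon> l" and P = P, OF e1]
    note z2 = sum_integrable_mean_zero[where J = "{1..kk M}" and h = "\<lambda>l \<epsilon>. (e \<epsilon> l)\<^sup>2 - \<sigma>\<^sup>2" and P = P, OF e2]
    show "integrable P noise"
      unfolding noise_def[abs_def] by (intro Bochner_Integration.integrable_diff integrable_mult_right z1(1) z2(1))
    show "(\<integral>\<epsilon>. noise \<epsilon> \<partial>P) = 0"
      unfolding noise_def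
      by (subst Bochner_Integration.integral_diff[OF integrable_mult_right[OF z1(1)] z2(1)])
        (assumption | simp only: integral_mult_right_zero z1(2) z2(2) mult_zero_right diff_0_right)+
  qed
  have loss0: "0 \<le> loss \<epsilon>" for \<epsilon> using b0 by (simp add: loss_def sum_nonneg)
  note expected = P.expected_selfbound[OF rm lm Zm dam r0 r_le loss0 noise Zi EZ dai Eda R0 b0' pathwise, folded bound_def]
  show "(\<integral>\<epsilon>. (\<Sum>i<n. (mat_vec n (Pw n X M k (wh (obs n f \<epsilon>))) (obs n f \<epsilon>) i - f i)\<^sup>2) \<partial>noise_space n D) \<le> bound"
    unfolding loss_eq P_def[symmetric] by (rule expected(2))
  show "(\<integral>\<epsilon>. real n * risk n X M k \<sigma> f (wh (obs n f \<epsilon>)) \<partial>noise_space n D) \<le> bound"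
    using expected(1) unfolding rsk r_def w_def y_def P_def[symmetric] .
qed

text \<open>Division by \<open>n\<close>. The mixed terms are geometric means, hence
  \<open>b * sqrt R\<close> loses only one factor \<open>sqrt n\<close>. The value of
  \<open>C\<close> dominates the separate constants \<open>3 * c^2\<close>, \<open>c\<close>, 25 and
  5.\<close>

lemma oracle_bound_rescale:
  fixes K \<sigma> Rn \<Psi> a c C :: real and n :: nat
  assumes n: "1 \<le> n" and nn: "0 \<le> \<sigma>" "0 \<le> Rn" "0 \<le> \<Psi>" "0 \<le> a" "0 \<le> c"
    and C: "C = 3 * c\<^sup>2 + c + 25"
  defines "R \<equiv> real n * Rn" and "A \<equiv> real n * a" and "b \<equiv> c * \<sigma> * sqrt \<Psi>"
  shows "(R + 3 * b\<^sup>2 + 25 * A + b * sqrt R + 5 * (sqrt A * sqrt R)) / real n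
    \<le> Rn + C * \<sigma>\<^sup>2 / real n * \<Psi> + C * \<sigma> / sqrt (real n) * sqrt \<Psi> * sqrt Rn + C * (a + sqrt a * sqrt Rn)"
proof -
  have nsq: "real n = sqrt (real n) * sqrt (real n)" and npos: "0 < sqrt (real n)" using n by auto
  have C_ge: "3 * c\<^sup>2 \<le> C" "c \<le> C" "25 \<le> C" "5 \<le> C" using nn by (auto simp: C)
  have t1: "3 * b\<^sup>2 / real n \<le> C * \<sigma>\<^sup>2 / real n * \<Psi>"
  proof -
    have "3 * b\<^sup>2 / real n = 3 * c\<^sup>2 * (\<sigma>\<^sup>2 / real n * \<Psi>)"
      using nn by (simp add: b_def power_mult_distrib)
    also have "\<dots> \<le> C * (\<sigma>\<^sup>2 / real n * \<Psi>)"
      using nn C_ge by (intro mult_right_mono) auto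
    finally show ?thesis by simp
  qed
  have t2: "b * sqrt R / real n \<le> C * \<sigma> / sqrt (real n) * sqrt \<Psi> * sqrt Rn"
  proof -
    have "b * sqrt R / real n = c * (\<sigma> * sqrt \<Psi> * sqrt Rn * (sqrt (real n) / real n))"
      by (simp add: b_def R_def real_sqrt_mult)
    also have "sqrt (real n) / real n = 1 / sqrt (real n)"
      using npos nsq by (metis divide_self_if nonzero_divide_mult_cancel_left order_less_irrefl)
    also have "c * (\<sigma> * sqrt \<Psi> * sqrt Rn * (1 / sqrt (real n))) \<le> C * (\<sigma> * sqrt \<Psi> * sqrt Rn * (1 / sqrt (real n)))"
      using nn C_ge by (intro mult_right_mono) auto
    finally show ?thesis by (simp add: mult_ac)
  qed
  have t3: "25 * A / real n \<le> C * a"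
    using n nn C_ge by (simp add: A_def mult_right_mono)
  have t4: "5 * (sqrt A * sqrt R) / real n \<le> C * (sqrt a * sqrt Rn)"
  proof -
    have "sqrt A * sqrt R = real n * (sqrt a * sqrt Rn)"
      by (simp add: A_def R_def real_sqrt_mult)
    then have "5 * (sqrt A * sqrt R) / real n = 5 * (sqrt a * sqrt Rn)"
      using n by simp
    also have "\<dots> \<le> C * (sqrt a * sqrt Rn)"
      using nn C_ge by (intro mult_right_mono) auto
    finally show ?thesis .
  qed
  have "R / real n = Rn" using n by (simp add: R_def)
  then show ?thesis
    using t1 t2 t3 t4 by (simp add: add_divide_distrib distrib_left)
qed

theorem theorem1:
  fixes K :: real
  assumes "K > 0"
  shows "\<exists>C>0. \<forall>(D::real measure) (\<sigma>::real) (p::nat \<Rightarrow> nat) (X::nat \<Rightarrow> nat \<Rightarrow> nat \<Rightarrow> real)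
      (\<beta>::nat \<Rightarrow> nat \<Rightarrow> real) (M::nat \<Rightarrow> nat) (k::nat \<Rightarrow> nat \<Rightarrow> nat)
      (sh::nat \<Rightarrow> (nat \<Rightarrow> real) \<Rightarrow> real) (wh::nat \<Rightarrow> (nat \<Rightarrow> real) \<Rightarrow> nat \<Rightarrow> real).
    noise_dist D \<sigma> K
    \<and> (\<forall>n\<ge>1. p n \<le> n \<and> full_col_rank n (p n) (X n) \<and> nested_sizes (M n) (k n) (p n)
        \<and> (\<lambda>\<epsilon>. sh n (obs n (design_mean n (p n) (X n) (\<beta> n)) \<epsilon>)) \<in> borel_measurable (noise_space n D)
        \<and> integrable (noise_space n D) (\<lambda>\<epsilon>. (sh n (obs n (design_mean n (p n) (X n) (\<beta> n)) \<epsilon>))\<^sup>2)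
        \<and> (\<forall>y. wh n y \<in> weights (M n) \<and>
             (\<forall>w\<in>weights (M n). mma_crit n (X n) (M n) (k n) (sh n y) y (wh n y)
                                 \<le> mma_crit n (X n) (M n) (k n) (sh n y) y w))
        \<and> (\<forall>m. (\<lambda>\<epsilon>. wh n (obs n (design_mean n (p n) (X n) (\<beta> n)) \<epsilon>) m) \<in> borel_measurable (noise_space n D)))
    \<and> limsup (\<lambda>n. ereal ((\<Sum>i<n. (design_mean n (p n) (X n) (\<beta> n) i)\<^sup>2) / real n)) < \<infinity>
    \<longrightarrow> (\<forall>n\<ge>1. \<forall>ws.
          ws \<in> weights (M n) \<and>
          (\<forall>w\<in>weights (M n). risk n (X n) (M n) (k n) \<sigma> (design_mean n (p n) (X n) (\<beta> n)) ws
                               \<le> risk n (X n) (M n) (k n) \<sigma> (design_mean n (p n) (X n) (\<beta> n)) w)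
          \<longrightarrow>
          (let f = design_mean n (p n) (X n) (\<beta> n);
               P = noise_space n D;
               y = obs n f;
               R = risk n (X n) (M n) (k n) \<sigma> f ws;
               \<Psi> = psi n (X n) f (M n) (k n);
               E = integral\<^sup>L P (\<lambda>\<epsilon>. (sh n (y \<epsilon>) - \<sigma>\<^sup>2)\<^sup>2);
               a = real (k n (M n)) / (real n * \<sigma>\<^sup>2) * E;
               \<rho> = a + sqrt a * sqrt R;
               bound = R + C * \<sigma>\<^sup>2 / real n * \<Psi> + C * \<sigma> / sqrt (real n) * sqrt \<Psi> * sqrt R + C * \<rho>
           in integral\<^sup>L P (\<lambda>\<epsilon>. (\<Sum>i<n. (mat_vec n (Pw n (X n) (M n) (k n) (wh n (y \<epsilon>))) (y \<epsilon>) i - f i)\<^sup>2) / real n)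
                \<le> bound
            \<and> integral\<^sup>L P (\<lambda>\<epsilon>. risk n (X n) (M n) (k n) \<sigma> f (wh n (y \<epsilon>))) \<le> bound))"
proof -
  \<comment> \<open>The factor of \<open>\<sigma> * sqrt \<Psi>\<close> in the cost of selection. It
    depends on \<open>K\<close> alone and is fixed before the noise distribution and its
    variance.\<close>
  define c where "c = 16 * sqrt (K\<^sup>2 + 4096 * K^4)"
  define C where "C = 3 * c\<^sup>2 + c + 25"
  have c: "0 \<le> c" by (simp add: c_def)
  have C: "0 < C" using c by (simp add: C_def add_nonneg_pos)
  show ?thesis
  proof (rule exI[of _ C], intro conjI C allI impI, elim conjE)
    fix D :: "real measure" and \<sigma> :: real and p :: "nat \<Rightarrow> nat" and X :: "nat \<Rightarrow> nat \<Rightarrow> nat \<Rightarrow> real"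
      and \<beta> :: "nat \<Rightarrow> nat \<Rightarrow> real" and M :: "nat \<Rightarrow> nat" and k :: "nat \<Rightarrow> nat \<Rightarrow> nat"
      and sh :: "nat \<Rightarrow> (nat \<Rightarrow> real) \<Rightarrow> real" and wh :: "nat \<Rightarrow> (nat \<Rightarrow> real) \<Rightarrow> nat \<Rightarrow> real"
      and n :: nat and ws :: "nat \<Rightarrow> real"
    assume nd: "noise_dist D \<sigma> K" and n: "1 \<le> n" and ws: "ws \<in> weights (M n)"
      and all: "\<forall>n\<ge>1. p n \<le> n \<and> full_col_rank n (p n) (X n) \<and> nested_sizes (M n) (k n) (p n)
        \<and> (\<lambda>\<epsilon>. sh n (obs n (design_mean n (p n) (X n) (\<beta> n)) \<epsilon>)) \<in> borel_measurable (noise_space n D)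
        \<and> integrable (noise_space n D) (\<lambda>\<epsilon>. (sh n (obs n (design_mean n (p n) (X n) (\<beta> n)) \<epsilon>))\<^sup>2)
        \<and> (\<forall>y. wh n y \<in> weights (M n) \<and>
             (\<forall>w\<in>weights (M n). mma_crit n (X n) (M n) (k n) (sh n y) y (wh n y)
                                 \<le> mma_crit n (X n) (M n) (k n) (sh n y) y w))
        \<and> (\<forall>m. (\<lambda>\<epsilon>. wh n (obs n (design_mean n (p n) (X n) (\<beta> n)) \<epsilon>) m) \<in> borel_measurable (noise_space n D))"
    define f where "f = design_mean n (p n) (X n) (\<beta> n)"
    note at_n = all[rule_format, OF n, folded f_def]
    define Rn where "Rn = risk n (X n) (M n) (k n) \<sigma> f ws"
    define \<Psi> where "\<Psi> = psi n (X n) f (M n) (k n)"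
    define E where "E = (\<integral>\<epsilon>. (sh n (obs n f \<epsilon>) - \<sigma>\<^sup>2)\<^sup>2 \<partial>noise_space n D)"
    define a where "a = real (k n (M n)) / (real n * \<sigma>\<^sup>2) * E"
    have s: "0 < \<sigma>" using noise_distD[OF nd] by simp
    have A: "real (k n (M n)) / \<sigma>\<^sup>2 * E = real n * a"
      using n by (simp add: a_def)
    have rank: "full_col_rank n (p n) (X n)" and nest: "nested_sizes (M n) (k n) (p n)"
      using at_n by blast+
    have \<Psi>: "0 \<le> \<Psi>"
    proof -
      obtain V where "psi n (X n) f (M n) (k n) = V * (1 + ln (real (M n)))\<^sup>2" "0 \<le> V"
        using psi_dominates_ratio_sums[OF nest n] by blast
      then show ?thesis by (simp add: \<Psi>_def)
    qed
    note bounds = mma_expected_loss_bound[where sh = "sh n" and wh = "wh n" and f = f and ws = ws,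
        OF assms nd n rank nest, folded \<Psi>_def Rn_def E_def c_def, unfolded A]
    define B where "B = real n * Rn + 3 * (c * \<sigma> * sqrt \<Psi>)\<^sup>2 + 25 * (real n * a) + c * \<sigma> * sqrt \<Psi> * sqrt (real n * Rn)
          + 5 * (sqrt (real n * a) * sqrt (real n * Rn))"
    have B: "(\<integral>\<epsilon>. (\<Sum>i<n. (mat_vec n (Pw n (X n) (M n) (k n) (wh n (obs n f \<epsilon>))) (obs n f \<epsilon>) i - f i)\<^sup>2) \<partial>noise_space n D)
        \<le> B" (is "?loss \<le> _")
      and B': "(\<integral>\<epsilon>. real n * risk n (X n) (M n) (k n) \<sigma> f (wh n (obs n f \<epsilon>)) \<partial>noise_space n D) \<le> B" (is "?risk \<le> _")
      and nn: "0 \<le> real n * Rn" "0 \<le> real n * a"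
      unfolding B_def by (rule bounds; use at_n ws in blast)+
    have "0 \<le> Rn" "0 \<le> a" using nn n by (auto simp: zero_le_mult_iff)
    then have "B / real n \<le> Rn + C * \<sigma>\<^sup>2 / real n * \<Psi> + C * \<sigma> / sqrt (real n) * sqrt \<Psi> * sqrt Rn + C * (a + sqrt a * sqrt Rn)"
      (is "_ \<le> ?bound")
      unfolding B_def using oracle_bound_rescale[OF n less_imp_le[OF s] _ \<Psi> _ c C_def] by blast
    moreover have "?loss / real n \<le> B / real n" "?risk / real n \<le> B / real n"
      by (intro divide_right_mono B B'; simp)+
    ultimately have "?loss / real n \<le> ?bound" "?risk / real n \<le> ?bound"
      by linarith+
    moreover have "?risk / real n = (\<integral>\<epsilon>. risk n (X n) (M n) (k n) \<sigma> f (wh n (obs n f \<epsilon>)) \<partial>noise_space n D)"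
      using n by simp
    ultimately show "let f = design_mean n (p n) (X n) (\<beta> n);
               P = noise_space n D;
               y = obs n f;
               R = risk n (X n) (M n) (k n) \<sigma> f ws;
               \<Psi> = psi n (X n) f (M n) (k n);
               E = integral\<^sup>L P (\<lambda>\<epsilon>. (sh n (y \<epsilon>) - \<sigma>\<^sup>2)\<^sup>2);
               a = real (k n (M n)) / (real n * \<sigma>\<^sup>2) * E;
               \<rho> = a + sqrt a * sqrt R;
               bound = R + C * \<sigma>\<^sup>2 / real n * \<Psi> + C * \<sigma> / sqrt (real n) * sqrt \<Psi> * sqrt R + C * \<rho>
           in integral\<^sup>L P (\<lambda>\<epsilon>. (\<Sum>i<n. (mat_vec n (Pw n (X n) (M n) (k n) (wh n (y \<epsilon>))) (y \<epsilon>) i - f i)\<^sup>2) / real n)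
                \<le> bound
            \<and> integral\<^sup>L P (\<lambda>\<epsilon>. risk n (X n) (M n) (k n) \<sigma> f (wh n (y \<epsilon>))) \<le> bound"
      unfolding Let_def f_def[symmetric] Rn_def[symmetric] \<Psi>_def[symmetric] E_def[symmetric] a_def[symmetric]
      by simp
  qed
qed

end
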